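(* Let $N$ be a compact subset of an $(n+1)$-dimensional Riemannian manifold $N^*$ and let $k\le n$ be a positive integer. The following are equivalent: (a) $N$ contains no nonzero, stationary, $k$-dimensional varifolds. (b) There is an increasing function $\phi:\mathbf{R}^+\to\mathbf{R}^+$ with $\phi(0)=0$ such that $|V|\le\phi(|\delta V|)$ for every $k$-dimensional varifold $V$ in $N$ with $|\delta V|<\infty$. (c) There is a constant $c<\infty$ such that $|V|\le c\,|\delta V|$ for every $k$-dimensional varifold $V$ in $N$.
   Context: $\mathbf{R}^+=[0,\infty)$. Let $G_k(N)=\{(p,S): p\in N,\ S \text{ a } k\text{-dimensional linear subspace of } T_pN^*\}$. A $k$-dimensional varifold in $N$ is a finite (nonnegative) Borel measure $V$ on $G_k(N)$. Its mass is $|V|=V(G_k(N))$. For a smooth vector field $X$ on $N^*$, $\delta V(X)=\int \mathrm{div}_S X(p)\,dV(p,S)$, where $\mathrm{div}_SX(p)=\sum_{i=1}^k\langle\nabla_{e_i}X,e_i\rangle$ for any orthonormal basis $e_1,\dots,e_k$ of $S$. The total first variation is $|\delta V|=\sup\{\delta V(X): X \text{ smooth on } N^*,\ |X(p)|\le 1 \text{ for all } p\}\in[0,\infty]$. The varifold $V$ is stationary if $\delta V=0$, equivalently $|\delta V|=0$. *)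

theory Defs
  imports "HOL-Analysis.Analysis"
begin

section \<open>Smooth functions on open subsets of Euclidean space\<close>

text \<open>Only used for open \<open>S\<close>: all iterated directional derivatives up to order \<open>m\<close> exist, and those
  of order \<open>m\<close> are continuous, which is class \<open>C\<^sup>m\<close>.\<close>

primrec higher_differentiable_on ::
  "'x::real_normed_vector set \<Rightarrow> ('x \<Rightarrow> 'y::real_normed_vector) \<Rightarrow> nat \<Rightarrow> bool" where
  "higher_differentiable_on S f 0 \<longleftrightarrow> continuous_on S f"
| "higher_differentiable_on S f (Suc m) \<longleftrightarrow>
     (\<forall>x\<in>S. f differentiable (at x)) \<and>
     (\<forall>v. higher_differentiable_on S (\<lambda>x. frechet_derivative f (at x) v) m)"

definition smooth_on :: "'x::real_normed_vector set \<Rightarrow> ('x \<Rightarrow> 'y::real_normed_vector) \<Rightarrow> bool" where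
  "smooth_on S f \<longleftrightarrow> (\<forall>m. higher_differentiable_on S f m)"


section \<open>Smooth manifolds\<close>

text \<open>The manifold is the whole type \<open>'a\<close>, of class \<open>t2_space\<close> and \<open>second_countable_topology\<close>; it is
  modelled on \<open>'b\<close>, so its dimension is \<open>DIM('b)\<close>. A chart is a domain together with a coordinate
  map. Atlases need not be maximal.\<close>

type_synonym ('a, 'b) chart = "'a set \<times> ('a \<Rightarrow> 'b)"

definition chart_image :: "('a, 'b) chart \<Rightarrow> 'b set" where
  "chart_image c = snd c ` fst c"

definition chart_inv :: "('a, 'b) chart \<Rightarrow> 'b \<Rightarrow> 'a" where
  "chart_inv c = inv_into (fst c) (snd c)"

definition transition :: "('a, 'b) chart \<Rightarrow> ('a, 'b) chart \<Rightarrow> 'b \<Rightarrow> 'b" where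
  "transition c d = snd d \<circ> chart_inv c"

definition smooth_atlas ::
  "('a::{t2_space, second_countable_topology}, 'b::euclidean_space) chart set \<Rightarrow> bool" where
  "smooth_atlas A \<longleftrightarrow>
     (\<forall>c\<in>A. open (fst c) \<and> open (chart_image c) \<and>
            homeomorphism (fst c) (chart_image c) (snd c) (chart_inv c)) \<and>
     (\<Union>c\<in>A. fst c) = UNIV \<and>
     (\<forall>c\<in>A. \<forall>d\<in>A. smooth_on (snd c ` (fst c \<inter> fst d)) (transition c d))"

text \<open>Each point \<open>p\<close> has a preferred chart, and a tangent vector at \<open>p\<close> is represented by its
  coordinates in that chart. Thus every tangent space is a copy of the vector space \<open>'b\<close>; its
  inner product is the Riemannian one below, not the inner product of \<open>'b\<close>. The coordinates of
  a tangent vector in another chart are obtained from the derivative of the transition map.\<close>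

definition chart_at :: "('a, 'b) chart set \<Rightarrow> 'a \<Rightarrow> ('a, 'b) chart" where
  "chart_at A p = (SOME c. c \<in> A \<and> p \<in> fst c)"

definition tangent_change ::
  "('a, 'b::euclidean_space) chart \<Rightarrow> ('a, 'b) chart \<Rightarrow> 'a \<Rightarrow> 'b \<Rightarrow> 'b" where
  "tangent_change c d p = frechet_derivative (transition c d) (at (snd c p))"

definition to_chart ::
  "('a, 'b::euclidean_space) chart set \<Rightarrow> ('a, 'b) chart \<Rightarrow> 'a \<Rightarrow> 'b \<Rightarrow> 'b" where
  "to_chart A c p = tangent_change (chart_at A p) c p"

definition from_chart ::
  "('a, 'b::euclidean_space) chart set \<Rightarrow> ('a, 'b) chart \<Rightarrow> 'a \<Rightarrow> 'b \<Rightarrow> 'b" where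
  "from_chart A c p = tangent_change c (chart_at A p) p"

text \<open>A vector field assigns to \<open>p\<close> an element of the tangent space at \<open>p\<close>.\<close>

definition vf_rep ::
  "('a, 'b::euclidean_space) chart set \<Rightarrow> ('a \<Rightarrow> 'b) \<Rightarrow> ('a, 'b) chart \<Rightarrow> 'b \<Rightarrow> 'b" where
  "vf_rep A X c x = to_chart A c (chart_inv c x) (X (chart_inv c x))"

definition smooth_vector_field ::
  "('a, 'b::euclidean_space) chart set \<Rightarrow> ('a \<Rightarrow> 'b) \<Rightarrow> bool" where
  "smooth_vector_field A X \<longleftrightarrow> (\<forall>c\<in>A. smooth_on (chart_image c) (vf_rep A X c))"


section \<open>Riemannian metrics and the Levi-Civita connection\<close>

definition metric_rep ::
  "('a, 'b::euclidean_space) chart set \<Rightarrow> ('a \<Rightarrow> 'b \<Rightarrow> 'b \<Rightarrow> real) \<Rightarrow> ('a, 'b) chart \<Rightarrow>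
   'b \<Rightarrow> 'b \<Rightarrow> 'b \<Rightarrow> real" where
  "metric_rep A g c x u v =
     g (chart_inv c x) (from_chart A c (chart_inv c x) u) (from_chart A c (chart_inv c x) v)"

definition riemannian_metric ::
  "('a, 'b::euclidean_space) chart set \<Rightarrow> ('a \<Rightarrow> 'b \<Rightarrow> 'b \<Rightarrow> real) \<Rightarrow> bool" where
  "riemannian_metric A g \<longleftrightarrow>
     (\<forall>p. bilinear (g p) \<and> (\<forall>u v. g p u v = g p v u) \<and> (\<forall>v. v \<noteq> 0 \<longrightarrow> g p v v > 0)) \<and>
     (\<forall>c\<in>A. \<forall>u v. smooth_on (chart_image c) (\<lambda>x. metric_rep A g c x u v))"

definition metric_deriv ::
  "('a, 'b::euclidean_space) chart set \<Rightarrow> ('a \<Rightarrow> 'b \<Rightarrow> 'b \<Rightarrow> real) \<Rightarrow> ('a, 'b) chart \<Rightarrow>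
   'b \<Rightarrow> 'b \<Rightarrow> 'b \<Rightarrow> 'b \<Rightarrow> real" where
  "metric_deriv A g c x z u v = frechet_derivative (\<lambda>y. metric_rep A g c y u v) (at x) z"

text \<open>The Christoffel symbols of the chart \<open>c\<close>, as the vector \<open>\<Gamma>(u, v) = \<Gamma>\<^sup>l\<^sub>i\<^sub>j u\<^sup>i v\<^sup>j \<partial>\<^sub>l\<close>: the
  vector is determined by its products with all \<open>z\<close>, and
  \<open>g(\<Gamma>(u, v), z) = 1/2 (\<partial>\<^sub>u g(v, z) + \<partial>\<^sub>v g(u, z) - \<partial>\<^sub>z g(u, v))\<close> is Koszul's formula for
  constant coordinate vector fields.\<close>

definition christoffel ::
  "('a, 'b::euclidean_space) chart set \<Rightarrow> ('a \<Rightarrow> 'b \<Rightarrow> 'b \<Rightarrow> real) \<Rightarrow> ('a, 'b) chart \<Rightarrow>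
   'b \<Rightarrow> 'b \<Rightarrow> 'b \<Rightarrow> 'b" where
  "christoffel A g c x u v =
     (THE w. \<forall>z. metric_rep A g c x w z =
        (metric_deriv A g c x u v z + metric_deriv A g c x v u z - metric_deriv A g c x z u v) / 2)"

text \<open>The Levi-Civita derivative \<open>\<nabla>\<^sub>v X\<close> at \<open>p\<close>, for \<open>v\<close> and the result in the tangent space at \<open>p\<close>;
  \<open>v\<close> is its own coordinate vector in the preferred chart at \<open>p\<close>.\<close>

definition covariant_derivative ::
  "('a, 'b::euclidean_space) chart set \<Rightarrow> ('a \<Rightarrow> 'b \<Rightarrow> 'b \<Rightarrow> real) \<Rightarrow> ('a \<Rightarrow> 'b) \<Rightarrow> 'a \<Rightarrow> 'b \<Rightarrow> 'b" where
  "covariant_derivative A g X p v =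
     (let c = chart_at A p; x = snd c p in
        frechet_derivative (vf_rep A X c) (at x) v + christoffel A g c x v (vf_rep A X c x))"

definition orthonormal_basis ::
  "('a \<Rightarrow> 'b::euclidean_space \<Rightarrow> 'b \<Rightarrow> real) \<Rightarrow> 'a \<Rightarrow> 'b set \<Rightarrow> 'b set \<Rightarrow> bool" where
  "orthonormal_basis g p S E \<longleftrightarrow>
     finite E \<and> span E = S \<and> (\<forall>u\<in>E. \<forall>v\<in>E. g p u v = (if u = v then 1 else 0))"

text \<open>The sum does not depend on the orthonormal basis.\<close>

definition div_on ::
  "('a, 'b::euclidean_space) chart set \<Rightarrow> ('a \<Rightarrow> 'b \<Rightarrow> 'b \<Rightarrow> real) \<Rightarrow> ('a \<Rightarrow> 'b) \<Rightarrow> 'a \<Rightarrow> 'b set \<Rightarrow> real" where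
  "div_on A g X p S =
     (let E = (SOME E. orthonormal_basis g p S E) in \<Sum>e\<in>E. g p (covariant_derivative A g X p e) e)"


section \<open>The Grassmann bundle\<close>

definition grassmann_bundle :: "nat \<Rightarrow> 'a set \<Rightarrow> ('a \<times> 'b::euclidean_space set) set" where
  "grassmann_bundle k N = {(p, S). p \<in> N \<and> subspace S \<and> dim S = k}"

text \<open>Subspaces of the model space are topologised through their orthogonal projections.\<close>

definition proj_onto :: "'b::euclidean_space set \<Rightarrow> 'b \<Rightarrow>\<^sub>L 'b" where
  "proj_onto S = Blinfun (closest_point S)"

lemma bounded_linear_closest_point:
  fixes S :: "'b::euclidean_space set"
  assumes "subspace S"
  shows "bounded_linear (closest_point S)"
proof -
  have cl: "closed S" and cv: "convex S" and ne: "S \<noteq> {}"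
    using assms closed_subspace subspace_imp_convex subspace_0 by auto
  have eq: "closest_point S a = b" if b: "b \<in> S" and o: "\<And>z. z \<in> S \<Longrightarrow> (a - b) \<bullet> z = 0" for a b
  proof -
    have "dist a b \<le> dist a z" if "z \<in> S" for z
    proof -
      have "(a - b) \<bullet> (b - z) = 0"
        using o that b assms subspace_diff by blast
      then have "(norm ((a - b) + (b - z)))\<^sup>2 = (norm (a - b))\<^sup>2 + (norm (b - z))\<^sup>2"
        using norm_add_Pythagorean[of "a - b" "b - z"] by (simp only: orthogonal_def)
      then have "(norm (a - b))\<^sup>2 \<le> (norm (a - z))\<^sup>2" by simp
      then show ?thesis by (simp add: dist_norm)
    qed
    then show ?thesis
      using closest_point_unique[OF cv cl b] by auto
  qed
  have ortho: "(a - closest_point S a) \<bullet> z = 0" and mem: "closest_point S a \<in> S" if "z \<in> S" for a z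
  proof -
    obtain b d where bd: "b \<in> span S" "\<And>w. w \<in> span S \<Longrightarrow> orthogonal d w" "a = b + d"
      using orthogonal_subspace_decomp_exists[of S a] by metis
    have sp: "span S = S" using assms by (simp add: span_eq_iff)
    note bd = bd[unfolded sp orthogonal_def]
    have "closest_point S a = b"
      using bd by (intro eq) auto
    then show "(a - closest_point S a) \<bullet> z = 0" "closest_point S a \<in> S"
      using bd that by auto
  qed
  have "linear (closest_point S)"
  proof (rule linearI)
    fix a b :: 'b and r :: real
    show "closest_point S (a + b) = closest_point S a + closest_point S b"
    proof (rule eq)
      show "closest_point S a + closest_point S b \<in> S"
        using assms ne mem subspace_add by blast
      fix z assume "z \<in> S"
      then show "(a + b - (closest_point S a + closest_point S b)) \<bullet> z = 0"
        using ortho[of z a] ortho[of z b] by (simp add: algebra_simps)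
    qed
    show "closest_point S (r *\<^sub>R a) = r *\<^sub>R closest_point S a"
    proof (rule eq)
      show "r *\<^sub>R closest_point S a \<in> S"
        using assms ne mem subspace_scale by blast
      fix z assume "z \<in> S"
      then show "(r *\<^sub>R a - r *\<^sub>R closest_point S a) \<bullet> z = 0"
        using ortho[of z a] by (simp flip: scaleR_diff_right)
    qed
  qed
  then show ?thesis by (simp add: linear_conv_bounded_linear)
qed

text \<open>The bundle topology: each chart \<open>c\<close> trivialises the bundle over its domain by
  \<open>(p, S) \<mapsto> (c(p), dc\<^sub>p(S))\<close>.\<close>

definition trivialization ::
  "('a, 'b::euclidean_space) chart set \<Rightarrow> ('a, 'b) chart \<Rightarrow> 'a \<times> 'b set \<Rightarrow> 'b \<times> ('b \<Rightarrow>\<^sub>L 'b)" where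
  "trivialization A c = (\<lambda>(p, S). (snd c p, proj_onto (to_chart A c p ` S)))"

definition grassmann_topology ::
  "('a, 'b::euclidean_space) chart set \<Rightarrow> nat \<Rightarrow> ('a \<times> 'b set) topology" where
  "grassmann_topology A k = topology_generated_by
     {{q \<in> grassmann_bundle k (fst c). trivialization A c q \<in> W} | c W. c \<in> A \<and> open W}"

definition grassmann_borel ::
  "('a, 'b::euclidean_space) chart set \<Rightarrow> nat \<Rightarrow> 'a set \<Rightarrow> ('a \<times> 'b set) measure" where
  "grassmann_borel A k N = sigma (grassmann_bundle k N)
     {U. openin (subtopology (grassmann_topology A k) (grassmann_bundle k N)) U}"


section \<open>Varifolds\<close>

definition varifold ::
  "('a, 'b::euclidean_space) chart set \<Rightarrow> nat \<Rightarrow> 'a set \<Rightarrow> ('a \<times> 'b set) measure \<Rightarrow> bool" where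
  "varifold A k N V \<longleftrightarrow> finite_measure V \<and> sets V = sets (grassmann_borel A k N)"

definition mass :: "('a \<times> 'b::euclidean_space set) measure \<Rightarrow> real" where
  "mass V = measure V (space V)"

definition first_variation ::
  "('a, 'b::euclidean_space) chart set \<Rightarrow> ('a \<Rightarrow> 'b \<Rightarrow> 'b \<Rightarrow> real) \<Rightarrow>
   ('a \<times> 'b set) measure \<Rightarrow> ('a \<Rightarrow> 'b) \<Rightarrow> real" where
  "first_variation A g V X = (\<integral>(p, S). div_on A g X p S \<partial>V)"

definition total_first_variation ::
  "('a, 'b::euclidean_space) chart set \<Rightarrow> ('a \<Rightarrow> 'b \<Rightarrow> 'b \<Rightarrow> real) \<Rightarrow>
   ('a \<times> 'b set) measure \<Rightarrow> ereal" where
  "total_first_variation A g V =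
     (SUP X \<in> {X. smooth_vector_field A X \<and> (\<forall>p. sqrt (g p (X p) (X p)) \<le> 1)}.
        ereal (first_variation A g V X))"

definition stationary ::
  "('a, 'b::euclidean_space) chart set \<Rightarrow> ('a \<Rightarrow> 'b \<Rightarrow> 'b \<Rightarrow> real) \<Rightarrow>
   ('a \<times> 'b set) measure \<Rightarrow> bool" where
  "stationary A g V \<longleftrightarrow> (\<forall>X. smooth_vector_field A X \<longrightarrow> first_variation A g V X = 0)"

end

(* Only "no stationary varifold implies a linear bound" is hard. If there is no linear bound, then there are
   varifolds V_i of mass 1 whose total first variations tend to 0. The Grassmann bundle over N is
   compact, so a subsequence converges weakly to some V of mass 1, and V annihilates every bounded
   smooth field. An arbitrary smooth field X is the limit, as e tends to 0, of the bounded fields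
   X / (1 + e |X|^2), uniformly on N together with first derivatives; so V is stationary.

   Weak compactness is reduced to Helly's selection theorem on the real line: a compact metric space K
   has a Borel injection into the reals whose inverse is uniformly continuous, hence extends
   continuously to the closure of the image.

   The divergence is continuous on the Grassmann bundle because g(nabla_v X, v) is half of the Lie
   derivative of g along X, evaluated at (v, v). Its coordinate expression involves no Christoffel
   symbols, and its invariance under change of charts rests on the symmetry of second derivatives. *)

theory Submission
  imports Defs "HOL-Probability.Helly_Selection"
begin

text \<open>The ambient manifold need not be compact, so a smooth field may be unbounded away from
  \<open>N\<close>, and then no nonzero multiple of it competes in the supremum that defines the
  total first variation. This is why fields are damped: t / (1 + e t^2) is at most 1 / (2 sqrt e),
  and the square of |X| keeps the factor smooth where X vanishes. The Grassmann bundle comes with a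
  generated topology but no metric. Its part over \<open>N\<close> is therefore presented as a
  continuous image of a compact set in a normed space, a tagged union of finitely many products of a
  coordinate piece with the rank \<open>k\<close> projections. A Borel section leads back; measures
  travel along the section and limits return along the continuous map. A compact space such as a
  sphere does not embed in the line, so the injection into the reals is only Borel. Its inverse is
  the continuous part, and that is what test functions are composed with. The divergence is defined
  by an arbitrarily chosen orthonormal basis, which may jump with the plane. It is rewritten as a
  trace against an operator determined by the metric and the plane; uniqueness of that operator and
  compactness give its continuity.\<close>

section \<open>Weak compactness on compact metric spaces\<close>

text \<open>The leading term has size \<open>(1/4)^i\<close> and the tail at most a third of that,
  so at least two thirds survive. The digits are differences of 0/1 digits; in base 2 the tail could
  cancel the leading term, which is why the base is 4.\<close>

lemma abs_suminf_quarter_powers: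
  fixes d :: "nat \<Rightarrow> real"
  assumes i: "\<bar>d i\<bar> = 1" and less: "\<And>l. l < i \<Longrightarrow> d l = 0" and bound: "\<And>l. \<bar>d l\<bar> \<le> 1"
  shows "(1/4)^i / 2 \<le> \<bar>\<Sum>l. d l * (1/4)^l\<bar>"
proof -
  have sm: "summable (\<lambda>l. d l * (1/4)^l)"
    by (rule summable_comparison_test[OF _ summable_geometric[of "1/4::real"]])
       (use bound in \<open>auto simp: abs_mult mult_left_le_one_le\<close>)
  have "(\<Sum>l. d l * (1/4)^l) = (\<Sum>l. d (l + Suc i) * (1/4)^(l + Suc i)) + (\<Sum>l<Suc i. d l * (1/4)^l)"
    by (rule suminf_split_initial_segment[OF sm])
  also have "(\<Sum>l<Suc i. d l * (1/4)^l) = d i * (1/4)^i"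
    using less by simp
  finally have eq: "(\<Sum>l. d l * (1/4)^l) = (\<Sum>l. d (l + Suc i) * (1/4)^(l + Suc i)) + d i * (1/4)^i" .
  have g: "(\<lambda>l. (1/4)^Suc i * (1/4)^l) sums ((1/4)^Suc i * (4/3 :: real))"
    by (intro sums_mult) (use geometric_sums[of "1/4::real"] in simp)
  have "\<bar>\<Sum>l. d (l + Suc i) * (1/4)^(l + Suc i)\<bar> \<le> (\<Sum>l. (1/4)^Suc i * (1/4)^l)"
    unfolding real_norm_def[symmetric]
    by (rule norm_suminf_le[OF _ sums_summable[OF g]])
       (use bound in \<open>auto simp: abs_mult power_add mult_left_le_one_le\<close>)
  also have "\<dots> = (1/4)^i / 3"
    using sums_unique[OF g] by simp
  finally have "\<bar>\<Sum>l. d (l + Suc i) * (1/4)^(l + Suc i)\<bar> \<le> (1/4)^i / 3" .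
  moreover have "\<bar>d i * (1/4)^i\<bar> = (1/4)^i"
    using i by (simp add: abs_mult)
  moreover have "(1/4::real)^i > 0" by simp
  ultimately show ?thesis
    unfolding eq by linarith
qed

text \<open>The base 4 digits of \<open>s x\<close> record which balls of a countable family contain
  \<open>x\<close>. The family contains a finite cover of \<open>K\<close> by balls of each radius
  \<open>1 / real (Suc n)\<close>; close codes agree on the digits of such a cover, so the points
  share a small ball.\<close>

lemma compact_borel_coding:
  fixes K :: "'c::metric_space set"
  assumes K: "compact K"
  obtains s :: "'c \<Rightarrow> real" where "s \<in> borel_measurable borel"
    "\<And>x. s x \<in> {0..2}"
    "\<And>e. e > 0 \<Longrightarrow> \<exists>\<delta>>0. \<forall>x\<in>K. \<forall>y\<in>K. \<bar>s x - s y\<bar> < \<delta> \<longrightarrow> dist x y < e"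
proof -
  have "\<exists>F. finite F \<and> K \<subseteq> (\<Union>x\<in>F. ball x (1 / real (Suc n)))" for n
    using compact_imp_seq_compact[OF K, THEN seq_compact_imp_totally_bounded, rule_format, of "1 / real (Suc n)"] 
    by auto
  then obtain F where F: "\<And>n. finite (F n)" "\<And>n. K \<subseteq> (\<Union>x\<in>F n. ball x (1 / real (Suc n)))"
    by metis
  \<comment> \<open>The empty set makes the family nonempty even if \<open>K\<close> is empty, so
    that \<open>from_nat_into\<close> enumerates exactly this family.\<close>
  define \<U> where "\<U> = insert {} (\<Union>n. (\<lambda>x. ball x (1 / real (Suc n))) ` F n)"
  have cU: "countable \<U>"
    unfolding \<U>_def using F(1) by (intro countable_insert countable_UN countable_image) (auto intro: countable_finite)
  define U where "U = from_nat_into \<U>"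
  have rU: "range U = \<U>"
    unfolding U_def using cU by (intro range_from_nat_into) (auto simp: \<U>_def)
  have openU: "open (U l)" for l
  proof -
    have "U l \<in> \<U>" using rU by auto
    then show ?thesis by (auto simp: \<U>_def)
  qed
  define s :: "'c \<Rightarrow> real" where "s x = (\<Sum>l. indicator (U l) x * (1/4)^l)" for x
  have sm: "summable (\<lambda>l. indicator (U l) x * (1/4::real)^l)" for x
    by (rule summable_comparison_test[OF _ summable_geometric[of "1/4::real"]])
       (auto simp: indicator_def)
  have "s \<in> borel_measurable borel"
    unfolding s_def
    by (intro borel_measurable_suminf borel_measurable_times borel_measurable_indicator borel_measurable_const)
       (simp add: openU)
  moreover have "s x \<in> {0..2}" for x
  proof -
    have "s x \<le> (\<Sum>l. (1/4)^l)"
      unfolding s_def by (rule suminf_le[OF _ sm summable_geometric]) (auto simp: indicator_def)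
    also have "\<dots> \<le> 2"
      using suminf_geometric[of "1/4::real"] by simp
    finally show ?thesis
      unfolding s_def using suminf_nonneg[OF sm] by simp
  qed
  moreover have "\<exists>\<delta>>0. \<forall>x\<in>K. \<forall>y\<in>K. \<bar>s x - s y\<bar> < \<delta> \<longrightarrow> dist x y < e" if e: "e > 0" for e
  proof -
    obtain n where n: "1 / real (Suc n) < e / 2"
      using e nat_approx_posE[of "e/2"] by (metis half_gt_zero inverse_eq_divide)
    define B where "B = (\<lambda>x. ball x (1 / real (Suc n))) ` F n"
    have "finite B" "B \<subseteq> range U"
      using F(1) unfolding B_def rU \<U>_def by auto
    then obtain J where J: "finite J" "B = U ` J"
      by (meson finite_subset_image)
    \<comment> \<open>All balls of the level \<open>n\<close> cover have indices below
      \<open>m\<close>, so a difference below \<open>(1/4)^m / 2\<close> rules out any disagreement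
      about them. The inserted 0 covers the case of an empty \<open>J\<close>.\<close>
    define m where "m = Suc (Max (insert 0 J))"
    have m: "l < m" if "l \<in> J" for l
      using that J unfolding m_def by (simp add: less_Suc_eq_le)
    show ?thesis
    proof (intro exI[of _ "(1/4)^m / 2"] conjI ballI impI)
      fix x y assume x: "x \<in> K" and y: "y \<in> K" and less: "\<bar>s x - s y\<bar> < (1/4)^m / 2"
      obtain z where z: "z \<in> F n" "x \<in> ball z (1 / real (Suc n))"
        using F(2) x by blast
      then obtain l where l: "l \<in> J" "U l = ball z (1 / real (Suc n))"
        using J(2) unfolding B_def by (metis (no_types, lifting) imageE image_eqI)
      have "y \<in> U l"
      proof (rule ccontr)
        assume ny: "y \<notin> U l"
        define d :: "nat \<Rightarrow> real" where "d l = indicator (U l) x - indicator (U l) y" for l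
        have dl: "d l \<noteq> 0" using z l ny by (simp add: d_def)
        \<comment> \<open>The first differing digit, whose index is at most \<open>l\<close> and
          hence below \<open>m\<close>, already forces the codes too far apart.\<close>
        define i where "i = (LEAST i. d i \<noteq> 0)"
        have di: "d i \<noteq> 0" "i \<le> l" and least: "\<And>l. l < i \<Longrightarrow> d l = 0"
          unfolding i_def using dl by (rule LeastI, rule Least_le) (use not_less_Least in blast)
        have "(1/4)^i / 2 \<le> \<bar>\<Sum>l. d l * (1/4)^l\<bar>"
          using di least by (intro abs_suminf_quarter_powers) (auto simp: d_def indicator_def)
        also have "(\<Sum>l. d l * (1/4)^l) = s x - s y"
          unfolding s_def d_def by (simp add: suminf_diff[OF sm sm] left_diff_distrib)
        finally have "(1/4::real)^i < (1/4)^m" using less by linarith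
        moreover have "(1/4::real)^m \<le> (1/4)^i"
          using di(2) m[OF l(1)] by (intro power_decreasing) auto
        ultimately show False by simp
      qed
      then have "dist z y < 1 / real (Suc n)" using l by simp
      moreover have "dist z x < 1 / real (Suc n)" using z by simp
      ultimately show "dist x y < e"
        using n dist_triangle3[of x y z] by linarith
    qed simp
  qed
  ultimately show ?thesis by (rule that)
qed

text \<open>The truncated distance to \<open>C\<close> is bounded, continuous and zero exactly on
  \<open>C\<close>. Its integrals vanish along the sequence, hence in the limit, and a nonnegative
  function with integral zero vanishes almost everywhere.\<close>

lemma weak_conv_m_measure_closed:
  assumes M: "\<And>n. real_distribution (M n)" and L: "real_distribution L"
    and wc: "weak_conv_m M L" and C: "closed C" "C \<noteq> {}"
    and supp: "\<And>n. AE x in M n. x \<in> C"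
  shows "AE x in L. x \<in> C"
proof -
  define f :: "real \<Rightarrow> real" where "f x = min 1 (infdist x C)" for x
  have f: "isCont f x" "norm (f x) \<le> 1" for x
    unfolding f_def by (auto intro!: continuous_intros simp: infdist_nonneg)
  interpret L: real_distribution L by (rule L)
  have zero: "integral\<^sup>L (M n) f = 0" for n
  proof -
    have "AE x in M n. f x = 0"
      using supp[of n] by eventually_elim (simp add: f_def)
    then show ?thesis by (rule integral_eq_zero_AE)
  qed
  have fm: "f \<in> borel_measurable borel"
    by (intro borel_measurable_continuous_onI) (simp add: continuous_on_eq_continuous_at f)
  have fL: "integrable L f"
    by (rule L.integrable_const_bound[of _ 1]) (use f fm in auto)
  have "(\<lambda>n. integral\<^sup>L (M n) f) \<longlonglongrightarrow> integral\<^sup>L L f"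
    using weak_conv_imp_integral_bdd_continuous_conv[OF M L wc, of f 1] f by blast
  then have "integral\<^sup>L L f = 0"
    by (simp add: zero LIMSEQ_const_iff)
  moreover have "AE x in L. 0 \<le> f x"
    by (simp add: f_def infdist_nonneg)
  ultimately have "AE x in L. f x = 0"
    using integral_nonneg_eq_0_iff_AE[OF fL] by simp
  then show ?thesis
  proof eventually_elim
    case (elim x)
    then have "infdist x C = 0" by (auto simp: f_def min_def split: if_splits)
    then show ?case using in_closed_iff_infdist_zero[OF C] by simp
  qed
qed

text \<open>The measures are pushed to the line by the code \<open>s\<close>, Helly's theorem yields
  a limit \<open>R\<close> there, and the continuous extension of the inverse code to the closure of
  the image carries \<open>R\<close> back. For continuous \<open>f\<close> on \<open>K\<close>, the
  integrand \<open>f\<close> is the composite of \<open>s\<close> with the continuous function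
  \<open>f \<circ> p\<close>, so jumps of \<open>s\<close> do no harm.\<close>

theorem compact_prob_space_convergent_subsequence:
  fixes K :: "'c::{heine_borel} set" and M :: "nat \<Rightarrow> 'c measure"
  assumes K: "compact K"
    and M: "\<And>n. prob_space (M n)" "\<And>n. sets (M n) = sets (restrict_space borel K)"
  obtains r :: "nat \<Rightarrow> nat" and L where "strict_mono r" "prob_space L"
    "sets L = sets (restrict_space borel K)"
    "\<And>f :: 'c \<Rightarrow> real. continuous_on K f \<Longrightarrow> (\<lambda>n. integral\<^sup>L (M (r n)) f) \<longlonglongrightarrow> integral\<^sup>L L f"
proof -
  obtain s :: "'c \<Rightarrow> real" where s: "s \<in> borel_measurable borel" "\<And>x. s x \<in> {0..2}"
    and sep: "\<And>e. e > 0 \<Longrightarrow> \<exists>\<delta>>0. \<forall>x\<in>K. \<forall>y\<in>K. \<bar>s x - s y\<bar> < \<delta> \<longrightarrow> dist x y < e"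
    using compact_borel_coding[OF K] by metis
  have spM: "space (M n) = K" for n
    using sets_eq_imp_space_eq[OF M(2)] by (simp add: space_restrict_space)
  have sM: "s \<in> borel_measurable (M n)" for n
    using measurable_restrict_space1[OF s(1), of K] measurable_cong_sets[OF M(2)[of n] refl] by blast
  have "space (M 0) \<noteq> {}"
    using prob_space.not_empty[OF M(1)] .
  then obtain k0 where k0: "k0 \<in> K" using spM by auto
  define C where "C = closure (s ` K)"
  have C: "closed C" "C \<noteq> {}"
    using k0 unfolding C_def by auto
  have inj: "inj_on s K"
  proof (rule inj_onI, rule ccontr)
    fix x y assume xy: "x \<in> K" "y \<in> K" "s x = s y" "x \<noteq> y"
    then show False using sep[of "dist x y"] by fastforce
  qed
  define t where "t = inv_into K s"
  have ts: "t (s x) = x" if "x \<in> K" for x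
    unfolding t_def using inj that by simp
  have "uniformly_continuous_on (s ` K) t"
    unfolding uniformly_continuous_on_def
  proof (intro allI impI)
    fix e :: real assume "e > 0"
    then obtain \<delta> where "\<delta> > 0" "\<forall>x\<in>K. \<forall>y\<in>K. \<bar>s x - s y\<bar> < \<delta> \<longrightarrow> dist x y < e"
      using sep by blast
    then show "\<exists>d>0. \<forall>x\<in>s ` K. \<forall>x'\<in>s ` K. dist x' x < d \<longrightarrow> dist (t x') (t x) < e"
      by (intro exI[of _ \<delta>]) (auto simp: ts dist_real_def)
  qed
  then obtain p where p: "uniformly_continuous_on C p" "\<And>x. x \<in> s ` K \<Longrightarrow> t x = p x"
    unfolding C_def by (rule uniformly_continuous_on_extension_on_closure) blast
  have cp: "continuous_on C p"
    by (rule uniformly_continuous_imp_continuous[OF p(1)])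
  \<comment> \<open>Points added by the closure still land in \<open>K\<close>, because
    \<open>K\<close> is closed.\<close>
  have pK: "p ` C \<subseteq> K"
    unfolding C_def
  proof (rule image_closure_subset)
    show "continuous_on (closure (s ` K)) p" using cp by (simp add: C_def)
    show "closed K" using K by (rule compact_imp_closed)
    show "p ` s ` K \<subseteq> K" using p(2) ts by force
  qed
  define N where "N n = distr (M n) borel s" for n
  have Nd: "real_distribution (N n)" for n
    unfolding N_def by (rule prob_space.real_distribution_distr[OF M(1) sM])
  have NC: "AE x in N n. x \<in> C" for n
  proof -
    have "AE x in M n. s x \<in> C"
      by (rule AE_I2) (use spM closure_subset[of "s ` K"] in \<open>auto simp: C_def\<close>)
    then show ?thesis
      unfolding N_def by (subst AE_distr_iff[OF sM]) (use C(1) in auto)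
  qed
  have "tight N"
    unfolding tight_def
  proof (intro conjI allI impI Nd)
    fix e :: real assume e: "e > 0"
    \<comment> \<open>A half-open interval, the shape demanded by tightness, around the range
      \<open>{0..2}\<close> of \<open>s\<close>.\<close>
    have "measure (N n) {-1<..3} = 1" for n
    proof -
      have "s -` {-1<..3} \<inter> space (M n) = space (M n)"
      proof (intro equalityI Int_greatest subset_refl subsetI)
        fix x show "x \<in> s -` {-1<..3}" using s(2)[of x] by auto
      qed auto
      then have "measure (N n) {-1<..3} = measure (M n) (space (M n))"
        unfolding N_def by (subst measure_distr[OF sM]) auto
      then show ?thesis by (simp add: prob_space.prob_space[OF M(1)])
    qed
    then show "\<exists>a b. a < b \<and> (\<forall>n. 1 - e < measure (N n) {a<..b})"
      using e by (intro exI[of _ "-1"] exI[of _ 3]) auto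
  qed
  then obtain r R where r: "strict_mono r" and R: "real_distribution R"
    and wc: "weak_conv_m (N \<circ> r) R"
    using tight_imp_convergent_subsubsequence[of N id] by (auto simp: strict_mono_id)
  interpret R: real_distribution R by (rule R)
  have Nr: "real_distribution ((N \<circ> r) n)" for n using Nd by simp
  have RC: "AE x in R. x \<in> C"
    by (rule weak_conv_m_measure_closed[OF Nr R wc C(1,2)]) (use NC in \<open>unfold comp_def\<close>)
  \<comment> \<open>The value \<open>k0\<close> off \<open>C\<close> only makes the map total with
    values in \<open>K\<close>; by \<open>RC\<close> the limit measure does not see it.\<close>
  define p' where "p' x = (if x \<in> C then p x else k0)" for x
  have p'K: "p' x \<in> K" for x
    using pK k0 by (auto simp: p'_def)
  have p'm: "p' \<in> measurable R (restrict_space borel K)"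
  proof (rule measurable_restrict_space2)
    show "p' \<in> space R \<rightarrow> K" using p'K by auto
    show "p' \<in> borel_measurable R"
      unfolding p'_def using borel_measurable_continuous_on_if[OF _ cp continuous_on_const, of k0] C(1)
      by (simp cong: measurable_cong_sets)
  qed
  define L where "L = distr R (restrict_space borel K) p'"
  have "prob_space L"
    unfolding L_def by (rule R.prob_space_distr[OF p'm])
  moreover have "(\<lambda>n. integral\<^sup>L (M (r n)) f) \<longlonglongrightarrow> integral\<^sup>L L f" if f: "continuous_on K f" for f :: "'c \<Rightarrow> real"
  proof -
    have "bounded (f ` K)"
      using f K by (simp add: compact_continuous_image compact_imp_bounded)
    then obtain B where B: "\<And>x. x \<in> K \<Longrightarrow> norm (f x) \<le> B"
      by (auto simp: bounded_iff)
    have B0: "0 \<le> B" using B[OF k0] norm_ge_zero order_trans by blast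
    have "continuous_on C (f \<circ> p)"
      using cp f pK by (intro continuous_on_compose) (auto intro: continuous_on_subset)
    moreover have "norm ((f \<circ> p) x) \<le> B" if "x \<in> C" for x
      using B pK that by auto
    \<comment> \<open>Weak convergence on the line tests functions continuous on all of it, so
      \<open>f \<circ> p\<close> is extended from the closed set \<open>C\<close> with the same
      bound.\<close>
    ultimately obtain h where h: "continuous_on UNIV h" "\<And>x. x \<in> C \<Longrightarrow> h x = (f \<circ> p) x"
        "\<And>x. norm (h x) \<le> B"
      using Tietze[of C "f \<circ> p" UNIV B] B0 C(1) by auto
    have hm: "h \<in> borel_measurable borel"
      using h(1) by (rule borel_measurable_continuous_onI)
    have "(\<lambda>n. integral\<^sup>L ((N \<circ> r) n) h) \<longlonglongrightarrow> integral\<^sup>L R h"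
      using weak_conv_imp_integral_bdd_continuous_conv[OF Nr R wc, of h B] h
      by (simp add: continuous_on_eq_continuous_at)
    moreover have "integral\<^sup>L ((N \<circ> r) n) h = integral\<^sup>L (M (r n)) f" for n
    proof -
      have "integral\<^sup>L ((N \<circ> r) n) h = (\<integral>x. h (s x) \<partial>M (r n))"
        unfolding N_def comp_def by (rule integral_distr[OF sM hm])
      also have "\<dots> = integral\<^sup>L (M (r n)) f"
      proof (rule Bochner_Integration.integral_cong[OF refl])
        fix x assume "x \<in> space (M (r n))"
        then have x: "x \<in> K" using spM by simp
        then have "s x \<in> C" unfolding C_def by (intro subsetD[OF closure_subset] imageI)
        then show "h (s x) = f x"
          using h(2) p(2)[of "s x"] ts x by simp
      qed
      finally show ?thesis .
    qed
    moreover have "integral\<^sup>L R h = integral\<^sup>L L f"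
    proof -
      have fm: "f \<in> borel_measurable (restrict_space borel K)"
        by (rule borel_measurable_continuous_on_restrict[OF f])
      have "integral\<^sup>L L f = (\<integral>x. f (p' x) \<partial>R)"
        unfolding L_def by (rule integral_distr[OF p'm fm])
      also have "\<dots> = integral\<^sup>L R h"
      proof (rule integral_cong_AE)
        show "(\<lambda>x. f (p' x)) \<in> borel_measurable R" using measurable_compose[OF p'm fm] .
        show "h \<in> borel_measurable R" using hm by simp
        show "AE x in R. f (p' x) = h x"
          using RC by eventually_elim (simp add: p'_def h)
      qed
      finally show ?thesis by simp
    qed
    ultimately show ?thesis by simp
  qed
  ultimately show ?thesis
    using that[OF r, of L] by (simp add: L_def)
qed

section \<open>Calculus of smooth functions\<close>

lemma differentiable_frechetI:
  "(f has_derivative f') (at x) \<Longrightarrow> frechet_derivative f (at x) = f'"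
  by (rule frechet_derivative_at[symmetric])

lemma has_derivative_local_eq:
  assumes "open S" "x \<in> S" "\<And>y. y \<in> S \<Longrightarrow> f y = g y"
  shows "(f has_derivative D) (at x) \<longleftrightarrow> (g has_derivative D) (at x)"
  using has_derivative_transform_within_open[OF _ assms(1,2), of f D UNIV g]
    has_derivative_transform_within_open[OF _ assms(1,2), of g D UNIV f] assms(3) by auto

lemma frechet_derivative_local_eq:
  assumes "open S" "x \<in> S" "\<And>y. y \<in> S \<Longrightarrow> f y = g y"
  shows "frechet_derivative f (at x) = frechet_derivative g (at x)"
  unfolding frechet_derivative_def using has_derivative_local_eq[OF assms] by simp

lemma differentiable_local_eq:
  assumes "open S" "x \<in> S" "\<And>y. y \<in> S \<Longrightarrow> f y = g y"
  shows "f differentiable at x \<longleftrightarrow> g differentiable at x"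
  unfolding differentiable_def using has_derivative_local_eq[OF assms] by simp

lemma higher_differentiable_on_cong:
  assumes "open S" "\<And>x. x \<in> S \<Longrightarrow> f x = g x"
  shows "higher_differentiable_on S f m \<longleftrightarrow> higher_differentiable_on S g m"
  using assms(2)
proof (induction m arbitrary: f g)
  case 0
  then show ?case by (auto intro: continuous_on_cong)
next
  case (Suc m)
  have "higher_differentiable_on S (\<lambda>x. frechet_derivative f (at x) v) m \<longleftrightarrow>
        higher_differentiable_on S (\<lambda>x. frechet_derivative g (at x) v) m" for v
    by (rule Suc.IH) (metis frechet_derivative_local_eq[OF assms(1)] Suc.prems)
  then show ?case
    using differentiable_local_eq[OF assms(1) _ Suc.prems] by auto
qed

lemma smooth_on_cong:
  assumes "open S" "\<And>x. x \<in> S \<Longrightarrow> f x = g x"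
  shows "smooth_on S f \<longleftrightarrow> smooth_on S g"
proof -
  have "higher_differentiable_on S f m \<longleftrightarrow> higher_differentiable_on S g m" for m
    by (rule higher_differentiable_on_cong[OF assms])
  then show ?thesis by (simp add: smooth_on_def)
qed

lemma higher_differentiable_on_continuous:
  "higher_differentiable_on S f m \<Longrightarrow> continuous_on S f"
  by (cases m) (auto intro: continuous_at_imp_continuous_on differentiable_imp_continuous_within)

lemma higher_differentiable_on_Suc_D:
  "higher_differentiable_on S f (Suc m) \<Longrightarrow> higher_differentiable_on S f m"
proof (induction m arbitrary: f)
  case 0
  then show ?case using higher_differentiable_on_continuous by fastforce
next
  case (Suc m)
  then show ?case by (metis higher_differentiable_on.simps(2))
qed

lemma higher_differentiable_on_const: "higher_differentiable_on S (\<lambda>x. c) m"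
  by (induction m arbitrary: c) (auto simp: frechet_derivative_const)

lemma higher_differentiable_on_add:
  assumes "open S" "higher_differentiable_on S f m" "higher_differentiable_on S g m"
  shows "higher_differentiable_on S (\<lambda>x. f x + g x) m"
  using assms(2,3)
proof (induction m arbitrary: f g)
  case 0
  then show ?case by (auto intro: continuous_on_add)
next
  case (Suc m)
  have "higher_differentiable_on S (\<lambda>x. frechet_derivative (\<lambda>x. f x + g x) (at x) v) m" for v
  proof (subst higher_differentiable_on_cong[OF assms(1)])
    show "frechet_derivative (\<lambda>x. f x + g x) (at x) v =
        frechet_derivative f (at x) v + frechet_derivative g (at x) v" if "x \<in> S" for x
      using Suc.prems that by (subst differentiable_frechetI[OF has_derivative_add])
        (auto simp: frechet_derivative_works[symmetric])
  qed (use Suc in auto)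
  then show ?case using Suc.prems by auto
qed

text \<open>Proved once for every bounded bilinear map, so that products, scalings and inner
  products share the induction. The Leibniz rule leaves one factor undifferentiated, which is why
  differentiability of one order less is extracted from the premises.\<close>

lemma (in bounded_bilinear) higher_differentiable_on_prod:
  assumes "open S" "higher_differentiable_on S f m" "higher_differentiable_on S g m"
  shows "higher_differentiable_on S (\<lambda>x. prod (f x) (g x)) m"
  using assms(2,3)
proof (induction m arbitrary: f g)
  case 0
  then show ?case by (auto intro: continuous_on)
next
  case (Suc m)
  have der: "((\<lambda>x. prod (f x) (g x)) has_derivative
      (\<lambda>v. prod (f x) (frechet_derivative g (at x) v) + prod (frechet_derivative f (at x) v) (g x))) (at x)"
    if "x \<in> S" for x
    using Suc.prems that by (intro FDERIV) (auto simp: frechet_derivative_works[symmetric])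
  have "higher_differentiable_on S (\<lambda>x. frechet_derivative (\<lambda>x. prod (f x) (g x)) (at x) v) m" for v
  proof (subst higher_differentiable_on_cong[OF assms(1)])
    show "frechet_derivative (\<lambda>x. prod (f x) (g x)) (at x) v =
        prod (f x) (frechet_derivative g (at x) v) + prod (frechet_derivative f (at x) v) (g x)"
      if "x \<in> S" for x
      using differentiable_frechetI[OF der[OF that]] by simp
    show "higher_differentiable_on S (\<lambda>x. prod (f x) (frechet_derivative g (at x) v) +
        prod (frechet_derivative f (at x) v) (g x)) m"
      using Suc.prems Suc.prems[THEN higher_differentiable_on_Suc_D]
      by (intro higher_differentiable_on_add Suc.IH assms(1)) auto
  qed
  then show ?case using der by (auto simp: differentiable_def)
qed

text \<open>The derivative of \<open>1 / f\<close> is a product of \<open>1 / f\<close> twice with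
  the derivative of \<open>f\<close>, so one order of \<open>1 / f\<close> feeds the next.\<close>

lemma higher_differentiable_on_inverse:
  fixes f :: "'x::real_normed_vector \<Rightarrow> real"
  assumes "open S" "\<And>x. x \<in> S \<Longrightarrow> f x \<noteq> 0" "higher_differentiable_on S f m"
  shows "higher_differentiable_on S (\<lambda>x. inverse (f x)) m"
  using assms(3)
proof (induction m)
  case 0
  then show ?case using assms(2) by (auto intro: continuous_on_inverse)
next
  case (Suc m)
  have der: "((\<lambda>x. inverse (f x)) has_derivative
      (\<lambda>v. - (inverse (f x) * frechet_derivative f (at x) v * inverse (f x)))) (at x)"
    if "x \<in> S" for x
    using Suc.prems that assms(2)
    by (intro Deriv.has_derivative_inverse) (auto simp: frechet_derivative_works[symmetric])
  note IH = Suc.IH[OF higher_differentiable_on_Suc_D[OF Suc.prems]]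
  have "higher_differentiable_on S (\<lambda>x. frechet_derivative (\<lambda>x. inverse (f x)) (at x) v) m" for v
  proof (subst higher_differentiable_on_cong[OF assms(1)])
    show "frechet_derivative (\<lambda>x. inverse (f x)) (at x) v =
        (- 1) * (inverse (f x) * frechet_derivative f (at x) v * inverse (f x))" if "x \<in> S" for x
      using differentiable_frechetI[OF der[OF that]] by simp
    show "higher_differentiable_on S (\<lambda>x. (- 1) * (inverse (f x) * frechet_derivative f (at x) v * inverse (f x))) m"
      using Suc.prems IH
      by (intro bounded_bilinear.higher_differentiable_on_prod[OF bounded_bilinear_mult] assms(1)
            higher_differentiable_on_const) auto
  qed
  then show ?case using der by (auto simp: differentiable_def)
qed

lemma smooth_on_const: "smooth_on S (\<lambda>x. c)"
  by (simp add: smooth_on_def higher_differentiable_on_const)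

lemma smooth_on_add: "open S \<Longrightarrow> smooth_on S f \<Longrightarrow> smooth_on S g \<Longrightarrow> smooth_on S (\<lambda>x. f x + g x)"
  by (simp add: smooth_on_def higher_differentiable_on_add)

lemma smooth_on_sum:
  "open S \<Longrightarrow> (\<And>i. i \<in> I \<Longrightarrow> smooth_on S (f i)) \<Longrightarrow> smooth_on S (\<lambda>x. \<Sum>i\<in>I. f i x)"
  by (induction I rule: infinite_finite_induct) (auto intro: smooth_on_const smooth_on_add)

lemma smooth_on_mult:
  fixes f g :: "'x::real_normed_vector \<Rightarrow> real"
  shows "open S \<Longrightarrow> smooth_on S f \<Longrightarrow> smooth_on S g \<Longrightarrow> smooth_on S (\<lambda>x. f x * g x)"
  by (simp add: smooth_on_def bounded_bilinear.higher_differentiable_on_prod[OF bounded_bilinear_mult])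

lemma smooth_on_scaleR:
  "open S \<Longrightarrow> smooth_on S f \<Longrightarrow> smooth_on S g \<Longrightarrow> smooth_on S (\<lambda>x. f x *\<^sub>R g x)"
  by (simp add: smooth_on_def bounded_bilinear.higher_differentiable_on_prod[OF bounded_bilinear_scaleR])

lemma smooth_on_inner:
  fixes f g :: "'x::real_normed_vector \<Rightarrow> 'y::real_inner"
  shows "open S \<Longrightarrow> smooth_on S f \<Longrightarrow> smooth_on S g \<Longrightarrow> smooth_on S (\<lambda>x. f x \<bullet> g x)"
  by (simp add: smooth_on_def bounded_bilinear.higher_differentiable_on_prod[OF bounded_bilinear_inner])

lemma smooth_on_inverse:
  fixes f :: "'x::real_normed_vector \<Rightarrow> real"
  shows "open S \<Longrightarrow> smooth_on S f \<Longrightarrow> (\<And>x. x \<in> S \<Longrightarrow> f x \<noteq> 0) \<Longrightarrow> smooth_on S (\<lambda>x. inverse (f x))"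
  by (simp add: smooth_on_def higher_differentiable_on_inverse)

lemma smooth_on_continuous: "smooth_on S f \<Longrightarrow> continuous_on S f"
  using higher_differentiable_on.simps(1) unfolding smooth_on_def by blast

lemma smooth_on_differentiable: "smooth_on S f \<Longrightarrow> x \<in> S \<Longrightarrow> f differentiable at x"
  unfolding smooth_on_def by (metis higher_differentiable_on.simps(2))

lemma smooth_on_has_derivative:
  "smooth_on S f \<Longrightarrow> x \<in> S \<Longrightarrow> (f has_derivative frechet_derivative f (at x)) (at x)"
  using smooth_on_differentiable frechet_derivative_works by blast

lemma smooth_on_frechet_derivative:
  "smooth_on S f \<Longrightarrow> smooth_on S (\<lambda>x. frechet_derivative f (at x) v)"
  unfolding smooth_on_def by (metis higher_differentiable_on.simps(2))

section \<open>Second derivatives and families of bilinear forms\<close>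

lemma has_field_derivative_along_line:
  fixes f :: "'x::real_normed_vector \<Rightarrow> real"
  assumes "f differentiable at (y + s *\<^sub>R v)"
  shows "((\<lambda>s. f (y + s *\<^sub>R v)) has_field_derivative frechet_derivative f (at (y + s *\<^sub>R v)) v) (at s)"
proof -
  have f: "(f has_derivative frechet_derivative f (at (y + s *\<^sub>R v))) (at (y + s *\<^sub>R v))"
    using assms frechet_derivative_works by blast
  have "((\<lambda>s. y + s *\<^sub>R v) has_derivative (\<lambda>h. h *\<^sub>R v)) (at s)"
    by (auto intro!: derivative_eq_intros)
  from has_derivative_compose[OF this f]
  have "((\<lambda>s. f (y + s *\<^sub>R v)) has_derivative (\<lambda>h. frechet_derivative f (at (y + s *\<^sub>R v)) (h *\<^sub>R v))) (at s)" .
  moreover have "(\<lambda>h. frechet_derivative f (at (y + s *\<^sub>R v)) (h *\<^sub>R v)) =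
      (*) (frechet_derivative f (at (y + s *\<^sub>R v)) v)"
    using has_derivative_linear[OF f] by (auto simp: linear_cmul)
  ultimately show ?thesis by (simp add: has_field_derivative_def)
qed

text \<open>Two mean value arguments: first along \<open>v\<close> for the difference of
  \<open>f\<close> on opposite sides of the parallelogram, then along \<open>w\<close> for the
  derivative in direction \<open>v\<close>. The left side is symmetric in \<open>v\<close> and
  \<open>w\<close>, the right side is not.\<close>

lemma second_difference_mean_value:
  fixes f :: "'x::real_normed_vector \<Rightarrow> real"
  assumes t: "t > 0" and box: "\<And>a b. a \<in> {0..t} \<Longrightarrow> b \<in> {0..t} \<Longrightarrow> x + a *\<^sub>R v + b *\<^sub>R w \<in> S"
    and f: "\<And>y. y \<in> S \<Longrightarrow> f differentiable at y"
    and f': "\<And>y. y \<in> S \<Longrightarrow> (\<lambda>y. frechet_derivative f (at y) v) differentiable at y"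
  obtains a b where "a \<in> {0..t}" "b \<in> {0..t}"
    "f (x + t *\<^sub>R v + t *\<^sub>R w) - f (x + t *\<^sub>R v) - f (x + t *\<^sub>R w) + f x =
     t * (t * frechet_derivative (\<lambda>y. frechet_derivative f (at y) v) (at (x + a *\<^sub>R v + b *\<^sub>R w)) w)"
proof -
  define \<phi> where "\<phi> s = f ((x + t *\<^sub>R w) + s *\<^sub>R v) - f (x + s *\<^sub>R v)" for s
  have in1: "x + t *\<^sub>R w + s *\<^sub>R v \<in> S" "x + s *\<^sub>R v \<in> S" if "0 \<le> s" "s \<le> t" for s
    using box[of s t] box[of s 0] that t by (auto simp: algebra_simps)
  have "DERIV \<phi> s :> frechet_derivative f (at (x + t *\<^sub>R w + s *\<^sub>R v)) v
        - frechet_derivative f (at (x + s *\<^sub>R v)) v" if "0 \<le> s" "s \<le> t" for s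
    unfolding \<phi>_def using in1[OF that] by (intro DERIV_diff has_field_derivative_along_line f)
  from MVT2[OF t this] obtain a where a: "0 < a" "a < t" and
    1: "\<phi> t - \<phi> 0 = t * (frechet_derivative f (at (x + t *\<^sub>R w + a *\<^sub>R v)) v
        - frechet_derivative f (at (x + a *\<^sub>R v)) v)" by auto
  define \<psi> where "\<psi> s = frechet_derivative f (at ((x + a *\<^sub>R v) + s *\<^sub>R w)) v" for s
  have "DERIV \<psi> s :> frechet_derivative (\<lambda>y. frechet_derivative f (at y) v) (at (x + a *\<^sub>R v + s *\<^sub>R w)) w"
    if "0 \<le> s" "s \<le> t" for s
    unfolding \<psi>_def using box[of a s] a that by (intro has_field_derivative_along_line f') auto
  from MVT2[OF t this] obtain b where b: "0 < b" "b < t" and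
    2: "\<psi> t - \<psi> 0 = t * frechet_derivative (\<lambda>y. frechet_derivative f (at y) v) (at (x + a *\<^sub>R v + b *\<^sub>R w)) w"
    by auto
  show ?thesis
  proof (rule that[of a b])
    have "f (x + t *\<^sub>R v + t *\<^sub>R w) - f (x + t *\<^sub>R v) - f (x + t *\<^sub>R w) + f x = \<phi> t - \<phi> 0"
      by (simp add: \<phi>_def algebra_simps)
    also have "\<dots> = t * (\<psi> t - \<psi> 0)"
      unfolding 1 \<psi>_def by (simp add: algebra_simps)
    finally show "f (x + t *\<^sub>R v + t *\<^sub>R w) - f (x + t *\<^sub>R v) - f (x + t *\<^sub>R w) + f x =
     t * (t * frechet_derivative (\<lambda>y. frechet_derivative f (at y) v) (at (x + a *\<^sub>R v + b *\<^sub>R w)) w)"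
      unfolding 2 .
  qed (use a b in auto)
qed

text \<open>The same second difference is evaluated in both orders. This equates the two mixed
  derivatives at two nearby points, and their continuity at \<open>x\<close> does the rest.\<close>

lemma second_derivative_commute_real:
  fixes f :: "'x::real_normed_vector \<Rightarrow> real"
  assumes S: "open S" "x \<in> S" and f: "smooth_on S f"
  shows "frechet_derivative (\<lambda>y. frechet_derivative f (at y) v) (at x) w =
         frechet_derivative (\<lambda>y. frechet_derivative f (at y) w) (at x) v"
proof -
  define D where "D v w y = frechet_derivative (\<lambda>y. frechet_derivative f (at y) v) (at y) w" for v w y
  have cont: "isCont (D v w) x" for v w
    using smooth_on_continuous[OF smooth_on_frechet_derivative[OF smooth_on_frechet_derivative[OF f]]]
      S continuous_on_eq_continuous_at unfolding D_def by blast
  have "\<bar>D v w x - D w v x\<bar> \<le> e" if e: "e > 0" for e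
  proof -
    obtain d1 where d1: "d1 > 0" "\<And>y. dist y x < d1 \<Longrightarrow> \<bar>D v w y - D v w x\<bar> < e/2"
      using cont[of v w] e unfolding continuous_at_eps_delta dist_real_def by (meson half_gt_zero)
    obtain d2 where d2: "d2 > 0" "\<And>y. dist y x < d2 \<Longrightarrow> \<bar>D w v y - D w v x\<bar> < e/2"
      using cont[of w v] e unfolding continuous_at_eps_delta dist_real_def by (meson half_gt_zero)
    obtain d3 where d3: "d3 > 0" "ball x d3 \<subseteq> S"
      using S by (meson open_contains_ball)
    define d where "d = min d1 (min d2 d3)"
    have d: "d > 0" using d1 d2 d3 by (simp add: d_def)
    \<comment> \<open>With this side length the whole parallelogram stays within distance
      \<open>d\<close> of \<open>x\<close>; the summand 1 keeps the denominator positive when both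
      directions vanish.\<close>
    define t where "t = d / (norm v + norm w + 1)"
    have nn: "norm v + norm w + 1 > 0" by (simp add: add_nonneg_pos)
    have t: "t > 0" using d nn by (simp add: t_def)
    have near: "dist (x + a *\<^sub>R v + b *\<^sub>R w) x < d" if "a \<in> {0..t}" "b \<in> {0..t}" for a b
    proof -
      have "norm (a *\<^sub>R v + b *\<^sub>R w) \<le> a * norm v + b * norm w"
        using that by (intro order_trans[OF norm_triangle_ineq]) auto
      also have "\<dots> \<le> t * norm v + t * norm w"
        using that by (intro add_mono mult_right_mono) auto
      also have "\<dots> < t * (norm v + norm w + 1)"
        using t by (simp add: algebra_simps)
      also have "\<dots> = d" using nn by (simp add: t_def)
      finally show ?thesis by (simp add: dist_norm algebra_simps)
    qed
    have inS: "x + a *\<^sub>R v + b *\<^sub>R w \<in> S" if "a \<in> {0..t}" "b \<in> {0..t}" for a b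
      using near[OF that] d3(2) by (auto simp: d_def dist_commute)
    have inS': "x + a *\<^sub>R w + b *\<^sub>R v \<in> S" if "a \<in> {0..t}" "b \<in> {0..t}" for a b
      using inS[OF that(2,1)] by (simp add: algebra_simps)
    obtain a b where ab: "a \<in> {0..t}" "b \<in> {0..t}"
      "f (x + t *\<^sub>R v + t *\<^sub>R w) - f (x + t *\<^sub>R v) - f (x + t *\<^sub>R w) + f x
        = t * (t * D v w (x + a *\<^sub>R v + b *\<^sub>R w))"
      unfolding D_def
      by (rule second_difference_mean_value[OF t inS, where f=f])
         (auto intro: smooth_on_differentiable[OF f] smooth_on_differentiable[OF smooth_on_frechet_derivative[OF f]])
    obtain a' b' where ab': "a' \<in> {0..t}" "b' \<in> {0..t}"
      "f (x + t *\<^sub>R w + t *\<^sub>R v) - f (x + t *\<^sub>R w) - f (x + t *\<^sub>R v) + f x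
        = t * (t * D w v (x + a' *\<^sub>R w + b' *\<^sub>R v))"
      unfolding D_def
      by (rule second_difference_mean_value[OF t inS', where f=f])
         (auto intro: smooth_on_differentiable[OF f] smooth_on_differentiable[OF smooth_on_frechet_derivative[OF f]])
    have "t * (t * D v w (x + a *\<^sub>R v + b *\<^sub>R w)) = t * (t * D w v (x + b' *\<^sub>R v + a' *\<^sub>R w))"
      using ab(3) ab'(3) by (simp add: algebra_simps)
    then have "D v w (x + a *\<^sub>R v + b *\<^sub>R w) = D w v (x + b' *\<^sub>R v + a' *\<^sub>R w)"
      using t by simp
    moreover have "\<bar>D v w (x + a *\<^sub>R v + b *\<^sub>R w) - D v w x\<bar> < e/2"
      using near[OF ab(1,2)] by (intro d1) (simp add: d_def)
    moreover have "\<bar>D w v (x + b' *\<^sub>R v + a' *\<^sub>R w) - D w v x\<bar> < e/2"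
      using near[OF ab'(2,1)] by (intro d2) (simp add: d_def)
    ultimately show ?thesis by linarith
  qed
  then have "\<bar>D v w x - D w v x\<bar> \<le> 0"
    by (rule field_le_epsilon) auto
  then show ?thesis by (simp add: D_def)
qed

lemma second_derivative_commute:
  fixes f :: "'x::real_normed_vector \<Rightarrow> 'y::euclidean_space"
  assumes S: "open S" "x \<in> S" and f: "smooth_on S f"
  shows "frechet_derivative (\<lambda>y. frechet_derivative f (at y) v) (at x) w =
         frechet_derivative (\<lambda>y. frechet_derivative f (at y) w) (at x) v"
proof (rule euclidean_eqI)
  fix b :: 'y
  have fb: "smooth_on S (\<lambda>y. f y \<bullet> b)"
    by (intro smooth_on_inner S f smooth_on_const)
  have inner: "frechet_derivative (\<lambda>y. h y \<bullet> b) (at y) u = frechet_derivative h (at y) u \<bullet> b"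
    if "y \<in> S" "smooth_on S h" for h y u
    using differentiable_frechetI[OF has_derivative_inner_left[OF smooth_on_has_derivative[OF that(2,1)]]]
    by simp
  have "frechet_derivative (\<lambda>y. frechet_derivative (\<lambda>y. f y \<bullet> b) (at y) v) (at x) w =
      frechet_derivative (\<lambda>y. frechet_derivative f (at y) v) (at x) w \<bullet> b" for v w
  proof -
    have "frechet_derivative (\<lambda>y. frechet_derivative (\<lambda>y. f y \<bullet> b) (at y) v) (at x) =
      frechet_derivative (\<lambda>y. frechet_derivative f (at y) v \<bullet> b) (at x)"
      by (rule frechet_derivative_local_eq[OF S]) (simp add: inner f)
    then show ?thesis
      using inner[OF S(2) smooth_on_frechet_derivative[OF f]] by simp
  qed
  then show "frechet_derivative (\<lambda>y. frechet_derivative f (at y) v) (at x) w \<bullet> b =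
         frechet_derivative (\<lambda>y. frechet_derivative f (at y) w) (at x) v \<bullet> b"
    using second_derivative_commute_real[OF S fb, of v w] by simp
qed

lemma linear_euclidean_sum:
  fixes L :: "'b::euclidean_space \<Rightarrow> 'y::real_vector"
  assumes "linear L"
  shows "L u = (\<Sum>i\<in>Basis. (u \<bullet> i) *\<^sub>R L i)"
proof -
  have "L u = L (\<Sum>i\<in>Basis. (u \<bullet> i) *\<^sub>R i)" by (simp add: euclidean_representation)
  then show ?thesis by (simp add: linear_sum[OF assms] linear_cmul[OF assms])
qed

lemma bilinear_euclidean_sum:
  fixes B :: "'b::euclidean_space \<Rightarrow> 'b \<Rightarrow> real"
  assumes "bilinear B"
  shows "B u v = (\<Sum>i\<in>Basis. \<Sum>j\<in>Basis. (u \<bullet> i) * (v \<bullet> j) * B i j)"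
proof -
  have 1: "linear (\<lambda>u. B u v)" and 2: "linear (\<lambda>v. B i v)" for i v
    using assms by (auto simp: bilinear_def)
  show ?thesis
    by (subst linear_euclidean_sum[OF 1], subst linear_euclidean_sum[OF 2])
       (simp add: sum_distrib_left mult_ac)
qed

text \<open>A product rule for an operator depending on the point, applied to a vector depending on
  the point. Expansion in \<open>Basis\<close> reduces it to finitely many scalar multiples of the
  functions \<open>\<lambda>y. L y i\<close>, so differentiability for each fixed vector
  suffices.\<close>

lemma has_derivative_linear_family:
  fixes L :: "'x::real_normed_vector \<Rightarrow> 'b::euclidean_space \<Rightarrow> 'y::real_normed_vector"
  assumes S: "open S" "x \<in> S" and lin: "\<And>y. y \<in> S \<Longrightarrow> linear (L y)"
    and L: "\<And>u. (\<lambda>y. L y u) differentiable at x"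
    and a: "(a has_derivative a') (at x)"
  shows "((\<lambda>y. L y (a y)) has_derivative
           (\<lambda>w. frechet_derivative (\<lambda>y. L y (a x)) (at x) w + L x (a' w))) (at x)"
proof -
  note L' = L[unfolded frechet_derivative_works]
  have *: "((\<lambda>y. \<Sum>i\<in>Basis. (h y \<bullet> i) *\<^sub>R L y i) has_derivative
      (\<lambda>w. \<Sum>i\<in>Basis. (h x \<bullet> i) *\<^sub>R frechet_derivative (\<lambda>y. L y i) (at x) w + (h' w \<bullet> i) *\<^sub>R L x i)) (at x)"
    if "(h has_derivative h') (at x)" for h h'
    using that L' by (intro has_derivative_sum has_derivative_scaleR has_derivative_inner_left)
  have "frechet_derivative (\<lambda>y. L y (a x)) (at x) w
      = (\<Sum>i\<in>Basis. (a x \<bullet> i) *\<^sub>R frechet_derivative (\<lambda>y. L y i) (at x) w)" for w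
  proof -
    have "frechet_derivative (\<lambda>y. L y (a x)) (at x)
        = frechet_derivative (\<lambda>y. \<Sum>i\<in>Basis. (a x \<bullet> i) *\<^sub>R L y i) (at x)"
      by (rule frechet_derivative_local_eq[OF S]) (rule linear_euclidean_sum[OF lin])
    then show ?thesis
      using differentiable_frechetI[OF *[OF has_derivative_const[of "a x"]]] by simp
  qed
  moreover have "((\<lambda>y. L y (a y)) has_derivative
      (\<lambda>w. \<Sum>i\<in>Basis. (a x \<bullet> i) *\<^sub>R frechet_derivative (\<lambda>y. L y i) (at x) w + (a' w \<bullet> i) *\<^sub>R L x i)) (at x)"
    by (subst has_derivative_local_eq[OF S linear_euclidean_sum[OF lin]]) (auto intro: *[OF a])
  moreover have "L x (a' w) = (\<Sum>i\<in>Basis. (a' w \<bullet> i) *\<^sub>R L x i)" for w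
    by (rule linear_euclidean_sum[OF lin[OF S(2)]])
  ultimately show ?thesis by (simp add: sum.distrib)
qed

lemma has_derivative_bilinear_family:
  fixes M :: "'z::real_normed_vector \<Rightarrow> 'b::euclidean_space \<Rightarrow> 'b \<Rightarrow> real"
  assumes S: "open S" "\<tau> x \<in> S" and bil: "\<And>y. y \<in> S \<Longrightarrow> bilinear (M y)"
    and M: "\<And>u v. (\<lambda>y. M y u v) differentiable at (\<tau> x)"
    and \<tau>: "(\<tau> has_derivative T) (at x)"
    and a: "(a has_derivative a') (at x)" and b: "(b has_derivative b') (at x)"
  shows "((\<lambda>y. M (\<tau> y) (a y) (b y)) has_derivative
           (\<lambda>w. frechet_derivative (\<lambda>y. M y (a x) (b x)) (at (\<tau> x)) (T w)
              + M (\<tau> x) (a' w) (b x) + M (\<tau> x) (a x) (b' w))) (at x)"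
proof -
  define D where "D i j = frechet_derivative (\<lambda>y. M y i j) (at (\<tau> x))" for i j
  have M': "((\<lambda>y. M y i j) has_derivative D i j) (at (\<tau> x))" for i j
    using M unfolding D_def by (simp add: frechet_derivative_works[symmetric])
  have "frechet_derivative (\<lambda>y. M y (a x) (b x)) (at (\<tau> x)) w
      = (\<Sum>i\<in>Basis. \<Sum>j\<in>Basis. (a x \<bullet> i) * (b x \<bullet> j) * D i j w)" for w
  proof -
    have "((\<lambda>y. \<Sum>i\<in>Basis. \<Sum>j\<in>Basis. (a x \<bullet> i) * (b x \<bullet> j) * M y i j) has_derivative
       (\<lambda>w. \<Sum>i\<in>Basis. \<Sum>j\<in>Basis. (a x \<bullet> i) * (b x \<bullet> j) * D i j w)) (at (\<tau> x))"
      by (intro has_derivative_sum has_derivative_mult_right M')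
    then show ?thesis
      using frechet_derivative_local_eq[OF S, of "\<lambda>y. M y (a x) (b x)"
          "\<lambda>y. \<Sum>i\<in>Basis. \<Sum>j\<in>Basis. (a x \<bullet> i) * (b x \<bullet> j) * M y i j",
          OF bilinear_euclidean_sum[OF bil]]
      by (simp add: differentiable_frechetI)
  qed
  moreover have "((\<lambda>y. M (\<tau> y) (a y) (b y)) has_derivative
      (\<lambda>w. \<Sum>i\<in>Basis. \<Sum>j\<in>Basis. (a x \<bullet> i) * (b x \<bullet> j) * D i j (T w)
         + ((a x \<bullet> i) * (b' w \<bullet> j) + (a' w \<bullet> i) * (b x \<bullet> j)) * M (\<tau> x) i j)) (at x)"
  proof -
    have "((\<lambda>y. \<Sum>i\<in>Basis. \<Sum>j\<in>Basis. (a y \<bullet> i) * (b y \<bullet> j) * M (\<tau> y) i j) has_derivative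
      (\<lambda>w. \<Sum>i\<in>Basis. \<Sum>j\<in>Basis. (a x \<bullet> i) * (b x \<bullet> j) * D i j (T w)
         + ((a x \<bullet> i) * (b' w \<bullet> j) + (a' w \<bullet> i) * (b x \<bullet> j)) * M (\<tau> x) i j)) (at x)"
      by (intro has_derivative_sum has_derivative_mult has_derivative_inner_left a b
            has_derivative_compose[OF \<tau> M'])
    \<comment> \<open>Bilinearity is assumed only on \<open>S\<close>, so the expansion in
      \<open>Basis\<close> is valid only where \<open>\<tau> y\<close> stays in
      \<open>S\<close>.\<close>
    moreover have "\<forall>\<^sub>F y in at x. \<tau> y \<in> S"
      using has_derivative_continuous[OF \<tau>] S topological_tendstoD
      unfolding continuous_within by blast
    then have "\<forall>\<^sub>F y in at x. (\<Sum>i\<in>Basis. \<Sum>j\<in>Basis. (a y \<bullet> i) * (b y \<bullet> j) * M (\<tau> y) i j)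
        = M (\<tau> y) (a y) (b y)"
      by eventually_elim (rule bilinear_euclidean_sum[OF bil, symmetric])
    ultimately show ?thesis
      by (rule has_derivative_transform_eventually)
         (use bilinear_euclidean_sum[OF bil[OF S(2)], symmetric] in auto)
  qed
  moreover have "M (\<tau> x) (a' w) (b x) = (\<Sum>i\<in>Basis. \<Sum>j\<in>Basis. (a' w \<bullet> i) * (b x \<bullet> j) * M (\<tau> x) i j)"
    "M (\<tau> x) (a x) (b' w) = (\<Sum>i\<in>Basis. \<Sum>j\<in>Basis. (a x \<bullet> i) * (b' w \<bullet> j) * M (\<tau> x) i j)" for w
    by (rule bilinear_euclidean_sum[OF bil[OF S(2)]])+
  ultimately show ?thesis
    by (simp add: sum.distrib distrib_right add_ac)
qed

section \<open>The divergence in charts\<close>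

locale riemannian_manifold =
  fixes A :: "('a::{t2_space, second_countable_topology}, 'b::euclidean_space) chart set"
    and g :: "'a \<Rightarrow> 'b \<Rightarrow> 'b \<Rightarrow> real"
  assumes atlas: "smooth_atlas A" and metric: "riemannian_metric A g"
begin

section \<open>Charts, transition maps and tangent coordinates\<close>

definition overlap :: "('a, 'b) chart \<Rightarrow> ('a, 'b) chart \<Rightarrow> 'b set" where
  "overlap c d = snd c ` (fst c \<inter> fst d)"

lemma chart_open: "c \<in> A \<Longrightarrow> open (fst c)" "c \<in> A \<Longrightarrow> open (chart_image c)"
  and chart_homeomorphism: "c \<in> A \<Longrightarrow> homeomorphism (fst c) (chart_image c) (snd c) (chart_inv c)"
  using atlas by (auto simp: smooth_atlas_def)

lemma chart_inv_left [simp]: "c \<in> A \<Longrightarrow> p \<in> fst c \<Longrightarrow> chart_inv c (snd c p) = p"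
  using chart_homeomorphism by (auto simp: homeomorphism_def)

lemma chart_in_image [simp]: "p \<in> fst c \<Longrightarrow> snd c p \<in> chart_image c"
  by (simp add: chart_image_def)

lemma chart_inv_right [simp]:
  "c \<in> A \<Longrightarrow> x \<in> chart_image c \<Longrightarrow> chart_inv c x \<in> fst c"
  "c \<in> A \<Longrightarrow> x \<in> chart_image c \<Longrightarrow> snd c (chart_inv c x) = x"
  using chart_homeomorphism[of c] by (auto simp: homeomorphism_def)

lemma chart_at [simp]: "chart_at A p \<in> A" "p \<in> fst (chart_at A p)"
proof -
  have "p \<in> (\<Union>c\<in>A. fst c)"
    using atlas unfolding smooth_atlas_def by blast
  then have "\<exists>c. c \<in> A \<and> p \<in> fst c" by blast
  then have "chart_at A p \<in> A \<and> p \<in> fst (chart_at A p)"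
    unfolding chart_at_def by (rule someI_ex)
  then show "chart_at A p \<in> A" "p \<in> fst (chart_at A p)" by auto
qed

lemma continuous_on_chart: "c \<in> A \<Longrightarrow> continuous_on (fst c) (snd c)"
  and continuous_on_chart_inv: "c \<in> A \<Longrightarrow> continuous_on (chart_image c) (chart_inv c)"
  using chart_homeomorphism by (auto simp: homeomorphism_def)

lemma in_overlap [simp]: "p \<in> fst c \<Longrightarrow> p \<in> fst d \<Longrightarrow> snd c p \<in> overlap c d"
  by (simp add: overlap_def)

lemma overlap_eq: "c \<in> A \<Longrightarrow> overlap c d = chart_image c \<inter> chart_inv c -` fst d"
  by (force simp: overlap_def chart_image_def)

lemma open_overlap: "c \<in> A \<Longrightarrow> d \<in> A \<Longrightarrow> open (overlap c d)"
  unfolding overlap_eq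
  using continuous_on_open_vimage[OF chart_open(2)] continuous_on_chart_inv chart_open(1)
  by (metis Int_commute)

lemma chart_inv_overlap:
  "c \<in> A \<Longrightarrow> x \<in> overlap c d \<Longrightarrow> chart_inv c x \<in> fst c \<inter> fst d \<and> snd c (chart_inv c x) = x"
  by (auto simp: overlap_def)

lemma smooth_transition: "c \<in> A \<Longrightarrow> d \<in> A \<Longrightarrow> smooth_on (overlap c d) (transition c d)"
  using atlas by (auto simp: smooth_atlas_def overlap_def)

lemma transition_chart [simp]: "c \<in> A \<Longrightarrow> p \<in> fst c \<Longrightarrow> transition c d (snd c p) = snd d p"
  by (simp add: transition_def)

lemma transition_has_derivative:
  assumes "c \<in> A" "d \<in> A" "p \<in> fst c" "p \<in> fst d"
  shows "(transition c d has_derivative tangent_change c d p) (at (snd c p))"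
  unfolding tangent_change_def
  using smooth_on_has_derivative[OF smooth_transition] assms by auto

lemma linear_tangent_change:
  assumes "c \<in> A" "d \<in> A" "p \<in> fst c" "p \<in> fst d"
  shows "linear (tangent_change c d p)"
  using transition_has_derivative[OF assms] by (rule has_derivative_linear)

text \<open>The chain rule: near the coordinates of \<open>p\<close> the two transition maps compose
  to the direct one, and derivatives are unique.\<close>

lemma tangent_change_compose:
  assumes "c \<in> A" "d \<in> A" "e \<in> A" "p \<in> fst c" "p \<in> fst d" "p \<in> fst e"
  shows "tangent_change d e p (tangent_change c d p u) = tangent_change c e p u"
proof -
  have "(transition d e has_derivative tangent_change d e p) (at (transition c d (snd c p)))"
    using transition_has_derivative assms by simp
  from has_derivative_compose[OF transition_has_derivative[OF assms(1,2,4,5)] this]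
  have 1: "((\<lambda>x. transition d e (transition c d x)) has_derivative
      (\<lambda>u. tangent_change d e p (tangent_change c d p u))) (at (snd c p))" .
  have "((\<lambda>x. transition d e (transition c d x)) has_derivative tangent_change c e p) (at (snd c p))"
  proof (rule has_derivative_transform_within_open[OF transition_has_derivative])
    show "open (overlap c d \<inter> overlap c e)"
      using assms by (intro open_Int open_overlap)
    fix x assume "x \<in> overlap c d \<inter> overlap c e"
    then show "transition c e x = transition d e (transition c d x)"
      using assms chart_inv_overlap[of c x d] by (simp add: transition_def)
  qed (use assms in auto)
  from has_derivative_unique[OF 1 this] show ?thesis by metis
qed

lemma tangent_change_id:
  assumes "c \<in> A" "p \<in> fst c"
  shows "tangent_change c c p u = u"
proof -
  have "((\<lambda>x. x) has_derivative tangent_change c c p) (at (snd c p))"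
    by (rule has_derivative_transform_within_open[OF transition_has_derivative chart_open(2)[of c]])
       (use assms in \<open>auto simp: transition_def\<close>)
  then show ?thesis
    using has_derivative_unique[OF _ has_derivative_ident] by metis
qed

lemma from_to_chart:
  assumes "c \<in> A" "p \<in> fst c"
  shows "from_chart A c p (to_chart A c p u) = u" "to_chart A c p (from_chart A c p u) = u"
  using assms by (auto simp: from_chart_def to_chart_def tangent_change_compose tangent_change_id)

lemma linear_to_chart: "c \<in> A \<Longrightarrow> p \<in> fst c \<Longrightarrow> linear (to_chart A c p)"
  and linear_from_chart: "c \<in> A \<Longrightarrow> p \<in> fst c \<Longrightarrow> linear (from_chart A c p)"
  unfolding to_chart_def from_chart_def by (auto intro!: linear_tangent_change)

section \<open>The metric and vector fields in coordinates\<close>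

lemma metric_bilinear: "bilinear (g p)" and metric_sym: "g p u v = g p v u"
  and metric_pos: "v \<noteq> 0 \<Longrightarrow> g p v v > 0"
  using metric by (auto simp: riemannian_metric_def)

lemma metric_nonneg: "0 \<le> g p v v"
  using metric_pos[of v p] bilinear_lzero[OF metric_bilinear, of p 0] by (cases "v = 0") auto

lemma metric_rep_chart:
  "c \<in> A \<Longrightarrow> p \<in> fst c \<Longrightarrow> metric_rep A g c (snd c p) u v = g p (from_chart A c p u) (from_chart A c p v)"
  by (simp add: metric_rep_def)

lemma metric_rep_to_chart:
  "c \<in> A \<Longrightarrow> p \<in> fst c \<Longrightarrow>
    metric_rep A g c (snd c p) (to_chart A c p u) (to_chart A c p v) = g p u v"
  by (simp add: metric_rep_chart from_to_chart)

lemma bilinear_metric_rep: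
  assumes "c \<in> A" "x \<in> chart_image c"
  shows "bilinear (metric_rep A g c x)"
proof -
  have "linear (from_chart A c (chart_inv c x))" using assms by (simp add: linear_from_chart)
  then show ?thesis
    using metric_bilinear[of "chart_inv c x"] unfolding bilinear_def metric_rep_def
    by (auto intro: linear_compose[of "from_chart A c (chart_inv c x)", unfolded comp_def])
qed

lemma metric_rep_sym: "metric_rep A g c x u v = metric_rep A g c x v u"
  by (simp add: metric_rep_def metric_sym)

lemma metric_rep_pos:
  assumes "c \<in> A" "x \<in> chart_image c" "v \<noteq> 0"
  shows "metric_rep A g c x v v > 0"
proof -
  have "from_chart A c (chart_inv c x) v \<noteq> 0"
    using from_to_chart(2)[of c "chart_inv c x" v] linear_to_chart[of c "chart_inv c x"] assms
    by (metis chart_inv_right(1) linear_0)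
  then show ?thesis by (simp add: metric_rep_def metric_pos)
qed

lemma metric_rep_smooth: "c \<in> A \<Longrightarrow> smooth_on (chart_image c) (\<lambda>x. metric_rep A g c x u v)"
  using metric by (simp add: riemannian_metric_def)

lemma metric_rep_transition:
  assumes "c \<in> A" "d \<in> A" "p \<in> fst c" "p \<in> fst d"
  shows "metric_rep A g d (snd d p) (tangent_change c d p u) (tangent_change c d p v)
       = metric_rep A g c (snd c p) u v"
  using assms by (simp add: metric_rep_chart from_chart_def tangent_change_compose)

lemma metric_rep_chart_at: "metric_rep A g (chart_at A p) (snd (chart_at A p) p) u v = g p u v"
  by (simp add: metric_rep_chart from_chart_def tangent_change_id)

lemma vf_rep_chart: "c \<in> A \<Longrightarrow> p \<in> fst c \<Longrightarrow> vf_rep A X c (snd c p) = to_chart A c p (X p)"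
  by (simp add: vf_rep_def)

lemma vf_rep_transition:
  assumes "c \<in> A" "d \<in> A" "p \<in> fst c" "p \<in> fst d"
  shows "vf_rep A X d (snd d p) = tangent_change c d p (vf_rep A X c (snd c p))"
  using assms by (simp add: vf_rep_chart to_chart_def tangent_change_compose)

section \<open>Half of the Lie derivative of the metric and its invariance\<close>

text \<open>By Koszul's formula the Christoffel terms of \<open>g(\<nabla>\<^sub>v X, v)\<close> reduce to half of \<open>\<partial>\<^sub>X g(v, v)\<close>. This is
  the restriction to the diagonal of the following bilinear form, half of the Lie derivative
  of \<open>g\<close> along \<open>X\<close>.\<close>

definition div_form :: "('a \<Rightarrow> 'b) \<Rightarrow> ('a, 'b) chart \<Rightarrow> 'b \<Rightarrow> 'b \<Rightarrow> 'b \<Rightarrow> real" where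
  "div_form X c x u v = metric_rep A g c x (frechet_derivative (vf_rep A X c) (at x) u) v
     + metric_deriv A g c x (vf_rep A X c x) u v / 2"

lemma vf_rep_has_derivative:
  assumes "smooth_vector_field A X" "c \<in> A" "x \<in> chart_image c"
  shows "(vf_rep A X c has_derivative frechet_derivative (vf_rep A X c) (at x)) (at x)"
  using assms smooth_on_has_derivative unfolding smooth_vector_field_def by blast

lemma metric_rep_has_derivative:
  assumes "c \<in> A" "x \<in> chart_image c"
    and "(\<tau> has_derivative T) (at y)" "\<tau> y = x" "(a has_derivative a') (at y)" "(b has_derivative b') (at y)"
  shows "((\<lambda>y. metric_rep A g c (\<tau> y) (a y) (b y)) has_derivative
     (\<lambda>w. metric_deriv A g c x (T w) (a y) (b y) + metric_rep A g c x (a' w) (b y)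
        + metric_rep A g c x (a y) (b' w))) (at y)"
  unfolding metric_deriv_def
  using has_derivative_bilinear_family[OF chart_open(2)[OF assms(1)], of \<tau> y "metric_rep A g c", OF _ _ _ assms(3,5,6)]
    assms smooth_on_differentiable[OF metric_rep_smooth[OF assms(1)]] bilinear_metric_rep
  by simp

lemma metric_deriv_linear:
  assumes "c \<in> A" "x \<in> chart_image c"
  shows "linear (\<lambda>z. metric_deriv A g c x z u v)"
  unfolding metric_deriv_def
  using smooth_on_has_derivative[OF metric_rep_smooth] assms has_derivative_linear by blast

lemma metric_deriv_sym: "metric_deriv A g c x z u v = metric_deriv A g c x z v u"
  by (simp add: metric_deriv_def metric_rep_sym[of c _ u v])

text \<open>Additivity and homogeneity of the forms hold throughout the open chart image, so
  uniqueness of derivatives passes them on to the derivative.\<close>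

lemma metric_deriv_bilinear:
  assumes "c \<in> A" "x \<in> chart_image c"
  shows "bilinear (metric_deriv A g c x z)"
proof -
  have *: "((\<lambda>y. metric_rep A g c y u v) has_derivative (\<lambda>w. metric_deriv A g c x w u v)) (at x)" for u v
    unfolding metric_deriv_def
    using smooth_on_has_derivative[OF metric_rep_smooth] assms by blast
  note bil = bilinear_metric_rep[OF assms(1)]
  have add: "metric_deriv A g c x z (u + u') v = metric_deriv A g c x z u v + metric_deriv A g c x z u' v" for u u' v
  proof -
    have "((\<lambda>y. metric_rep A g c y (u + u') v) has_derivative 
        (\<lambda>w. metric_deriv A g c x w u v + metric_deriv A g c x w u' v)) (at x)"
      by (rule has_derivative_transform_within_open[OF has_derivative_add[OF * *] chart_open(2)[OF assms(1)] assms(2)])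
         (simp add: bilinear_ladd[OF bil])
    from has_derivative_unique[OF this *] show ?thesis by metis
  qed
  have scale: "metric_deriv A g c x z (r *\<^sub>R u) v = r * metric_deriv A g c x z u v" for r u v
  proof -
    have "((\<lambda>y. metric_rep A g c y (r *\<^sub>R u) v) has_derivative 
        (\<lambda>w. r * metric_deriv A g c x w u v)) (at x)"
      by (rule has_derivative_transform_within_open[OF has_derivative_mult_right[OF *] chart_open(2)[OF assms(1)] assms(2)])
         (simp add: bilinear_lmul[OF bil])
    from has_derivative_unique[OF this *] show ?thesis by metis
  qed
  show ?thesis
    unfolding bilinear_def using add scale metric_deriv_sym[of c x z] by (auto intro!: linearI)
qed

lemma bilinear_div_form:
  assumes "smooth_vector_field A X" "c \<in> A" "x \<in> chart_image c"
  shows "bilinear (div_form X c x)"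
proof -
  have 1: "linear (frechet_derivative (vf_rep A X c) (at x))"
    using vf_rep_has_derivative[OF assms] by (rule has_derivative_linear)
  note b = bilinear_metric_rep[OF assms(2,3)] metric_deriv_bilinear[OF assms(2,3)]
  show ?thesis
    unfolding bilinear_def div_form_def
    by (auto intro!: linearI simp: linear_add[OF 1] linear_cmul[OF 1] bilinear_ladd[OF b(1)] bilinear_radd[OF b(1)]
       bilinear_ladd[OF b(2)] bilinear_radd[OF b(2)] bilinear_lmul[OF b(1)] bilinear_rmul[OF b(1)]
       bilinear_lmul[OF b(2)] bilinear_rmul[OF b(2)] algebra_simps)
qed

text \<open>Differentiating the transformation laws of the metric and of the field produces, each
  time, a term with the second derivative \<open>T2\<close> of the transition map. In one the two
  arguments are \<open>Z x\<close> and \<open>v\<close>, in the other \<open>v\<close> and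
  \<open>Z x\<close>; symmetry of \<open>T2\<close> makes them cancel, and the remaining terms
  transform as tensors.\<close>

lemma div_form_transition:
  assumes X: "smooth_vector_field A X"
    and c: "c \<in> A" "d \<in> A" "p \<in> fst c" "p \<in> fst d"
  shows "div_form X d (snd d p) (tangent_change c d p v) (tangent_change c d p v)
       = div_form X c (snd c p) v v"
proof -
  define x where "x = snd c p"
  define y where "y = snd d p"
  define \<tau> where "\<tau> = transition c d"
  define T where "T x = frechet_derivative \<tau> (at x)" for x
  define Z where "Z = vf_rep A X c"
  define Z' where "Z' = frechet_derivative Z (at x)"
  define T2 where "T2 w v = frechet_derivative (\<lambda>x. T x v) (at x) w" for w v
  note op = open_overlap[OF c(1,2)]
  note sm = smooth_transition[OF c(1,2), folded \<tau>_def]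
  have x: "x \<in> overlap c d" "x \<in> chart_image c" "y \<in> chart_image d" "\<tau> x = y"
    using c by (auto simp: x_def y_def \<tau>_def)
  have Tx: "T x = tangent_change c d p" by (simp add: T_def tangent_change_def \<tau>_def x_def)
  have Tp: "T (snd c q) = tangent_change c d q" for q
    by (simp add: T_def tangent_change_def \<tau>_def)
  have \<tau>: "(\<tau> has_derivative T x) (at x)"
    unfolding T_def using smooth_on_has_derivative[OF sm x(1)] .
  have Tv: "((\<lambda>x. T x u) has_derivative (\<lambda>w. T2 w u)) (at x)" for u
    unfolding T2_def T_def using smooth_on_has_derivative[OF smooth_on_frechet_derivative[OF sm] x(1)] .
  have Z: "(Z has_derivative Z') (at x)"
    unfolding Z_def Z'_def using vf_rep_has_derivative[OF X c(1) x(2)] .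
  have lin: "linear (T x)" if "x \<in> overlap c d" for x
    using has_derivative_linear smooth_on_has_derivative[OF sm that] by (auto simp: T_def)
  note m = bilinear_metric_rep[OF c(2) x(3)]
  have "((\<lambda>x. metric_rep A g d (\<tau> x) (T x v) (T x v)) has_derivative
     (\<lambda>w. metric_deriv A g d y (T x w) (T x v) (T x v) + metric_rep A g d y (T2 w v) (T x v)
        + metric_rep A g d y (T x v) (T2 w v))) (at x)"
    by (rule metric_rep_has_derivative[OF c(2) x(3) \<tau> x(4) Tv Tv])
  then have "((\<lambda>x. metric_rep A g c x v v) has_derivative
     (\<lambda>w. metric_deriv A g d y (T x w) (T x v) (T x v) + metric_rep A g d y (T2 w v) (T x v)
        + metric_rep A g d y (T x v) (T2 w v))) (at x)"
  proof (rule has_derivative_transform_within_open[OF _ op x(1)])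
    fix z assume "z \<in> overlap c d"
    then obtain q where q: "q \<in> fst c" "q \<in> fst d" "z = snd c q" by (auto simp: overlap_def)
    show "metric_rep A g d (\<tau> z) (T z v) (T z v) = metric_rep A g c z v v"
      unfolding q(3) Tp \<tau>_def using metric_rep_transition[OF c(1,2) q(1,2)] c(1) q(1) by simp
  qed
  from differentiable_frechetI[OF this]
  \<comment> \<open>The metric law contributes its second-derivative term twice, which the factor
    one half in \<open>div_form\<close> reduces to one.\<close>
  have 1: "metric_deriv A g c x w v v = metric_deriv A g d y (T x w) (T x v) (T x v)
      + 2 * metric_rep A g d y (T2 w v) (T x v)" for w
    unfolding metric_deriv_def by (simp add: metric_rep_sym[of d y "T x v"])
  have dvf: "(vf_rep A X d has_derivative frechet_derivative (vf_rep A X d) (at y)) (at (\<tau> x))"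
    unfolding x(4) by (rule vf_rep_has_derivative[OF X c(2) x(3)])
  have 2: "((\<lambda>x. vf_rep A X d (\<tau> x)) has_derivative (\<lambda>w. frechet_derivative (vf_rep A X d) (at y) (T x w))) (at x)"
    by (rule has_derivative_compose[OF \<tau> dvf])
  have "((\<lambda>x. T x (Z x)) has_derivative
           (\<lambda>w. frechet_derivative (\<lambda>y. T y (Z x)) (at x) w + T x (Z' w))) (at x)"
    by (rule has_derivative_linear_family[OF op x(1) lin _ Z]) (use Tv in \<open>auto simp: differentiable_def\<close>)
  then have "((\<lambda>x. vf_rep A X d (\<tau> x)) has_derivative
           (\<lambda>w. T2 w (Z x) + T x (Z' w))) (at x)"
    unfolding T2_def[symmetric]
  proof (rule has_derivative_transform_within_open[OF _ op x(1)])
    fix z assume "z \<in> overlap c d"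
    then obtain q where q: "q \<in> fst c" "q \<in> fst d" "z = snd c q" by (auto simp: overlap_def)
    show "T z (Z z) = vf_rep A X d (\<tau> z)"
      unfolding q(3) Tp \<tau>_def Z_def using vf_rep_transition[OF c(1,2) q(1,2)] c(1) q(1) by simp
  qed
  from has_derivative_unique[OF 2 this]
  have 3: "frechet_derivative (vf_rep A X d) (at y) (T x w) = T2 w (Z x) + T x (Z' w)" for w
    by metis
  \<comment> \<open>This is the cancellation between \<open>1\<close> at \<open>w = Z x\<close> and
    \<open>3\<close> at \<open>w = v\<close>.\<close>
  have 4: "T2 v (Z x) = T2 (Z x) v"
    unfolding T2_def T_def by (rule second_derivative_commute[OF op x(1) sm])
  have 5: "vf_rep A X d y = T x (Z x)"
    unfolding y_def Z_def x_def Tp by (rule vf_rep_transition[OF c])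
  have 6: "metric_rep A g d y (T x (Z' v)) (T x v) = metric_rep A g c x (Z' v) v"
    unfolding y_def x_def Tp by (rule metric_rep_transition[OF c])
  show ?thesis
    unfolding div_form_def x_def[symmetric] y_def[symmetric] Tx[symmetric] 3 5
    using 1[of "Z x"] 4 6 by (simp add: bilinear_ladd[OF m] Z_def Z'_def)
qed

section \<open>Christoffel symbols and the Levi-Civita derivative\<close>

text \<open>The definite description is justified by a Riesz argument. \<open>F\<close> represents
  the functional \<open>metric_rep A g c x w\<close> by a vector; positivity makes it injective,
  finite dimension makes it surjective, and the right side of Koszul's formula is linear in
  \<open>z\<close>.\<close>

lemma christoffel_metric_rep:
  assumes "c \<in> A" "x \<in> chart_image c"
  shows "metric_rep A g c x (christoffel A g c x u v) z =
     (metric_deriv A g c x u v z + metric_deriv A g c x v u z - metric_deriv A g c x z u v) / 2"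
proof -
  note m = bilinear_metric_rep[OF assms]
  define F where "F w = (\<Sum>i\<in>Basis. metric_rep A g c x w i *\<^sub>R i)" for w
  have mz: "linear (\<lambda>z. metric_rep A g c x w z)" "linear (\<lambda>w. metric_rep A g c x w z)" for w z
    using m[unfolded bilinear_def, THEN conjunct1, rule_format, of w]
      m[unfolded bilinear_def, THEN conjunct2, rule_format, of z] by blast+
  have F: "F w \<bullet> z = metric_rep A g c x w z" for w z
    using linear_euclidean_sum[OF mz(1), of w z] by (simp add: F_def inner_sum_left inner_commute[of z] mult.commute)
  have linF: "linear F"
  proof (rule linearI)
    show "F (u + v) = F u + F v" for u v
      by (simp add: F_def bilinear_ladd[OF m] scaleR_add_left sum.distrib)
    show "F (r *\<^sub>R u) = r *\<^sub>R F u" for r u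
      by (simp add: F_def bilinear_lmul[OF m] scaleR_sum_right)
  qed
  have "inj F"
  proof (subst linear_injective_0[OF linF], intro allI impI)
    fix w assume "F w = 0"
    then have "metric_rep A g c x w w = 0" using F[of w w] by simp
    then show "w = 0" using metric_rep_pos[OF assms, of w] by fastforce
  qed
  then have "surj F" by (rule linear_inj_imp_surj[OF linF])
  define R where "R z = (metric_deriv A g c x u v z + metric_deriv A g c x v u z - metric_deriv A g c x z u v) / 2" for z
  have "linear R"
  proof (rule linearI)
    note b = metric_deriv_bilinear[OF assms] and l = metric_deriv_linear[OF assms]
    show "R (y + z) = R y + R z" for y z
      unfolding R_def bilinear_radd[OF b] linear_add[OF l] by argo
    show "R (r *\<^sub>R z) = r *\<^sub>R R z" for r z
      unfolding R_def bilinear_rmul[OF b] linear_cmul[OF l] real_scaleR_def by argo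
  qed
  then have R: "(\<Sum>i\<in>Basis. R i *\<^sub>R i) \<bullet> z = R z" for z
    using linear_euclidean_sum[of R z] by (simp add: inner_sum_left inner_commute[of z] mult.commute)
  obtain w where w: "F w = (\<Sum>i\<in>Basis. R i *\<^sub>R i)"
    using \<open>surj F\<close> by (metis surjD)
  have "\<exists>!w. \<forall>z. metric_rep A g c x w z = R z"
  proof (rule ex1I[of _ w])
    show "\<forall>z. metric_rep A g c x w z = R z"
      unfolding F[symmetric] w R by simp
    fix w' assume w': "\<forall>z. metric_rep A g c x w' z = R z"
    have "F w' \<bullet> z = F w \<bullet> z" for z
      unfolding w R F by (rule w'[rule_format])
    then have "F w' = F w" by (rule euclidean_eqI)
    then show "w' = w" using \<open>inj F\<close> by (simp add: inj_eq)
  qed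
  from theI'[OF this, unfolded R_def, THEN spec] show ?thesis
    unfolding christoffel_def .
qed

lemma metric_covariant_derivative:
  assumes X: "smooth_vector_field A X"
  shows "g p (covariant_derivative A g X p v) v =
    div_form X (chart_at A p) (snd (chart_at A p) p) v v"
proof -
  define c where "c = chart_at A p"
  define x where "x = snd c p"
  have c: "c \<in> A" "x \<in> chart_image c" by (auto simp: c_def x_def)
  have gp: "g p u v = metric_rep A g c x u v" for u v
    by (simp add: c_def x_def metric_rep_chart_at)
  have cd: "covariant_derivative A g X p v =
      frechet_derivative (vf_rep A X c) (at x) v + christoffel A g c x v (vf_rep A X c x)"
    by (simp only: covariant_derivative_def Let_def c_def x_def)
  \<comment> \<open>Pairing with \<open>v\<close> itself makes the first and third Koszul terms
    cancel by symmetry of the metric.\<close>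
  have ch: "metric_rep A g c x (christoffel A g c x v (vf_rep A X c x)) v
      = metric_deriv A g c x (vf_rep A X c x) v v / 2"
    unfolding christoffel_metric_rep[OF c] metric_deriv_sym[of c x v "vf_rep A X c x" v] by simp
  show ?thesis
    unfolding c_def[symmetric] x_def[symmetric] gp cd div_form_def
      bilinear_ladd[OF bilinear_metric_rep[OF c]] ch ..
qed

end

section \<open>Subspaces and their orthogonal projections\<close>

text \<open>A closed graph over a compact range. It suits objects characterised by equations that
  survive limits but given by no convenient formula: a subsequence violating convergence would have
  a further convergent subsequence, whose limit is forced to be \<open>f x\<close>.\<close>

lemma continuous_on_compact_range_closed_graph:
  fixes f :: "'x::metric_space \<Rightarrow> 'y::metric_space"
  assumes T: "compact T" "f ` S \<subseteq> T"
    and closed: "\<And>u x y. (\<And>n. u n \<in> S) \<Longrightarrow> x \<in> S \<Longrightarrow> u \<longlonglongrightarrow> x \<Longrightarrow> (\<lambda>n. f (u n)) \<longlonglongrightarrow> y \<Longrightarrow> y = f x"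
  shows "continuous_on S f"
  unfolding continuous_on_sequentially
proof (intro ballI allI impI, elim conjE)
  fix x u assume x: "x \<in> S" and u: "\<forall>n. u n \<in> S" "u \<longlonglongrightarrow> x"
  show "(f \<circ> u) \<longlonglongrightarrow> f x"
  proof (rule ccontr)
    assume "\<not> (f \<circ> u) \<longlonglongrightarrow> f x"
    then obtain e where e: "e > 0" "\<forall>N. \<exists>n\<ge>N. \<not> dist ((f \<circ> u) n) (f x) < e"
      unfolding lim_sequentially by blast
    then have "infinite {n. \<not> dist ((f \<circ> u) n) (f x) < e}"
      unfolding infinite_nat_iff_unbounded_le by blast
    from infinite_enumerate[OF this]
    obtain r :: "nat \<Rightarrow> nat" where r: "strict_mono r" "\<And>n. \<not> dist (f (u (r n))) (f x) < e"
      by (auto simp: comp_def)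
    have "\<forall>n. f (u (r n)) \<in> T" using T(2) u(1) by blast
    then obtain y s where s: "strict_mono s" "((\<lambda>n. f (u (r n))) \<circ> s) \<longlonglongrightarrow> y"
      using T(1) unfolding compact_def by meson
    have "(\<lambda>n. u (r (s n))) \<longlonglongrightarrow> x"
      using LIMSEQ_subseq_LIMSEQ[OF LIMSEQ_subseq_LIMSEQ[OF u(2) r(1)] s(1)] by (simp add: comp_def)
    then have "y = f x"
      using s(2) u(1) x by (intro closed[of "\<lambda>n. u (r (s n))"]) (auto simp: comp_def)
    then have "\<forall>\<^sub>F n in sequentially. dist (f (u (r (s n)))) (f x) < e"
      using tendstoD[OF s(2) e(1)] by (simp add: comp_def)
    then show False using r(2) by (auto simp: eventually_sequentially)
  qed
qed

lemma tendsto_linear_family: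
  fixes L :: "'x \<Rightarrow> 'b::euclidean_space \<Rightarrow> 'y::real_normed_vector"
  assumes "\<And>n. linear (L (u n))" "linear (L x)" "\<And>b. ((\<lambda>n. L (u n) b) \<longlongrightarrow> L x b) F" "(a \<longlongrightarrow> a') F"
  shows "((\<lambda>n. L (u n) (a n)) \<longlongrightarrow> L x a') F"
proof -
  have "((\<lambda>n. \<Sum>i\<in>Basis. (a n \<bullet> i) *\<^sub>R L (u n) i) \<longlongrightarrow> (\<Sum>i\<in>Basis. (a' \<bullet> i) *\<^sub>R L x i)) F"
    by (intro tendsto_intros assms)
  moreover have "(\<lambda>n. L (u n) (a n)) = (\<lambda>n. \<Sum>i\<in>Basis. (a n \<bullet> i) *\<^sub>R L (u n) i)"
    by (intro ext linear_euclidean_sum assms)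
  moreover have "L x a' = (\<Sum>i\<in>Basis. (a' \<bullet> i) *\<^sub>R L x i)"
    by (intro linear_euclidean_sum assms)
  ultimately show ?thesis by metis
qed

lemma tendsto_bilinear_family:
  fixes M :: "'x \<Rightarrow> 'b::euclidean_space \<Rightarrow> 'b \<Rightarrow> real"
  assumes "\<And>n. bilinear (M (u n))" "bilinear (M x)" "\<And>b c. ((\<lambda>n. M (u n) b c) \<longlongrightarrow> M x b c) F"
    "(a \<longlongrightarrow> a') F" "(b \<longlongrightarrow> b') F"
  shows "((\<lambda>n. M (u n) (a n) (b n)) \<longlongrightarrow> M x a' b') F"
proof -
  have "((\<lambda>n. \<Sum>i\<in>Basis. \<Sum>j\<in>Basis. (a n \<bullet> i) * (b n \<bullet> j) * M (u n) i j) \<longlongrightarrow>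
      (\<Sum>i\<in>Basis. \<Sum>j\<in>Basis. (a' \<bullet> i) * (b' \<bullet> j) * M x i j)) F"
    by (intro tendsto_intros assms)
  moreover have "(\<lambda>n. M (u n) (a n) (b n)) =
      (\<lambda>n. \<Sum>i\<in>Basis. \<Sum>j\<in>Basis. (a n \<bullet> i) * (b n \<bullet> j) * M (u n) i j)"
    by (intro ext bilinear_euclidean_sum assms)
  moreover have "M x a' b' = (\<Sum>i\<in>Basis. \<Sum>j\<in>Basis. (a' \<bullet> i) * (b' \<bullet> j) * M x i j)"
    by (intro bilinear_euclidean_sum assms)
  ultimately show ?thesis by metis
qed

lemma continuous_on_bilinear_family:
  fixes M :: "'x::topological_space \<Rightarrow> 'b::euclidean_space \<Rightarrow> 'b \<Rightarrow> real"
  assumes "\<And>x. x \<in> S \<Longrightarrow> bilinear (M x)" "\<And>u v. continuous_on S (\<lambda>x. M x u v)"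
    "continuous_on S a" "continuous_on S b"
  shows "continuous_on S (\<lambda>x. M x (a x) (b x))"
proof -
  have "continuous_on S (\<lambda>x. \<Sum>i\<in>Basis. \<Sum>j\<in>Basis. (a x \<bullet> i) * (b x \<bullet> j) * M x i j)"
    by (intro continuous_intros assms)
  then show ?thesis
    by (rule continuous_on_eq) (use bilinear_euclidean_sum[OF assms(1), symmetric] in blast)
qed

section \<open>Projections as points of the Grassmannian\<close>

lemma
  fixes S :: "'b::euclidean_space set"
  assumes S: "subspace S"
  shows proj_onto_mem: "proj_onto S x \<in> S"
    and proj_onto_orthogonal: "z \<in> S \<Longrightarrow> (x - proj_onto S x) \<bullet> z = 0"
    and proj_onto_self: "x \<in> S \<Longrightarrow> proj_onto S x = x"
proof -
  have cl: "closed S" and cv: "convex S" and ne: "S \<noteq> {}"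
    using S closed_subspace subspace_imp_convex subspace_0 by auto
  have P: "proj_onto S x = closest_point S x" for x
    by (simp add: proj_onto_def bounded_linear_Blinfun_apply bounded_linear_closest_point[OF S])
  show mem: "proj_onto S x \<in> S" for x
    unfolding P using closest_point_in_set[OF cl ne] .
  show "proj_onto S x = x" if "x \<in> S" for x
    unfolding P using closest_point_self[OF that] .
  show "(x - proj_onto S x) \<bullet> z = 0" if z: "z \<in> S" for z
  proof -
    define p where "p = closest_point S x"
    have le: "(x - p) \<bullet> (y - p) \<le> 0" if "y \<in> S" for y
      unfolding p_def by (rule closest_point_dot[OF cv cl that])
    have p: "p \<in> S" unfolding p_def using closest_point_in_set[OF cl ne] .
    \<comment> \<open>Both \<open>z\<close> and its negative are admissible, which turns the obtuse
      angle inequality into orthogonality.\<close>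
    have "(x - p) \<bullet> z \<le> 0" "(x - p) \<bullet> (- z) \<le> 0"
      using le[of "p + z"] le[of "p - z"] p z S by (auto simp: subspace_add subspace_diff)
    then show ?thesis unfolding P p_def[symmetric] by simp
  qed
qed

lemma range_proj_onto: "subspace S \<Longrightarrow> range (proj_onto S) = S"
  using proj_onto_mem proj_onto_self by (metis image_subset_iff rangeI subsetI subset_antisym UNIV_I)

lemma proj_onto_symmetric:
  assumes "subspace S"
  shows "proj_onto S x \<bullet> y = x \<bullet> proj_onto S y"
  using proj_onto_orthogonal[OF assms proj_onto_mem[OF assms], of x y]
    proj_onto_orthogonal[OF assms proj_onto_mem[OF assms], of y x]
  by (simp add: inner_diff_left) (simp add: inner_commute)

lemma proj_onto_eqI:
  fixes P :: "'b::euclidean_space \<Rightarrow>\<^sub>L 'b"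
  assumes idem: "\<And>x. P (P x) = P x" and sym: "\<And>x y. P x \<bullet> y = x \<bullet> P y"
  shows "proj_onto (range P) = P"
proof (rule blinfun_eqI)
  fix x
  have S: "subspace (range P)"
    by (simp add: blinfun.bounded_linear_right bounded_linear.linear linear_subspace_image)
  have "proj_onto (range P) x = P (proj_onto (range P) x)"
    using proj_onto_mem[OF S, of x] idem by auto
  also have "\<dots> = P x"
  proof (rule euclidean_eqI)
    fix b
    show "P (proj_onto (range P) x) \<bullet> b = P x \<bullet> b"
      using proj_onto_orthogonal[OF S, of "P b" x] by (simp add: sym inner_diff_left)
  qed
  finally show "proj_onto (range P) x = P x" .
qed

text \<open>The trace expresses the dimension by an equation continuous in the projection, so the
  dimension survives limits.\<close>

lemma trace_proj_onto:
  fixes S :: "'b::euclidean_space set"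
  assumes S: "subspace S"
  shows "(\<Sum>b\<in>Basis. proj_onto S b \<bullet> b) = dim S"
proof -
  obtain B where B: "B \<subseteq> S" "pairwise orthogonal B" "\<And>x. x \<in> B \<Longrightarrow> norm x = 1"
      "independent B" "card B = dim S" "span B = S"
    using orthonormal_basis_subspace[OF S] by metis
  have fB: "finite B" using B(4) by (rule independent_imp_finite)
  have "proj_onto S x = (\<Sum>e\<in>B. (x \<bullet> e) *\<^sub>R e)" for x
  proof -
    define y where "y = (\<Sum>e\<in>B. (x \<bullet> e) *\<^sub>R e)"
    have y: "y \<in> S" unfolding y_def using B(1) S by (intro subspace_sum subspace_scale) auto
    have ye: "y \<bullet> e = x \<bullet> e" if "e \<in> B" for e
    proof -
      have "e' \<bullet> e = (if e' = e then 1 else 0)" if "e' \<in> B" for e'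
        using B(2,3) that \<open>e \<in> B\<close> by (auto simp: pairwise_def orthogonal_def norm_eq_1)
      then have "y \<bullet> e = (\<Sum>e'\<in>B. if e' = e then x \<bullet> e' else 0)"
        unfolding y_def inner_sum_left by (intro sum.cong) auto
      then show ?thesis using fB that by simp
    qed
    have "(x - y) \<bullet> z = 0" if "z \<in> span B" for z
      using that by (induction rule: span_induct_alt)
        (auto simp: inner_add_right ye inner_diff_left)
    moreover have "proj_onto S x - y \<in> S"
      using proj_onto_mem[OF S] y S by (simp add: subspace_diff)
    ultimately have "(x - y) \<bullet> (proj_onto S x - y) = 0" "(x - proj_onto S x) \<bullet> (proj_onto S x - y) = 0"
      using B(6) proj_onto_orthogonal[OF S] by auto
    then have "(proj_onto S x - y) \<bullet> (proj_onto S x - y) = 0"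
      by (simp add: inner_diff_left)
    then show ?thesis by (simp add: y_def)
  qed
  then have "(\<Sum>b\<in>Basis. proj_onto S b \<bullet> b) = (\<Sum>b\<in>Basis. \<Sum>e\<in>B. (b \<bullet> e) * (e \<bullet> b))"
    by (simp only: inner_sum_left inner_scaleR_left)
  also have "\<dots> = (\<Sum>e\<in>B. \<Sum>b\<in>Basis. (e \<bullet> b) * (e \<bullet> b))"
    by (subst sum.swap) (simp add: inner_commute)
  also have "\<dots> = (\<Sum>e\<in>B. 1)"
    using B(3) by (intro sum.cong refl) (metis euclidean_inner norm_eq_1)
  finally show ?thesis using B(5) by simp
qed

definition projections :: "nat \<Rightarrow> ('b::euclidean_space \<Rightarrow>\<^sub>L 'b) set" where
  "projections k = proj_onto ` {S. subspace S \<and> dim S = k}"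

text \<open>Idempotent, symmetric, of trace \<open>k\<close>: three closed conditions, from which
  closedness of the set of projections is read off.\<close>

lemma projections_iff:
  "P \<in> projections k \<longleftrightarrow>
    (\<forall>x. P (P x) = P x) \<and> (\<forall>x y. P x \<bullet> y = x \<bullet> P y) \<and> (\<Sum>b\<in>Basis. P b \<bullet> b) = real k"
  (is "_ \<longleftrightarrow> ?R P")
proof
  assume "P \<in> projections k"
  then show "?R P"
    unfolding projections_def
    by (auto simp: proj_onto_symmetric proj_onto_self proj_onto_mem simp del: inner_commute)
       (use trace_proj_onto in \<open>simp add: inner_commute\<close>)
next
  assume R: "?R P"
  then have P: "proj_onto (range P) = P" by (intro proj_onto_eqI) auto
  have S: "subspace (range P)"
    by (simp add: blinfun.bounded_linear_right bounded_linear.linear linear_subspace_image)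
  then have "real (dim (range P)) = real k"
    using trace_proj_onto[OF S] R unfolding P by linarith
  then show "P \<in> projections k"
    using S P by (auto simp: projections_def intro!: image_eqI[of _ _ "range P"])
qed

lemma projections_range:
  assumes "P \<in> projections k"
  shows "subspace (range P)" "dim (range P) = k" "proj_onto (range P) = P"
  using assms by (auto simp: projections_def range_proj_onto)

lemma projections_idem: "P \<in> projections k \<Longrightarrow> P (P x) = P x"
  and projections_sym: "P \<in> projections k \<Longrightarrow> P x \<bullet> y = x \<bullet> P y"
  by (auto simp: projections_iff)

lemma compact_projections: "compact (projections k :: ('b::euclidean_space \<Rightarrow>\<^sub>L 'b) set)"
proof -
  have "norm P \<le> 1" if "P \<in> projections k" for P :: "'b \<Rightarrow>\<^sub>L 'b"
  proof (rule norm_blinfun_bound)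
    fix x
    have "norm (P x) * norm (P x) = x \<bullet> P x"
      using projections_idem[OF that] projections_sym[OF that, of x "P x"]
      by (simp flip: power2_eq_square add: power2_norm_eq_inner)
    also have "\<dots> \<le> norm x * norm (P x)" by (rule norm_cauchy_schwarz)
    finally show "norm (P x) \<le> 1 * norm x"
      by (cases "norm (P x) = 0") auto
  qed simp
  then have "bounded (projections k :: ('b \<Rightarrow>\<^sub>L 'b) set)"
    by (auto simp: bounded_iff)
  moreover have "closed (projections k :: ('b \<Rightarrow>\<^sub>L 'b) set)"
  proof -
    have "projections k = {P :: 'b \<Rightarrow>\<^sub>L 'b. (\<forall>x. P (P x) = P x) \<and> (\<forall>x y. P x \<bullet> y = x \<bullet> P y) \<and> (\<Sum>b\<in>Basis. P b \<bullet> b) = real k}"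
      by (auto simp: projections_iff)
    moreover have "closed \<dots>"
      by (intro closed_Collect_conj closed_Collect_all closed_Collect_eq continuous_intros)
    ultimately show ?thesis by simp
  qed
  ultimately show ?thesis by (simp add: compact_eq_bounded_closed)
qed

text \<open>A limit \<open>Q\<close> of the image projections is again a projection of rank
  \<open>k\<close> and fixes the limit image pointwise. That image also has dimension
  \<open>k\<close> by injectivity, so it is the whole range of \<open>Q\<close>, and the graph is
  closed.\<close>

lemma continuous_on_proj_onto_image:
  fixes T :: "'x::metric_space \<Rightarrow> 'b::euclidean_space \<Rightarrow> 'b"
  assumes lin: "\<And>x. x \<in> W \<Longrightarrow> linear (T x)" and inj: "\<And>x. x \<in> W \<Longrightarrow> inj (T x)"
    and cont: "\<And>v. continuous_on W (\<lambda>x. T x v)"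
  shows "continuous_on (W \<times> projections k) (\<lambda>(x, P). proj_onto (T x ` range (blinfun_apply P)))"
proof (rule continuous_on_compact_range_closed_graph[OF compact_projections[of k]])
  have im: "subspace (T x ` range P)" "dim (T x ` range P) = k"
    if "x \<in> W" "P \<in> projections k" for x P
  proof -
    show "subspace (T x ` range P)"
      using linear_subspace_image[OF lin[OF that(1)] projections_range(1)[OF that(2)]] .
    show "dim (T x ` range P) = k"
      using dim_image_eq[OF lin[OF that(1)], of "range P"] inj[OF that(1)] projections_range(2)[OF that(2)]
      by (metis inj_on_subset top_greatest)
  qed
  then show "(\<lambda>(x, P). proj_onto (T x ` range (blinfun_apply P))) ` (W \<times> projections k) \<subseteq> projections k"
    by (auto simp: projections_def)
  fix u :: "nat \<Rightarrow> 'x \<times> ('b \<Rightarrow>\<^sub>L 'b)" and z :: "'x \<times> ('b \<Rightarrow>\<^sub>L 'b)" and Q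
  assume u: "\<And>n. u n \<in> W \<times> projections k" and z: "z \<in> W \<times> projections k" and lim: "u \<longlonglongrightarrow> z"
    and Q: "(\<lambda>n. case u n of (x, P) \<Rightarrow> proj_onto (T x ` range (blinfun_apply P))) \<longlonglongrightarrow> Q"
  define X where "X n = fst (u n)" for n
  define P where "P n = snd (u n)" for n
  obtain x R where xR: "z = (x, R)" by force
  have X: "X n \<in> W" "P n \<in> projections k" "u n = (X n, P n)" for n
    using u[of n] by (auto simp: X_def P_def)
  have x: "x \<in> W" "R \<in> projections k" using z xR by auto
  have limX: "X \<longlonglongrightarrow> x" and limP: "P \<longlonglongrightarrow> R"
    using tendsto_fst[OF lim] tendsto_snd[OF lim] by (simp_all add: xR X_def[abs_def] P_def[abs_def])
  define q where "q n = proj_onto (T (X n) ` range (P n))" for n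
  have q: "q \<longlonglongrightarrow> Q" using Q by (simp add: X(3) q_def[abs_def])
  have "q n \<in> projections k" for n
    using im[OF X(1,2)] by (auto simp: q_def projections_def)
  then have Qk: "Q \<in> projections k"
    using q compact_imp_closed[OF compact_projections] closed_sequentially by blast
  have fixed: "Q (T x (R v)) = T x (R v)" for v
  proof -
    have cT: "(\<lambda>n. T (X n) b) \<longlonglongrightarrow> T x b" for b
      using cont[of b] X(1) x(1) limX unfolding continuous_on_sequentially comp_def by blast
    have 1: "(\<lambda>n. T (X n) (P n v)) \<longlonglongrightarrow> T x (R v)"
      by (rule tendsto_linear_family[OF lin[OF X(1)] lin[OF x(1)] cT blinfun.tendsto[OF limP tendsto_const]])
    have "(\<lambda>n. q n (T (X n) (P n v))) \<longlonglongrightarrow> Q (T x (R v))"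
      by (rule blinfun.tendsto[OF q 1])
    moreover have "q n (T (X n) (P n v)) = T (X n) (P n v)" for n
      unfolding q_def using im[OF X(1,2)] by (intro proj_onto_self) auto
    ultimately show ?thesis using 1 LIMSEQ_unique by simp
  qed
  have "T x ` range R \<subseteq> range Q"
  proof clarify
    fix v
    show "T x (R v) \<in> range Q" using rangeI[of Q "T x (R v)"] unfolding fixed .
  qed
  then have "T x ` range R = range Q"
    using subspace_dim_equal[OF im(1)[OF x] projections_range(1)[OF Qk]] im(2)[OF x]
      projections_range(2)[OF Qk] by simp
  then show "Q = (case z of (x, P) \<Rightarrow> proj_onto (T x ` range (blinfun_apply P)))"
    using projections_range(3)[OF Qk] by (simp add: xR)
qed

subsection \<open>The inverse of an inner product restricted to a subspace\<close>

definition inner_form :: "('b::real_vector \<Rightarrow> 'b \<Rightarrow> real) \<Rightarrow> bool" where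
  "inner_form m \<longleftrightarrow> bilinear m \<and> (\<forall>u v. m u v = m v u) \<and> (\<forall>v. v \<noteq> 0 \<longrightarrow> m v v > 0)"

lemma inner_form_independent:
  assumes m: "inner_form m" and E: "finite E" "\<forall>u\<in>E. \<forall>v\<in>E. m u v = (if u = v then 1 else 0)"
  shows "independent E"
proof -
  have b: "bilinear m" using m by (simp add: inner_form_def)
  have "w e = 0" if s: "(\<Sum>v\<in>E. w v *\<^sub>R v) = 0" and e: "e \<in> E" for w e
  proof -
    have l: "linear (\<lambda>v. m v e)" using b unfolding bilinear_def by blast
    have "0 = (\<Sum>v\<in>E. w v * m v e)"
      using linear_sum[OF l, of "\<lambda>v. w v *\<^sub>R v" E] s linear_0[OF l] by (simp add: linear_cmul[OF l])
    also have "\<dots> = (\<Sum>v\<in>E. if v = e then w v else 0)"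
      using E(2) e by (intro sum.cong) auto
    also have "\<dots> = w e" using E(1) e by simp
    finally show ?thesis by simp
  qed
  then show ?thesis
    using dependent_finite[OF E(1)] by blast
qed

text \<open>An orthonormal set of maximal cardinality, which exists because independence bounds the
  cardinality by the dimension. A vector outside its span would, after one Gram-Schmidt step,
  enlarge it.\<close>

lemma inner_form_orthonormal_basis:
  fixes m :: "'b::euclidean_space \<Rightarrow> 'b \<Rightarrow> real"
  assumes m: "inner_form m" and S: "subspace S"
  obtains E where "finite E" "span E = S" "\<forall>u\<in>E. \<forall>v\<in>E. m u v = (if u = v then 1 else 0)"
proof -
  define on where "on E \<longleftrightarrow> finite E \<and> E \<subseteq> S \<and> (\<forall>u\<in>E. \<forall>v\<in>E. m u v = (if u = v then 1 else 0))" for E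
  have b: "bilinear m" and sym: "m u v = m v u" and pos: "v \<noteq> 0 \<Longrightarrow> m v v > 0" for u v
    using m by (auto simp: inner_form_def)
  have "card E \<le> DIM('b)" if "on E" for E
    using inner_form_independent[OF m, of E] independent_card_le[of E] that by (auto simp: on_def)
  moreover have "on {}" by (simp add: on_def)
  ultimately obtain E where E: "on E" "\<And>F. on F \<Longrightarrow> card F \<le> card E"
    using ex_has_greatest_nat[of on "{}" card "Suc DIM('b)"] by (metis le_imp_less_Suc)
  have sub: "span E \<subseteq> S" using E(1) S by (simp add: on_def span_minimal)
  have "S \<subseteq> span E"
  proof (rule ccontr)
    assume "\<not> S \<subseteq> span E"
    then obtain v where v: "v \<in> S" "v \<notin> span E" by blast
    define w where "w = v - (\<Sum>e\<in>E. m v e *\<^sub>R e)"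
    have "(\<Sum>e\<in>E. m v e *\<^sub>R e) \<in> span E" by (intro span_sum span_scale span_base)
    then have w: "w \<noteq> 0" "w \<in> S" using v sub S by (auto simp: w_def subspace_diff)
    have we: "m w e = 0" if "e \<in> E" for e
    proof -
      have l: "linear (\<lambda>v. m v e)" using b unfolding bilinear_def by blast
      have "m w e = m v e - (\<Sum>e'\<in>E. m v e' * m e' e)"
        unfolding w_def by (simp add: linear_diff[OF l] linear_sum[OF l] linear_cmul[OF l])
      also have "(\<Sum>e'\<in>E. m v e' * m e' e) = (\<Sum>e'\<in>E. if e' = e then m v e' else 0)"
        using E(1) that by (intro sum.cong) (auto simp: on_def)
      finally show ?thesis using E(1) that by (simp add: on_def)
    qed
    define z where "z = (1 / sqrt (m w w)) *\<^sub>R w"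
    have zz: "m z z = 1"
      using pos[OF w(1)] by (simp add: z_def bilinear_lmul[OF b] bilinear_rmul[OF b])
    have ze: "m z e = 0" if "e \<in> E" for e
      using we[OF that] by (simp add: z_def bilinear_lmul[OF b])
    have "z \<notin> E" using zz ze by fastforce
    have ez: "m e z = 0" if "e \<in> E" for e
      using ze[OF that] sym[of e z] by simp
    have "z \<in> S" using w(2) S by (simp add: z_def subspace_scale)
    then have "on (insert z E)"
      using E(1) zz ze ez \<open>z \<notin> E\<close> by (auto simp: on_def)
    from E(2)[OF this] show False using E(1) \<open>z \<notin> E\<close> by (simp add: on_def)
  qed
  then show ?thesis using that[of E] sub E(1) by (auto simp: on_def)
qed

text \<open>For an \<open>m\<close>-orthonormal basis \<open>E\<close> of the range of \<open>P\<close>, \<open>dual_op m P\<close> is the sum of \<open>e \<otimes> e\<close> over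
  \<open>E\<close>; the description below does not mention \<open>E\<close>, and is closed under limits.\<close>

definition is_dual_op :: "('b::euclidean_space \<Rightarrow> 'b \<Rightarrow> real) \<Rightarrow> ('b \<Rightarrow>\<^sub>L 'b) \<Rightarrow> ('b \<Rightarrow>\<^sub>L 'b) \<Rightarrow> bool" where
  "is_dual_op m P H \<longleftrightarrow> (\<forall>u. P (H u) = H u) \<and> (\<forall>u v. H u \<bullet> v = u \<bullet> H v) \<and>
     (\<forall>u v. m (H u) (P v) = u \<bullet> P v)"

definition dual_op :: "('b::euclidean_space \<Rightarrow> 'b \<Rightarrow> real) \<Rightarrow> ('b \<Rightarrow>\<^sub>L 'b) \<Rightarrow> ('b \<Rightarrow>\<^sub>L 'b)" where
  "dual_op m P = (SOME H. is_dual_op m P H)"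

text \<open>Both \<open>u \<bullet> H v\<close> and \<open>u \<bullet> H' v\<close> equal the value
  of \<open>m\<close> at \<open>H u\<close> and \<open>H' v\<close>: ranges in that of
  \<open>P\<close> let the third condition apply on either side, and symmetry joins them.\<close>

lemma is_dual_op_unique:
  assumes sym: "\<And>u v. m u v = m v u" and H: "is_dual_op m P H" "is_dual_op m P H'"
  shows "H = H'"
proof (rule blinfun_eqI)
  fix v
  have "u \<bullet> H v = u \<bullet> H' v" for u
  proof -
    have 1: "P (H u) = H u" "P (H' v) = H' v" "m (H u) (P (H' v)) = u \<bullet> P (H' v)"
      "m (H' v) (P (H u)) = v \<bullet> P (H u)" "H u \<bullet> v = u \<bullet> H v"
      using H unfolding is_dual_op_def by blast+
    have "u \<bullet> H' v = m (H u) (H' v)"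
      using 1 by simp
    also have "\<dots> = m (H' v) (H u)" by (rule sym)
    also have "\<dots> = v \<bullet> H u"
      using 1 by simp
    also have "\<dots> = u \<bullet> H v"
      using 1 by (simp add: inner_commute)
    finally show ?thesis by simp
  qed
  then show "H v = H' v" by (metis vector_eq_ldot)
qed

text \<open>The explicit sum satisfies the characterisation, so the choice in \<open>dual_op\<close>
  is possible; by uniqueness it is that sum, whatever orthonormal basis of the span is used.\<close>

lemma dual_op_orthonormal_sum:
  fixes m :: "'b::euclidean_space \<Rightarrow> 'b \<Rightarrow> real"
  assumes m: "inner_form m"
    and E: "finite E" "\<forall>u\<in>E. \<forall>v\<in>E. m u v = (if u = v then 1 else 0)"
  shows "is_dual_op m (proj_onto (span E)) (dual_op m (proj_onto (span E)))"
    and "dual_op m (proj_onto (span E)) u = (\<Sum>e\<in>E. (u \<bullet> e) *\<^sub>R e)"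
proof -
  have b: "bilinear m" and sym: "m u v = m v u" for u v
    using m by (auto simp: inner_form_def)
  define H where "H = Blinfun (\<lambda>u. \<Sum>e\<in>E. (u \<bullet> e) *\<^sub>R e)"
  have H: "H u = (\<Sum>e\<in>E. (u \<bullet> e) *\<^sub>R e)" for u
    unfolding H_def
    by (subst bounded_linear_Blinfun_apply) (auto intro!: bounded_linear_sum bounded_linear_scaleR_left[THEN bounded_linear_compose, of "\<lambda>u. u \<bullet> _", unfolded comp_def] bounded_linear_inner_left)
  have sp: "subspace (span E)" by (rule subspace_span)
  have mH: "m (H u) v = u \<bullet> v" if "v \<in> span E" for u v
    using that
  proof (induction rule: span_induct_alt)
    case base
    then show ?case by (simp add: bilinear_rzero[OF b])
  next
    case (step c x y)
    have l: "linear (\<lambda>v. m v x)" using b unfolding bilinear_def by blast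
    have "m (H u) x = (\<Sum>e\<in>E. (u \<bullet> e) * m e x)"
      unfolding H by (simp add: linear_sum[OF l] linear_cmul[OF l])
    also have "\<dots> = (\<Sum>e\<in>E. if e = x then u \<bullet> e else 0)"
      using E(2) step(1) by (intro sum.cong) auto
    finally have "m (H u) x = u \<bullet> x" using E(1) step(1) by simp
    then show ?case
      using step by (simp add: bilinear_radd[OF b] bilinear_rmul[OF b] inner_add_right)
  qed
  have "is_dual_op m (proj_onto (span E)) H"
    unfolding is_dual_op_def
  proof (intro conjI allI)
    show "proj_onto (span E) (H u) = H u" for u
      unfolding H by (intro proj_onto_self sp span_sum span_scale span_base)
    show "H u \<bullet> v = u \<bullet> H v" for u v
      unfolding H by (simp add: inner_sum_left inner_sum_right mult.commute inner_commute)
    show "m (H u) (proj_onto (span E) v) = u \<bullet> proj_onto (span E) v" for u v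
      by (intro mH proj_onto_mem sp)
  qed
  moreover from this show d: "is_dual_op m (proj_onto (span E)) (dual_op m (proj_onto (span E)))"
    unfolding dual_op_def by (rule someI)
  ultimately show "dual_op m (proj_onto (span E)) u = (\<Sum>e\<in>E. (u \<bullet> e) *\<^sub>R e)"
    using is_dual_op_unique[of m, OF sym d] H by metis
qed

lemma is_dual_op_dual_op:
  assumes "inner_form m" "P \<in> projections k"
  shows "is_dual_op m P (dual_op m P)"
proof -
  obtain E where E: "finite E" "span E = range P" "\<forall>u\<in>E. \<forall>v\<in>E. m u v = (if u = v then 1 else 0)"
    using inner_form_orthonormal_basis[OF assms(1) projections_range(1)[OF assms(2)]] by metis
  show ?thesis
    using dual_op_orthonormal_sum(1)[OF assms(1) E(1,3)] by (simp add: E(2) projections_range(3)[OF assms(2)])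
qed

text \<open>The trace of \<open>B\<close> over the span relative to \<open>m\<close>, rewritten so
  that only the fixed basis of the model space is summed over.\<close>

lemma trace_dual_op:
  fixes m :: "'b::euclidean_space \<Rightarrow> 'b \<Rightarrow> real"
  assumes m: "inner_form m"
    and E: "finite E" "\<forall>u\<in>E. \<forall>v\<in>E. m u v = (if u = v then 1 else 0)"
    and B: "bilinear (B :: 'b \<Rightarrow> 'b \<Rightarrow> real)"
  shows "(\<Sum>i\<in>Basis. B (dual_op m (proj_onto (span E)) i) i) = (\<Sum>e\<in>E. B e e)"
proof -
  have l: "linear (\<lambda>v. B v i)" "linear (B i)" for i
    using B unfolding bilinear_def by blast+
  have "(\<Sum>i\<in>Basis. B (dual_op m (proj_onto (span E)) i) i) = (\<Sum>i\<in>Basis. \<Sum>e\<in>E. (i \<bullet> e) * B e i)"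
    by (simp add: dual_op_orthonormal_sum(2)[OF m E] linear_sum[OF l(1)] linear_cmul[OF l(1)])
  also have "\<dots> = (\<Sum>e\<in>E. \<Sum>i\<in>Basis. (e \<bullet> i) * B e i)"
    by (subst sum.swap) (simp add: inner_commute)
  also have "\<dots> = (\<Sum>e\<in>E. B e e)"
  proof (rule sum.cong[OF refl])
    fix e
    show "(\<Sum>i\<in>Basis. (e \<bullet> i) * B e i) = B e e"
      using linear_euclidean_sum[OF l(2)[of e], of e] by simp
  qed
  finally show ?thesis .
qed

text \<open>Compactness of \<open>C\<close> bounds the forms below by a common \<open>l > 0\<close>,
  hence the operators by \<open>1 / l\<close>, so their values lie in a compact ball. The equations
  of \<open>is_dual_op\<close> pass to limits and have one solution, so the graph is closed.\<close>

lemma continuous_on_dual_op: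
  fixes m :: "'x::metric_space \<Rightarrow> 'b::euclidean_space \<Rightarrow> 'b \<Rightarrow> real"
  assumes m: "\<And>x. x \<in> C \<Longrightarrow> inner_form (m x)"
    and cont: "\<And>u v. continuous_on C (\<lambda>x. m x u v)" and C: "compact C"
  shows "continuous_on (C \<times> projections k) (\<lambda>(x, P). dual_op (m x) P)"
proof -
  have bil: "bilinear (m x)" and sym: "m x u v = m x v u" if "x \<in> C" for x u v
    using m[OF that] by (auto simp: inner_form_def)
  \<comment> \<open>The minimum over unit vectors is attained on
    \<open>C \<times> sphere 0 1\<close>, is positive, and extends to all vectors by homogeneity; an
    empty \<open>C\<close> has no minimum but admits any constant.\<close>
  have "\<exists>l>0. \<forall>x\<in>C. \<forall>v. l * (norm v)\<^sup>2 \<le> m x v v"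
  proof (cases "C = {}")
    case True
    then show ?thesis
      by (intro exI[of _ 1]) auto
  next
    case False
    have c: "continuous_on (C \<times> sphere 0 1) (\<lambda>z. m (fst z) (snd z) (snd z))"
    proof (rule continuous_on_bilinear_family[where M = "\<lambda>z. m (fst z)"])
      show "continuous_on (C \<times> sphere 0 1) (\<lambda>z. m (fst z) u v)" for u v
        by (rule continuous_on_compose2[OF cont continuous_on_fst[OF continuous_on_id]]) auto
    qed (use bil in \<open>auto intro: continuous_intros\<close>)
    have "compact (C \<times> sphere (0::'b) 1)"
      using C by (intro compact_Times) auto
    moreover obtain b :: 'b where "b \<in> Basis" using nonempty_Basis by blast
    then have "C \<times> sphere (0::'b) 1 \<noteq> {}"
      using False norm_Basis by auto
    ultimately obtain z where z: "z \<in> C \<times> sphere 0 1"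
      "\<And>y. y \<in> C \<times> sphere 0 1 \<Longrightarrow> m (fst z) (snd z) (snd z) \<le> m (fst y) (snd y) (snd y)"
      using continuous_attains_inf[OF _ _ c] by blast
    have "snd z \<noteq> 0" using z(1) by auto
    then have "m (fst z) (snd z) (snd z) > 0"
      using m[of "fst z"] z(1) by (auto simp: inner_form_def)
    moreover have "m (fst z) (snd z) (snd z) * (norm v)\<^sup>2 \<le> m x v v" if x: "x \<in> C" for x v
    proof (cases "v = 0")
      case True
      then show ?thesis by (simp add: bilinear_lzero[OF bil[OF x]])
    next
      case False
      have "m (fst z) (snd z) (snd z) \<le> m x (v /\<^sub>R norm v) (v /\<^sub>R norm v)"
        using z(2)[of "(x, v /\<^sub>R norm v)"] x False by simp
      also have "\<dots> = m x v v / (norm v)\<^sup>2"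
        by (simp add: bilinear_lmul[OF bil[OF x]] bilinear_rmul[OF bil[OF x]] divide_simps power2_eq_square)
      finally show ?thesis using False by (simp add: pos_le_divide_eq)
    qed
    ultimately show ?thesis by blast
  qed
  then obtain l where l: "l > 0" "\<And>x v. x \<in> C \<Longrightarrow> l * (norm v)\<^sup>2 \<le> m x v v" by blast
  have bound: "norm (dual_op (m x) P) \<le> 1 / l" if x: "x \<in> C" and P: "P \<in> projections k" for x P
  proof (rule norm_blinfun_bound)
    fix u
    define h where "h = dual_op (m x) P u"
    have d: "is_dual_op (m x) P (dual_op (m x) P)" by (rule is_dual_op_dual_op[OF m[OF x] P])
    have h: "P h = h" "m x h (P h) = u \<bullet> P h"
      using d unfolding is_dual_op_def h_def by blast+
    have "l * (norm h)\<^sup>2 \<le> m x h h" by (rule l(2)[OF x])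
    also have "\<dots> = u \<bullet> h"
      using h by simp
    also have "\<dots> \<le> norm u * norm h" by (rule norm_cauchy_schwarz)
    finally have "norm h * (l * norm h) \<le> norm h * norm u"
      by (simp add: power2_eq_square mult_ac)
    then have "l * norm h \<le> norm u"
      by (cases "norm h = 0") (auto simp: mult_le_cancel_left)
    then show "norm (dual_op (m x) P u) \<le> 1 / l * norm u"
      using l(1) by (simp add: h_def field_simps)
  qed (use l in simp)
  show ?thesis
  proof (rule continuous_on_compact_range_closed_graph[OF compact_cball[of 0 "1/l"]])
    show "(\<lambda>(x, P). dual_op (m x) P) ` (C \<times> projections k) \<subseteq> cball 0 (1/l)"
      using bound by auto
    fix u :: "nat \<Rightarrow> 'x \<times> ('b \<Rightarrow>\<^sub>L 'b)" and z :: "'x \<times> ('b \<Rightarrow>\<^sub>L 'b)" and Q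
    assume u: "\<And>n. u n \<in> C \<times> projections k" and z: "z \<in> C \<times> projections k" and lim: "u \<longlonglongrightarrow> z"
      and Q: "(\<lambda>n. case u n of (x, P) \<Rightarrow> dual_op (m x) P) \<longlonglongrightarrow> Q"
    define X where "X n = fst (u n)" for n
    define P where "P n = snd (u n)" for n
    obtain x R where xR: "z = (x, R)" by force
    have X: "X n \<in> C" "P n \<in> projections k" "u n = (X n, P n)" for n
      using u[of n] by (auto simp: X_def P_def)
    have x: "x \<in> C" "R \<in> projections k" using z xR by auto
    have limX: "X \<longlonglongrightarrow> x" and limP: "P \<longlonglongrightarrow> R"
      using tendsto_fst[OF lim] tendsto_snd[OF lim] by (simp_all add: xR X_def[abs_def] P_def[abs_def])
    define q where "q n = dual_op (m (X n)) (P n)" for n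
    have q: "q \<longlonglongrightarrow> Q" using Q by (simp add: X(3) q_def[abs_def])
    have d: "is_dual_op (m (X n)) (P n) (q n)" for n
      unfolding q_def by (rule is_dual_op_dual_op[OF m[OF X(1)] X(2)])
    have lq: "(\<lambda>n. q n u) \<longlonglongrightarrow> Q u" and lP: "(\<lambda>n. P n u) \<longlonglongrightarrow> R u" for u
      using q limP by (auto intro!: tendsto_intros)
    have lm: "(\<lambda>n. m (X n) b c) \<longlonglongrightarrow> m x b c" for b c
      using cont[of b c] X(1) x(1) limX unfolding continuous_on_sequentially comp_def by blast
    have "is_dual_op (m x) R Q"
      unfolding is_dual_op_def
    proof (intro conjI allI)
      fix u v
      have "(\<lambda>n. P n (q n u)) \<longlonglongrightarrow> R (Q u)" by (rule blinfun.tendsto[OF limP lq])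
      moreover have "P n (q n u) = q n u" for n using d by (simp add: is_dual_op_def)
      ultimately show "R (Q u) = Q u" using lq[of u] LIMSEQ_unique by simp
      have "(\<lambda>n. q n u \<bullet> v) \<longlonglongrightarrow> Q u \<bullet> v" "(\<lambda>n. u \<bullet> q n v) \<longlonglongrightarrow> u \<bullet> Q v"
        by (intro tendsto_intros lq)+
      moreover have "q n u \<bullet> v = u \<bullet> q n v" for n using d by (simp add: is_dual_op_def)
      ultimately show "Q u \<bullet> v = u \<bullet> Q v" using LIMSEQ_unique by simp
      have "(\<lambda>n. m (X n) (q n u) (P n v)) \<longlonglongrightarrow> m x (Q u) (R v)"
        by (rule tendsto_bilinear_family[OF bil[OF X(1)] bil[OF x(1)] lm lq lP])
      moreover have "(\<lambda>n. u \<bullet> P n v) \<longlonglongrightarrow> u \<bullet> R v"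
        by (intro tendsto_intros lP)
      moreover have "m (X n) (q n u) (P n v) = u \<bullet> P n v" for n using d by (simp add: is_dual_op_def)
      ultimately show "m x (Q u) (R v) = u \<bullet> R v" using LIMSEQ_unique by simp
    qed
    then show "Q = (case z of (x, P) \<Rightarrow> dual_op (m x) P)"
      using is_dual_op_unique[of "m x", OF sym[OF x(1)] _ is_dual_op_dual_op[OF m[OF x(1)] x(2)]]
      by (simp add: xR)
  qed
qed

section \<open>Compactness of the Grassmann bundle\<close>

context riemannian_manifold
begin

section \<open>The divergence as a continuous function in trivialisations\<close>

lemma inner_form_metric_rep: "c \<in> A \<Longrightarrow> x \<in> chart_image c \<Longrightarrow> inner_form (metric_rep A g c x)"
  unfolding inner_form_def using bilinear_metric_rep metric_rep_sym metric_rep_pos by blast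

lemma inner_form_metric: "inner_form (g p)"
  unfolding inner_form_def using metric_bilinear metric_sym metric_pos by blast

text \<open>The trace of \<open>div_form\<close> over the plane \<open>range P\<close>, taken with
  respect to the coordinate metric; no orthonormal basis is chosen, so joint continuity in
  \<open>x\<close> and \<open>P\<close> can be proved.\<close>

definition chart_divergence :: "('a \<Rightarrow> 'b) \<Rightarrow> ('a, 'b) chart \<Rightarrow> 'b \<times> ('b \<Rightarrow>\<^sub>L 'b) \<Rightarrow> real" where
  "chart_divergence X c = (\<lambda>(x, P). \<Sum>i\<in>Basis. div_form X c x (dual_op (metric_rep A g c x) P i) i)"

lemma inj_tangent_change:
  assumes "c \<in> A" "d \<in> A" "p \<in> fst c" "p \<in> fst d"
  shows "inj (tangent_change c d p)"
  by (rule inj_on_inverseI[of _ "tangent_change d c p"])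
     (simp add: tangent_change_compose tangent_change_id assms)

text \<open>The chosen basis depends on the point and the plane but not on the field. One
  \<open>E\<close> therefore serves all fields at once, which the later comparison of divergences of
  different multiples of \<open>X\<close> relies on.\<close>

lemma div_on_sum:
  assumes S: "subspace S"
  obtains E where "orthonormal_basis g p S E"
    "\<And>X. smooth_vector_field A X \<Longrightarrow>
      div_on A g X p S = (\<Sum>e\<in>E. div_form X (chart_at A p) (snd (chart_at A p) p) e e)"
proof -
  define E where "E = (SOME E. orthonormal_basis g p S E)"
  have "\<exists>E. orthonormal_basis g p S E"
    using inner_form_orthonormal_basis[OF inner_form_metric S] unfolding orthonormal_basis_def by metis
  then have E: "orthonormal_basis g p S E"
    unfolding E_def by (rule someI_ex)
  show ?thesis
    by (rule that[OF E]) (simp add: div_on_def E_def[symmetric] Let_def metric_covariant_derivative)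
qed

lemma div_on_trivialization:
  assumes X: "smooth_vector_field A X" and S: "subspace S" and c: "c \<in> A" "p \<in> fst c"
  shows "div_on A g X p S = chart_divergence X c (trivialization A c (p, S))"
proof -
  define x where "x = snd c p"
  define T where "T = to_chart A c p"
  have T: "T = tangent_change (chart_at A p) c p" by (simp add: T_def to_chart_def)
  have lin: "linear T" unfolding T_def by (rule linear_to_chart[OF c])
  have inj: "inj T" unfolding T using c by (intro inj_tangent_change) auto
  have x: "x \<in> chart_image c" using c by (simp add: x_def)
  obtain E where E: "orthonormal_basis g p S E"
    "div_on A g X p S = (\<Sum>e\<in>E. div_form X (chart_at A p) (snd (chart_at A p) p) e e)"
    using div_on_sum[OF S, of p] X by blast
  have fE: "finite E" "span E = S" "\<And>u v. u \<in> E \<Longrightarrow> v \<in> E \<Longrightarrow> g p u v = (if u = v then 1 else 0)"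
    using E(1) by (auto simp: orthonormal_basis_def)
  have on: "\<forall>u\<in>T ` E. \<forall>v\<in>T ` E. metric_rep A g c x u v = (if u = v then 1 else 0)"
    using fE(3) inj by (auto simp: x_def T_def metric_rep_to_chart[OF c] inj_eq)
  have "div_on A g X p S = (\<Sum>e\<in>E. div_form X c x (T e) (T e))"
    unfolding E(2) x_def T using c by (intro sum.cong refl div_form_transition[symmetric] X) auto
  also have "\<dots> = (\<Sum>e\<in>T ` E. div_form X c x e e)"
    using inj by (simp add: sum.reindex inj_on_subset)
  also have "\<dots> = (\<Sum>i\<in>Basis. div_form X c x (dual_op (metric_rep A g c x) (proj_onto (span (T ` E))) i) i)"
    using trace_dual_op[OF inner_form_metric_rep[OF c(1) x] _ on bilinear_div_form[OF X c(1) x]] fE(1) by simp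
  also have "span (T ` E) = T ` S"
    using linear_span_image[OF lin, of E] fE(2) by simp
  finally show ?thesis
    by (simp add: chart_divergence_def trivialization_def x_def T_def)
qed

lemma continuous_on_div_form:
  assumes X: "smooth_vector_field A X" and c: "c \<in> A"
  shows "continuous_on (chart_image c) (\<lambda>x. div_form X c x u v)"
proof -
  have sm: "smooth_on (chart_image c) (vf_rep A X c)" using X c by (simp add: smooth_vector_field_def)
  have "continuous_on (chart_image c) (\<lambda>x. \<Sum>j\<in>Basis. (vf_rep A X c x \<bullet> j) * metric_deriv A g c x j u v)"
    unfolding metric_deriv_def
    by (intro continuous_intros smooth_on_continuous[OF sm]
          smooth_on_continuous[OF smooth_on_frechet_derivative[OF metric_rep_smooth[OF c]]])
  then have 1: "continuous_on (chart_image c) (\<lambda>x. metric_deriv A g c x (vf_rep A X c x) u v)"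
  proof (rule continuous_on_eq)
    fix x assume x: "x \<in> chart_image c"
    show "(\<Sum>j\<in>Basis. (vf_rep A X c x \<bullet> j) * metric_deriv A g c x j u v) =
        metric_deriv A g c x (vf_rep A X c x) u v"
      using linear_euclidean_sum[OF metric_deriv_linear[OF c x, of u v], of "vf_rep A X c x"] by simp
  qed
  have "continuous_on (chart_image c) (\<lambda>x. metric_rep A g c x (frechet_derivative (vf_rep A X c) (at x) u) v)"
    by (rule continuous_on_bilinear_family)
       (auto intro: bilinear_metric_rep c smooth_on_continuous metric_rep_smooth smooth_on_frechet_derivative sm)
  then show ?thesis
    unfolding div_form_def using 1 by (intro continuous_intros) auto
qed

lemma continuous_on_chart_divergence:
  assumes X: "smooth_vector_field A X" and c: "c \<in> A" and C: "compact C" "C \<subseteq> chart_image c"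
  shows "continuous_on (C \<times> projections k) (chart_divergence X c)"
proof -
  have d: "continuous_on (C \<times> projections k) (\<lambda>z. dual_op (metric_rep A g c (fst z)) (snd z))"
    using continuous_on_dual_op[of C "metric_rep A g c", OF _ _ C(1)] inner_form_metric_rep[OF c] C(2)
      continuous_on_subset[OF smooth_on_continuous[OF metric_rep_smooth[OF c]] C(2)]
    by (auto simp: case_prod_beta)
  have f: "continuous_on (C \<times> projections k) (\<lambda>z. div_form X c (fst z) u v)" for u v
    by (rule continuous_on_compose2[OF continuous_on_div_form[OF X c] continuous_on_fst[OF continuous_on_id]])
       (use C(2) in auto)
  have "continuous_on (C \<times> projections k)
      (\<lambda>z. div_form X c (fst z) (dual_op (metric_rep A g c (fst z)) (snd z) i) i)" for i
    by (rule continuous_on_bilinear_family[where M = "\<lambda>z. div_form X c (fst z)"])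
       (use C(2) bilinear_div_form[OF X c] f d in \<open>auto intro!: continuous_intros\<close>)
  then show ?thesis
    unfolding chart_divergence_def case_prod_beta by (intro continuous_on_sum)
qed

section \<open>Inverse trivialisations and the bundle topology\<close>

text \<open>The inverse of \<open>trivialization A c\<close>, a plane being encoded as the range of
  its projection.\<close>

definition chart_subspace :: "('a, 'b) chart \<Rightarrow> 'b \<times> ('b \<Rightarrow>\<^sub>L 'b) \<Rightarrow> 'a \<times> 'b set" where
  "chart_subspace c = (\<lambda>(x, P). (chart_inv c x, from_chart A c (chart_inv c x) ` range P))"

lemma inj_to_chart: "c \<in> A \<Longrightarrow> p \<in> fst c \<Longrightarrow> inj (to_chart A c p)"
  and inj_from_chart: "c \<in> A \<Longrightarrow> p \<in> fst c \<Longrightarrow> inj (from_chart A c p)"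
  unfolding to_chart_def from_chart_def by (auto intro: inj_tangent_change)

lemma chart_subspace_in_grassmann_bundle:
  assumes c: "c \<in> A" "x \<in> chart_image c" "P \<in> projections k"
  shows "chart_subspace c (x, P) \<in> grassmann_bundle k {chart_inv c x}"
proof -
  have p: "chart_inv c x \<in> fst c" using c by simp
  note l = linear_from_chart[OF c(1) p] and i = inj_from_chart[OF c(1) p]
  note P = projections_range[OF c(3)]
  show ?thesis
    unfolding grassmann_bundle_def chart_subspace_def
    using linear_subspace_image[OF l P(1)] dim_image_eq[OF l inj_on_subset[OF i]] P(2) by simp
qed

lemma trivialization_chart_subspace:
  assumes c: "c \<in> A" "x \<in> chart_image c" "P \<in> projections k"
  shows "trivialization A c (chart_subspace c (x, P)) = (x, P)"
  using from_to_chart(2)[OF c(1) chart_inv_right(1)[OF c(1,2)]] c projections_range(3)[OF c(3)]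
  by (simp add: trivialization_def chart_subspace_def image_image)

lemma trivialization_mem:
  assumes c: "c \<in> A" "p \<in> fst c" and S: "(p, S) \<in> grassmann_bundle k M"
  shows "trivialization A c (p, S) \<in> {snd c p} \<times> projections k"
  using S linear_subspace_image[OF linear_to_chart[OF c]]
    dim_image_eq[OF linear_to_chart[OF c] inj_on_subset[OF inj_to_chart[OF c]]]
  by (auto simp: trivialization_def projections_def grassmann_bundle_def)

lemma chart_subspace_trivialization:
  assumes c: "c \<in> A" "p \<in> fst c" and S: "(p, S) \<in> grassmann_bundle k M"
  shows "chart_subspace c (trivialization A c (p, S)) = (p, S)"
proof -
  have "subspace (to_chart A c p ` S)"
    using S linear_subspace_image[OF linear_to_chart[OF c]] by (auto simp: grassmann_bundle_def)
  from range_proj_onto[OF this] show ?thesis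
    by (simp only: trivialization_def chart_subspace_def case_prod_conv chart_inv_left[OF c])
       (simp add: image_image from_to_chart(1)[OF c])
qed

text \<open>Changing from the trivialisation of \<open>c\<close> to that of \<open>d\<close> is
  continuous over the overlap, so generating sets of the bundle topology pull back to relatively
  open sets of coordinates.\<close>

lemma openin_chart_subspace:
  assumes c: "c \<in> A" "d \<in> A" and W: "open W"
  obtains Q where "open Q"
    "\<And>x P. x \<in> chart_image c \<Longrightarrow> P \<in> projections k \<Longrightarrow> (x, P) \<in> Q \<longleftrightarrow>
      chart_subspace c (x, P) \<in> {q \<in> grassmann_bundle k (fst d). trivialization A d q \<in> W}"
proof -
  define T where "T x = frechet_derivative (transition c d) (at x)" for x
  define f :: "'b \<times> ('b \<Rightarrow>\<^sub>L 'b) \<Rightarrow> 'b \<times> ('b \<Rightarrow>\<^sub>L 'b)"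
    where "f z = (transition c d (fst z), proj_onto (T (fst z) ` range (blinfun_apply (snd z))))" for z
  have Tx: "T x = tangent_change c d (chart_inv c x)" if "x \<in> overlap c d" for x
    using chart_inv_overlap[OF c(1) that] by (simp add: T_def tangent_change_def)
  have ov: "chart_inv c x \<in> fst c" "chart_inv c x \<in> fst d" if "x \<in> overlap c d" for x
    using chart_inv_overlap[OF c(1) that] by auto
  have "continuous_on (overlap c d \<times> projections k) (\<lambda>(x, P). proj_onto (T x ` range (blinfun_apply P)))"
  proof (rule continuous_on_proj_onto_image)
    show "linear (T x)" "inj (T x)" if "x \<in> overlap c d" for x
      unfolding Tx[OF that] using c ov[OF that] by (auto intro: linear_tangent_change inj_tangent_change)
    show "continuous_on (overlap c d) (\<lambda>x. T x v)" for v
      unfolding T_def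
      by (rule smooth_on_continuous[OF smooth_on_frechet_derivative[OF smooth_transition[OF c]]])
  qed
  moreover have "continuous_on (overlap c d \<times> (projections k :: ('b \<Rightarrow>\<^sub>L 'b) set)) (\<lambda>z. transition c d (fst z))"
    by (rule continuous_on_compose2[OF smooth_on_continuous[OF smooth_transition[OF c]] continuous_on_fst[OF continuous_on_id]])
       auto
  ultimately have "continuous_on (overlap c d \<times> projections k) f"
    unfolding f_def by (auto intro!: continuous_on_Pair simp: case_prod_beta)
  then obtain Q where Q: "open Q" "Q \<inter> (overlap c d \<times> projections k) = f -` W \<inter> (overlap c d \<times> projections k)"
    using W unfolding continuous_on_open_invariant by blast
  show ?thesis
  \<comment> \<open>Restriction to the overlap is needed because elsewhere the plane does not lie
    over the domain of \<open>d\<close> at all.\<close>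
  proof (rule that[of "Q \<inter> (overlap c d \<times> UNIV)"])
    show "open (Q \<inter> (overlap c d \<times> UNIV))"
      using Q(1) open_overlap[OF c] by (intro open_Int open_Times) auto
    fix x :: 'b and P :: "'b \<Rightarrow>\<^sub>L 'b" assume x: "x \<in> chart_image c" and P: "P \<in> projections k"
    have mem: "chart_subspace c (x, P) \<in> grassmann_bundle k (fst d) \<longleftrightarrow> x \<in> overlap c d"
      using chart_subspace_in_grassmann_bundle[OF c(1) x P] x c
      by (auto simp: grassmann_bundle_def chart_subspace_def overlap_eq)
    have "trivialization A d (chart_subspace c (x, P)) = f (x, P)" if x: "x \<in> overlap c d"
    proof -
      note p = ov[OF x]
      have "to_chart A d (chart_inv c x) (from_chart A c (chart_inv c x) u) = T x u" for u
        unfolding Tx[OF x] to_chart_def from_chart_def using p c by (simp add: tangent_change_compose)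
      then show ?thesis
        by (simp add: trivialization_def chart_subspace_def f_def image_image transition_def)
    qed
    moreover have "(x, P) \<in> Q \<inter> (overlap c d \<times> projections k) \<longleftrightarrow> (x, P) \<in> f -` W \<inter> (overlap c d \<times> projections k)"
      unfolding Q(2) ..
    ultimately show "(x, P) \<in> Q \<inter> (overlap c d \<times> UNIV) \<longleftrightarrow>
      chart_subspace c (x, P) \<in> {q \<in> grassmann_bundle k (fst d). trivialization A d q \<in> W}"
      using mem P by auto
  qed
qed

lemma open_chart_image:
  assumes c: "c \<in> A" and B: "open B"
  shows "open (snd c ` (B \<inter> fst c))"
proof -
  have "snd c ` (B \<inter> fst c) = chart_image c \<inter> chart_inv c -` B"
    using c by (force simp: chart_image_def)
  then show ?thesis
    using continuous_on_open_vimage[OF chart_open(2)[OF c]] continuous_on_chart_inv[OF c] B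
    by (metis Int_commute)
qed

lemma openin_grassmann_trivialization:
  "c \<in> A \<Longrightarrow> open W \<Longrightarrow> openin (grassmann_topology A k) {q \<in> grassmann_bundle k (fst c). trivialization A c q \<in> W}"
  unfolding grassmann_topology_def by (rule topology_generated_by_Basis) blast

text \<open>Continuity of the bundle projection: over each chart the set is a generating set whose
  condition constrains only the base coordinate.\<close>

lemma openin_grassmann_base:
  assumes B: "open B"
  shows "openin (grassmann_topology A k) {q \<in> grassmann_bundle k UNIV. fst q \<in> B}"
proof -
  have "{q \<in> grassmann_bundle k UNIV. fst q \<in> B} =
    (\<Union>c\<in>A. {q \<in> grassmann_bundle k (fst c). trivialization A c q \<in> snd c ` (B \<inter> fst c) \<times> UNIV})"
    (is "?L = ?R")
  proof (intro equalityI subsetI)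
    fix q assume q: "q \<in> ?L"
    then show "q \<in> ?R"
      by (intro UN_I[of "chart_at A (fst q)"]) (auto simp: grassmann_bundle_def trivialization_def)
  next
    fix q assume "q \<in> ?R"
    then obtain c where "c \<in> A"
      "q \<in> {q \<in> grassmann_bundle k (fst c). trivialization A c q \<in> snd c ` (B \<inter> fst c) \<times> UNIV}"
      by (rule UN_E)
    then have c': "c \<in> A" "q \<in> grassmann_bundle k (fst c)"
        "trivialization A c q \<in> snd c ` (B \<inter> fst c) \<times> UNIV" by simp_all
    obtain p S where q: "q = (p, S)" by force
    have c: "c \<in> A" "q = (p, S)" "(p, S) \<in> grassmann_bundle k (fst c)"
        "snd c p \<in> snd c ` (B \<inter> fst c)" using c' q unfolding trivialization_def by simp_all
    then obtain p' where p': "p' \<in> B" "p' \<in> fst c" "snd c p = snd c p'" by blast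
    have "p \<in> fst c" using c(3) by (simp add: grassmann_bundle_def)
    then have "p = p'"
      using p' chart_inv_left[OF c(1)] by metis
    then show "q \<in> ?L" using c(2,3) p'(1) by (simp add: grassmann_bundle_def)
  qed
  then show ?thesis
    using open_chart_image B by (auto intro!: openin_Union openin_grassmann_trivialization open_Times)
qed

section \<open>Borel sets of the bundle\<close>

lemma space_grassmann_borel [simp]: "space (grassmann_borel A k N) = grassmann_bundle k N"
  by (simp add: grassmann_borel_def space_measure_of_conv)

lemma openin_grassmann_subset_Pow:
  "{U. openin (subtopology (grassmann_topology A k) (grassmann_bundle k N)) U} \<subseteq> Pow (grassmann_bundle k N)"
  by (auto simp: openin_subtopology)

lemma sets_grassmann_borel_openin:
  assumes "openin (grassmann_topology A k) U"
  shows "U \<inter> grassmann_bundle k N \<in> sets (grassmann_borel A k N)"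
proof -
  have "openin (subtopology (grassmann_topology A k) (grassmann_bundle k N)) (U \<inter> grassmann_bundle k N)"
    using assms by (auto simp: openin_subtopology)
  then show ?thesis
    unfolding grassmann_borel_def sets_measure_of[OF openin_grassmann_subset_Pow]
    by (intro sigma_sets.Basic) simp
qed

lemma sets_grassmann_borel_base:
  assumes "closed B"
  shows "{q \<in> grassmann_bundle k N. fst q \<in> B} \<in> sets (grassmann_borel A k N)"
proof -
  have "{q \<in> grassmann_bundle k UNIV. fst q \<in> - B} \<inter> grassmann_bundle k N \<in> sets (grassmann_borel A k N)"
    using assms by (intro sets_grassmann_borel_openin openin_grassmann_base) auto
  then have "space (grassmann_borel A k N) - {q \<in> grassmann_bundle k UNIV. fst q \<in> - B} \<inter> grassmann_bundle k N
    \<in> sets (grassmann_borel A k N)"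
    by (rule sets.compl_sets)
  also have "space (grassmann_borel A k N) - {q \<in> grassmann_bundle k UNIV. fst q \<in> - B} \<inter> grassmann_bundle k N
    = {q \<in> grassmann_bundle k N. fst q \<in> B}"
    by (auto simp: grassmann_bundle_def)
  finally show ?thesis .
qed

section \<open>A compact model of the bundle over \<open>N\<close>\<close>

lemma compact_chart_cover:
  assumes N: "compact N"
  obtains cs Cs and m :: nat where "\<And>j. j < m \<Longrightarrow> cs j \<in> A" "\<And>j. j < m \<Longrightarrow> compact (Cs j)"
    "\<And>j. j < m \<Longrightarrow> Cs j \<subseteq> chart_image (cs j)" "\<And>j. j < m \<Longrightarrow> compact (chart_inv (cs j) ` Cs j)"
    "N = (\<Union>j<m. chart_inv (cs j) ` Cs j)"
proof -
  define ch where "ch p = chart_at A p" for p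
  have ch: "ch p \<in> A" "p \<in> fst (ch p)" for p
    unfolding ch_def by (rule chart_at)+
  have "\<exists>e>0. cball (snd (ch p) p) e \<subseteq> chart_image (ch p)" for p
    using open_contains_cball[of "chart_image (ch p)"] chart_open(2)[OF ch(1)] chart_in_image[OF ch(2)]
    by blast
  then obtain e where e: "\<And>p. e p > 0" "\<And>p. cball (snd (ch p) p) (e p) \<subseteq> chart_image (ch p)"
    by metis
  define B where "B p = fst (ch p) \<inter> snd (ch p) -` ball (snd (ch p) p) (e p)" for p
  have "open (B p)" for p
    unfolding B_def using continuous_on_open_vimage[OF chart_open(1)[OF ch(1)]] continuous_on_chart[OF ch(1)]
    by (metis Int_commute open_ball)
  moreover have "N \<subseteq> (\<Union>p\<in>N. B p)" using e(1) ch(2) by (auto simp: B_def)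
  ultimately obtain F where F: "F \<subseteq> N" "finite F" "N \<subseteq> (\<Union>p\<in>F. B p)"
    using compactE_image[OF N, of N B] by metis
  obtain ps where ps: "set ps = F" using finite_list[OF F(2)] by blast
  \<comment> \<open>Open coordinate balls give the finite subcover, closed ones the compact pieces;
    cutting with \<open>N\<close> makes their union exactly \<open>N\<close>.\<close>
  define D where "D p = N \<inter> chart_inv (ch p) ` cball (snd (ch p) p) (e p)" for p
  have D: "compact (D p)" "D p \<subseteq> fst (ch p)" for p
  proof -
    have "compact (chart_inv (ch p) ` cball (snd (ch p) p) (e p))"
      using continuous_on_subset[OF continuous_on_chart_inv[OF ch(1)] e(2)] by (intro compact_continuous_image) auto
    then show "compact (D p)"
      unfolding D_def using N by (intro compact_Int)
    show "D p \<subseteq> fst (ch p)" unfolding D_def using e(2)[of p] chart_inv_right(1)[OF ch(1)] by blast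
  qed
  have inv: "chart_inv (ch p) ` snd (ch p) ` D p = D p" for p
    using D(2)[of p] chart_inv_left[OF ch(1)] by (force simp: image_image)
  show ?thesis
  proof (rule that[of "length ps" "\<lambda>j. ch (ps ! j)" "\<lambda>j. snd (ch (ps ! j)) ` D (ps ! j)"])
    show "compact (snd (ch (ps ! j)) ` D (ps ! j))" for j
      by (intro compact_continuous_image D continuous_on_subset[OF continuous_on_chart[OF ch(1)] D(2)])
    show "snd (ch (ps ! j)) ` D (ps ! j) \<subseteq> chart_image (ch (ps ! j))" for j
      unfolding chart_image_def by (rule image_mono[OF D(2)])
    show "compact (chart_inv (ch (ps ! j)) ` snd (ch (ps ! j)) ` D (ps ! j))" for j
      unfolding inv by (rule D)
    have BD: "N \<inter> B p \<subseteq> D p" for p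
    proof
      fix q assume q: "q \<in> N \<inter> B p"
      then have b: "q \<in> fst (ch p)" "snd (ch p) q \<in> ball (snd (ch p) p) (e p)"
        unfolding B_def by blast+
      have "chart_inv (ch p) (snd (ch p) q) \<in> chart_inv (ch p) ` cball (snd (ch p) p) (e p)"
        using b(2) ball_subset_cball by (intro imageI) blast
      then show "q \<in> D p" using q unfolding D_def chart_inv_left[OF ch(1) b(1)] by blast
    qed
    have "(\<Union>j<length ps. D (ps ! j)) = (\<Union>p\<in>F. D p)"
      unfolding ps[symmetric] set_conv_nth by auto
    also have "\<dots> = N"
    proof (rule equalityI)
      show "(\<Union>p\<in>F. D p) \<subseteq> N" unfolding D_def by blast
      show "N \<subseteq> (\<Union>p\<in>F. D p)" using F(3) BD by blast
    qed
    finally show "N = (\<Union>j<length ps. chart_inv (ch (ps ! j)) ` snd (ch (ps ! j)) ` D (ps ! j))"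
      unfolding inv by simp
  qed (rule ch)
qed

text \<open>\<open>K\<close> is a disjoint union of coordinate pieces times projections, and
  \<open>\<Theta>\<close> glues them to the bundle over \<open>N\<close>. The pieces overlap there,
  so \<open>\<Theta>\<close> need not be injective; \<open>\<sigma>\<close> is a right inverse that
  selects one piece measurably. Divergences become continuous on \<open>K\<close>, where weak
  compactness is available.\<close>

lemma varifold_coding:
  assumes N: "compact N"
  obtains K :: "(real \<times> 'b \<times> ('b \<Rightarrow>\<^sub>L 'b)) set" and \<Theta> \<sigma> where "compact K"
    "\<Theta> \<in> measurable (restrict_space borel K) (grassmann_borel A k N)"
    "\<sigma> \<in> measurable (grassmann_borel A k N) (restrict_space borel K)"
    "\<And>q. q \<in> grassmann_bundle k N \<Longrightarrow> \<Theta> (\<sigma> q) = q"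
    "\<And>X. smooth_vector_field A X \<Longrightarrow> continuous_on K (\<lambda>z. case \<Theta> z of (p, S) \<Rightarrow> div_on A g X p S)"
proof -
  obtain cs Cs and m :: nat where c: "\<And>j. j < m \<Longrightarrow> cs j \<in> A" and C: "\<And>j. j < m \<Longrightarrow> compact (Cs j)"
    "\<And>j. j < m \<Longrightarrow> Cs j \<subseteq> chart_image (cs j)" and D: "\<And>j. j < m \<Longrightarrow> compact (chart_inv (cs j) ` Cs j)"
    "N = (\<Union>j<m. chart_inv (cs j) ` Cs j)"
    by (rule compact_chart_cover[OF N]) blast
  define L :: "nat \<Rightarrow> ('b \<times> ('b \<Rightarrow>\<^sub>L 'b)) set" where "L j = Cs j \<times> projections k" for j
  define K where "K = (\<Union>j<m. {real j} \<times> L j)"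
  \<comment> \<open>The real tag is turned back into the index of the piece by the floor.\<close>
  define \<Theta> where "\<Theta> z = chart_subspace (cs (nat \<lfloor>fst z\<rfloor>)) (snd z)" for z :: "real \<times> 'b \<times> ('b \<Rightarrow>\<^sub>L 'b)"
  have \<Theta>: "\<Theta> (real j, z) = chart_subspace (cs j) z" for j z
    by (simp add: \<Theta>_def)
  have cL: "compact (L j)" if "j < m" for j
    unfolding L_def using C(1)[OF that] compact_projections by (rule compact_Times)
  have cK: "compact K"
    unfolding K_def by (intro compact_UN compact_Times cL) auto
  have K: "\<exists>j x P. j < m \<and> z = (real j, x, P) \<and> x \<in> Cs j \<and> P \<in> projections k" if "z \<in> K" for z
    using that unfolding K_def L_def by blast
  have mem: "chart_subspace (cs j) (x, P) \<in> grassmann_bundle k N"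
    if j: "j < m" and x: "x \<in> Cs j" and P: "P \<in> projections k" for j x P
  proof -
    have "chart_inv (cs j) x \<in> N" using D(2) j x by blast
    then show ?thesis
      using chart_subspace_in_grassmann_bundle[OF c[OF j] subsetD[OF C(2)[OF j] x] P]
      unfolding grassmann_bundle_def by auto
  qed
  have \<Theta>K: "\<Theta> z \<in> grassmann_bundle k N" if "z \<in> K" for z
    using K[OF that] mem \<Theta> by metis
  have cont: "continuous_map (top_of_set K) (grassmann_topology A k) \<Theta>"
    unfolding grassmann_topology_def
  proof (rule continuous_on_generated_topo)
    fix U assume "U \<in> {{q \<in> grassmann_bundle k (fst c). trivialization A c q \<in> W} |c W. c \<in> A \<and> open W}"
    then obtain d W where d: "d \<in> A" "open W"
      and U: "U = {q \<in> grassmann_bundle k (fst d). trivialization A d q \<in> W}" by blast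
    define good where "good j Q \<longleftrightarrow> open Q \<and> (\<forall>x P. x \<in> chart_image (cs j) \<longrightarrow> P \<in> projections k \<longrightarrow>
      ((x, P) \<in> Q \<longleftrightarrow> chart_subspace (cs j) (x, P) \<in> U))" for j Q
    have "\<exists>Q. good j Q" if "j < m" for j
    proof -
      note cj = c[OF that]
      obtain Q where "open Q" "\<And>x P. x \<in> chart_image (cs j) \<Longrightarrow> P \<in> projections k \<Longrightarrow> (x, P) \<in> Q \<longleftrightarrow>
          chart_subspace (cs j) (x, P) \<in> {q \<in> grassmann_bundle k (fst d). trivialization A d q \<in> W}"
        by (rule openin_chart_subspace[OF cj d, of k]) blast
      then show ?thesis unfolding good_def U by blast
    qed
    then obtain Q where good: "\<And>j. j < m \<Longrightarrow> good j (Q j)" by metis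
    have Q: "\<And>j. j < m \<Longrightarrow> open (Q j)"
      "\<And>j x P. j < m \<Longrightarrow> x \<in> chart_image (cs j) \<Longrightarrow> P \<in> projections k \<Longrightarrow>
        (x, P) \<in> Q j \<longleftrightarrow> chart_subspace (cs j) (x, P) \<in> U"
      using good unfolding good_def by blast+
    \<comment> \<open>Tags are distinct integers, so the ball of radius 1 around
      \<open>real j\<close> meets only the piece with tag \<open>j\<close>.\<close>
    have "\<Theta> -` U \<inter> K = K \<inter> (\<Union>j<m. ball (real j) 1 \<times> Q j)"
    proof (rule set_eqI)
      fix z
      show "z \<in> \<Theta> -` U \<inter> K \<longleftrightarrow> z \<in> K \<inter> (\<Union>j<m. ball (real j) 1 \<times> Q j)"
      proof (cases "z \<in> K")
        case True
        then obtain i x P where i: "i < m" "z = (real i, x, P)" "x \<in> Cs i" "P \<in> projections k"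
          using K by blast
        have "z \<in> (\<Union>j<m. ball (real j) 1 \<times> Q j) \<longleftrightarrow> (x, P) \<in> Q i"
        proof
          assume "z \<in> (\<Union>j<m. ball (real j) 1 \<times> Q j)"
          then obtain j where "j < m" "dist (real j) (real i) < 1" "(x, P) \<in> Q j"
            using i(2) by auto
          moreover from this have "j = i" by (simp add: dist_real_def)
          ultimately show "(x, P) \<in> Q i" by simp
        next
          assume "(x, P) \<in> Q i"
          then show "z \<in> (\<Union>j<m. ball (real j) 1 \<times> Q j)"
            unfolding i(2) by (intro UN_I[of i]) (use i(1) in auto)
        qed
        also have "\<dots> \<longleftrightarrow> \<Theta> z \<in> U"
          unfolding i(2) \<Theta> using Q(2)[OF i(1) subsetD[OF C(2)[OF i(1)] i(3)] i(4)] .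
        finally show ?thesis using True by simp
      qed simp
    qed
    moreover have "open (\<Union>j<m. ball (real j) 1 \<times> Q j)"
      using Q(1) by (intro open_UN ballI open_Times) auto
    ultimately show "openin (top_of_set K) (\<Theta> -` U \<inter> topspace (top_of_set K))"
      by (auto simp: openin_open)
  next
    show "\<Theta> ` topspace (top_of_set K)
      \<subseteq> \<Union> {{q \<in> grassmann_bundle k (fst c). trivialization A c q \<in> W} |c W. c \<in> A \<and> open W}"
    proof (rule image_subsetI)
      fix z assume "z \<in> topspace (top_of_set K)"
      then have "\<Theta> z \<in> grassmann_bundle k N" using \<Theta>K by simp
      then have "\<Theta> z \<in> {q \<in> grassmann_bundle k (fst (chart_at A (fst (\<Theta> z)))). trivialization A (chart_at A (fst (\<Theta> z))) q \<in> UNIV}"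
        by (auto simp: grassmann_bundle_def)
      then show "\<Theta> z \<in> \<Union> {{q \<in> grassmann_bundle k (fst c). trivialization A c q \<in> W} |c W. c \<in> A \<and> open W}"
        using open_UNIV chart_at(1) by blast
    qed
  qed
  have \<Theta>m: "\<Theta> \<in> measurable (restrict_space borel K) (grassmann_borel A k N)"
    unfolding grassmann_borel_def
  proof (rule measurable_measure_of[OF openin_grassmann_subset_Pow])
    show "\<Theta> \<in> space (restrict_space borel K) \<rightarrow> grassmann_bundle k N"
      using \<Theta>K by (auto simp: space_restrict_space)
    fix U assume "U \<in> {U. openin (subtopology (grassmann_topology A k) (grassmann_bundle k N)) U}"
    then obtain T where T: "openin (grassmann_topology A k) T" "U = T \<inter> grassmann_bundle k N"
      by (auto simp: openin_subtopology)
    have "openin (top_of_set K) {z \<in> K. \<Theta> z \<in> T}"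
      using openin_continuous_map_preimage[OF cont T(1)] by simp
    moreover have "{z \<in> K. \<Theta> z \<in> T} = \<Theta> -` U \<inter> K"
      using \<Theta>K T(2) by auto
    ultimately obtain O' where O': "open O'" "\<Theta> -` U \<inter> K = K \<inter> O'"
      by (auto simp: openin_open)
    then show "\<Theta> -` U \<inter> space (restrict_space borel K) \<in> sets (restrict_space borel K)"
      by (auto simp: space_restrict_space sets_restrict_space)
  qed
  \<comment> \<open>Among the overlapping pieces over a point the one of least index is selected, so
    each region of constant choice is a difference of sets lying over compact pieces.\<close>
  define jj where "jj p = (LEAST j. j < m \<and> p \<in> chart_inv (cs j) ` Cs j)" for p
  define \<sigma> where "\<sigma> q = (real (jj (fst q)), trivialization A (cs (jj (fst q))) q)" for q
  have jj: "jj p < m" "p \<in> chart_inv (cs (jj p)) ` Cs (jj p)" if "p \<in> N" for p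
  proof -
    have "\<exists>j. j < m \<and> p \<in> chart_inv (cs j) ` Cs j" using D(2) that by blast
    then have "jj p < m \<and> p \<in> chart_inv (cs (jj p)) ` Cs (jj p)"
      unfolding jj_def by (rule LeastI_ex)
    then show "jj p < m" "p \<in> chart_inv (cs (jj p)) ` Cs (jj p)" by auto
  qed
  have inchart: "p \<in> fst (cs j)" "snd (cs j) p \<in> Cs j" if "j < m" "p \<in> chart_inv (cs j) ` Cs j" for p j
    using that C(2)[OF that(1)] chart_inv_right[OF c[OF that(1)]] by auto
  have \<sigma>: "\<sigma> q \<in> K" "\<Theta> (\<sigma> q) = q" if q: "q \<in> grassmann_bundle k N" for q
  proof -
    obtain p S where pS: "q = (p, S)" by force
    have p: "p \<in> N" using q pS by (simp add: grassmann_bundle_def)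
    note j = jj[OF p]
    note i = inchart[OF j]
    have q': "(p, S) \<in> grassmann_bundle k N" using q pS by simp
    show "\<sigma> q \<in> K"
      using trivialization_mem[OF c[OF j(1)] i(1) q'] i(2) j(1)
      unfolding \<sigma>_def K_def L_def pS by auto
    show "\<Theta> (\<sigma> q) = q"
      unfolding \<sigma>_def \<Theta> pS fst_conv by (rule chart_subspace_trivialization[OF c[OF j(1)] i(1) q'])
  qed
  have \<sigma>m: "\<sigma> \<in> measurable (grassmann_borel A k N) (restrict_space borel K)"
  proof (rule measurable_restrict_space2)
    show "\<sigma> \<in> space (grassmann_borel A k N) \<rightarrow> K" using \<sigma>(1) by simp
    show "\<sigma> \<in> borel_measurable (grassmann_borel A k N)"
    proof (rule borel_measurableI)
      fix O' :: "(real \<times> 'b \<times> ('b \<Rightarrow>\<^sub>L 'b)) set" assume O': "open O'"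
      define G :: "('a \<times> 'b set) set" where "G = grassmann_bundle k N"
      define B where "B j = {q \<in> G. fst q \<in> chart_inv (cs j) ` Cs j}" for j
      define W where "W j = {z. (real j, z) \<in> O'}" for j
      define F where "F j = {q \<in> grassmann_bundle k (fst (cs j)). trivialization A (cs j) q \<in> W j} \<inter> G" for j
      have B: "B j \<in> sets (grassmann_borel A k N)" if "j < m" for j
        unfolding B_def G_def by (rule sets_grassmann_borel_base[OF compact_imp_closed[OF D(1)[OF that]]])
      have "open (W j)" for j
        unfolding W_def using open_vimage[OF O', of "\<lambda>z. (real j, z)"]
        by (simp add: vimage_def continuous_intros)
      then have F: "F j \<in> sets (grassmann_borel A k N)" if "j < m" for j
        unfolding F_def G_def using that by (intro sets_grassmann_borel_openin openin_grassmann_trivialization c)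
      \<comment> \<open>On the set where \<open>j\<close> is the least index,
        \<open>\<sigma>\<close> is the continuous trivialisation of one chart. Finitely many such
        sets partition the bundle over \<open>N\<close>.\<close>
      have "\<sigma> -` O' \<inter> G = (\<Union>j<m. (B j - (\<Union>i<j. B i)) \<inter> F j)"
      proof (rule set_eqI)
        fix q
        show "q \<in> \<sigma> -` O' \<inter> G \<longleftrightarrow> q \<in> (\<Union>j<m. (B j - (\<Union>i<j. B i)) \<inter> F j)"
        proof (cases "q \<in> G")
          case True
          then have p: "fst q \<in> N" and q: "q \<in> grassmann_bundle k N"
            by (auto simp: G_def grassmann_bundle_def)
          have lj: "q \<in> B j - (\<Union>i<j. B i) \<longleftrightarrow> j = jj (fst q)" if "j < m" for j
          proof
            assume a: "q \<in> B j - (\<Union>i<j. B i)"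
            have "jj (fst q) \<le> j"
              unfolding jj_def by (rule Least_le) (use a that in \<open>simp add: B_def\<close>)
            moreover have "\<not> jj (fst q) < j"
              using a jj[OF p] True by (auto simp: B_def)
            ultimately show "j = jj (fst q)" by simp
          next
            assume j: "j = jj (fst q)"
            have "q \<in> B j" unfolding j B_def using True jj[OF p] by simp
            moreover have "q \<notin> B i" if "i < j" for i
              using not_less_Least[of i "\<lambda>j. j < m \<and> fst q \<in> chart_inv (cs j) ` Cs j"] that \<open>j < m\<close>
              unfolding j jj_def B_def by simp
            ultimately show "q \<in> B j - (\<Union>i<j. B i)" by blast
          qed
          have "q \<in> (\<Union>j<m. (B j - (\<Union>i<j. B i)) \<inter> F j) \<longleftrightarrow> q \<in> F (jj (fst q))"
            using lj jj(1)[OF p] by auto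
          also have "\<dots> \<longleftrightarrow> \<sigma> q \<in> O'"
            unfolding F_def W_def \<sigma>_def using True inchart(1)[OF jj[OF p]]
            by (auto simp: G_def grassmann_bundle_def)
          finally show ?thesis using True by simp
        qed (simp add: F_def)
      qed
      also have "\<dots> \<in> sets (grassmann_borel A k N)"
        using B F by (intro sets.finite_UN sets.Int sets.Diff) auto
      finally show "\<sigma> -` O' \<inter> space (grassmann_borel A k N) \<in> sets (grassmann_borel A k N)"
        by (simp add: G_def)
    qed
  qed
  have "continuous_on K (\<lambda>z. case \<Theta> z of (p, S) \<Rightarrow> div_on A g X p S)" if X: "smooth_vector_field A X" for X
    unfolding K_def
  \<comment> \<open>The pieces are closed and finite in number, so continuity can be checked on each
    of them.\<close>
  proof (rule continuous_on_closed_Union)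
    fix j assume "j \<in> {..<m}"
    then have j: "j < m" by simp
    show "closed ({real j} \<times> L j)"
      using cL[OF j] by (intro closed_Times) (auto simp: compact_imp_closed)
    have "continuous_on ({real j} \<times> L j) (\<lambda>z. chart_divergence X (cs j) (snd z))"
      by (rule continuous_on_compose2[OF continuous_on_chart_divergence[OF X c[OF j] C(1)[OF j] C(2)[OF j]]
            continuous_on_snd[OF continuous_on_id]]) (auto simp: L_def)
    then show "continuous_on ({real j} \<times> L j) (\<lambda>z. case \<Theta> z of (p, S) \<Rightarrow> div_on A g X p S)"
    proof (rule continuous_on_eq)
      fix z assume "z \<in> {real j} \<times> L j"
      then obtain x P where z: "z = (real j, x, P)" "x \<in> Cs j" "P \<in> projections k"
        by (auto simp: L_def)
      have x: "x \<in> chart_image (cs j)" using C(2)[OF j] z(2) by blast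
      obtain p S where pS: "chart_subspace (cs j) (x, P) = (p, S)" by force
      have "p \<in> fst (cs j)" "subspace S"
        using chart_subspace_in_grassmann_bundle[OF c[OF j] x z(3)] chart_inv_right(1)[OF c[OF j] x]
        unfolding pS by (auto simp: grassmann_bundle_def)
      from div_on_trivialization[OF X this(2) c[OF j] this(1)]
      show "chart_divergence X (cs j) (snd z) = (case \<Theta> z of (p, S) \<Rightarrow> div_on A g X p S)"
        unfolding z(1) \<Theta> using trivialization_chart_subspace[OF c[OF j] x z(3)] pS by simp
    qed
  qed simp
  then show ?thesis
    using that[OF cK \<Theta>m \<sigma>m \<sigma>(2)] by blast
qed

text \<open>On the bundle the divergence is \<open>f \<circ> \<sigma>\<close> with \<open>f\<close>
  continuous on the compact set \<open>K\<close>: measurability comes from \<open>\<sigma>\<close>,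
  the bound from \<open>f\<close>.\<close>

lemma div_on_borel_bounded:
  assumes N: "compact N" and X: "smooth_vector_field A X"
  shows "(\<lambda>(p, S). div_on A g X p S) \<in> borel_measurable (grassmann_borel A k N)"
    and "\<exists>B. \<forall>q\<in>grassmann_bundle k N. \<bar>case q of (p, S) \<Rightarrow> div_on A g X p S\<bar> \<le> B"
proof -
  obtain K :: "(real \<times> 'b \<times> ('b \<Rightarrow>\<^sub>L 'b)) set" and \<Theta> \<sigma> where K: "compact K"
    and \<Theta>: "\<Theta> \<in> measurable (restrict_space borel K) (grassmann_borel A k N)"
    and \<sigma>: "\<sigma> \<in> measurable (grassmann_borel A k N) (restrict_space borel K)"
    and inv: "\<And>q. q \<in> grassmann_bundle k N \<Longrightarrow> \<Theta> (\<sigma> q) = q"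
    and c: "\<And>X. smooth_vector_field A X \<Longrightarrow> continuous_on K (\<lambda>z. case \<Theta> z of (p, S) \<Rightarrow> div_on A g X p S)"
    by (rule varifold_coding[OF N, of k]) blast
  define f where "f z = (case \<Theta> z of (p, S) \<Rightarrow> div_on A g X p S)" for z
  have f: "continuous_on K f" unfolding f_def by (rule c[OF X])
  have eq: "f (\<sigma> q) = (case q of (p, S) \<Rightarrow> div_on A g X p S)" if "q \<in> grassmann_bundle k N" for q
    unfolding f_def inv[OF that] ..
  have "(\<lambda>q. f (\<sigma> q)) \<in> borel_measurable (grassmann_borel A k N)"
    by (rule measurable_compose[OF \<sigma> borel_measurable_continuous_on_restrict[OF f]])
  then show "(\<lambda>(p, S). div_on A g X p S) \<in> borel_measurable (grassmann_borel A k N)"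
    by (rule measurable_cong[THEN iffD1, rotated]) (simp add: eq)
  have "bounded (f ` K)"
    using f K by (simp add: compact_continuous_image compact_imp_bounded)
  then obtain B where B: "\<And>z. z \<in> K \<Longrightarrow> \<bar>f z\<bar> \<le> B"
    by (auto simp: bounded_iff)
  have "\<sigma> q \<in> K" if "q \<in> grassmann_bundle k N" for q
    using measurable_space[OF \<sigma>, of q] that by (simp add: space_restrict_space)
  then show "\<exists>B. \<forall>q\<in>grassmann_bundle k N. \<bar>case q of (p, S) \<Rightarrow> div_on A g X p S\<bar> \<le> B"
    using B eq by metis
qed

section \<open>Integrals over varifolds and weak limits\<close>

lemma varifold_space: "varifold A k N V \<Longrightarrow> space V = grassmann_bundle k N"
  using sets_eq_imp_space_eq[of V "grassmann_borel A k N"] by (simp add: varifold_def)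

lemma varifold_div_on:
  assumes N: "compact N" and V: "varifold A k N V" and X: "smooth_vector_field A X"
  shows "(\<lambda>(p, S). div_on A g X p S) \<in> borel_measurable V"
    and "integrable V (\<lambda>(p, S). div_on A g X p S)"
proof -
  interpret finite_measure V using V by (simp add: varifold_def)
  have "sets V = sets (grassmann_borel A k N)" using V by (simp add: varifold_def)
  from measurable_cong_sets[OF this refl]
  show m: "(\<lambda>(p, S). div_on A g X p S) \<in> borel_measurable V"
    using div_on_borel_bounded(1)[OF N X] by blast
  obtain B where "\<forall>q\<in>grassmann_bundle k N. \<bar>case q of (p, S) \<Rightarrow> div_on A g X p S\<bar> \<le> B"
    using div_on_borel_bounded(2)[OF N X] by blast
  then show "integrable V (\<lambda>(p, S). div_on A g X p S)"
    using m varifold_space[OF V] by (intro integrable_const_bound[of _ B]) auto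
qed

text \<open>Since \<open>\<Theta> (\<sigma> q) = q\<close>, integrating \<open>f\<close> against the
  image of \<open>V n\<close> under \<open>\<sigma>\<close> gives its first variation. The weak
  limit \<open>R\<close> on \<open>K\<close> is mapped by \<open>\<Theta>\<close>, which makes its
  integral of \<open>f\<close> the first variation of \<open>L\<close>.\<close>

theorem varifold_convergent_subsequence:
  assumes N: "compact N" and V: "\<And>n. varifold A k N (V n)" "\<And>n. prob_space (V n)"
  obtains r :: "nat \<Rightarrow> nat" and L where "strict_mono r" "varifold A k N L" "prob_space L"
    "\<And>X. smooth_vector_field A X \<Longrightarrow>
      (\<lambda>n. first_variation A g (V (r n)) X) \<longlonglongrightarrow> first_variation A g L X"
proof -
  obtain K :: "(real \<times> 'b \<times> ('b \<Rightarrow>\<^sub>L 'b)) set" and \<Theta> \<sigma> where K: "compact K"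
    and \<Theta>: "\<Theta> \<in> measurable (restrict_space borel K) (grassmann_borel A k N)"
    and \<sigma>: "\<sigma> \<in> measurable (grassmann_borel A k N) (restrict_space borel K)"
    and inv: "\<And>q. q \<in> grassmann_bundle k N \<Longrightarrow> \<Theta> (\<sigma> q) = q"
    and c: "\<And>X. smooth_vector_field A X \<Longrightarrow> continuous_on K (\<lambda>z. case \<Theta> z of (p, S) \<Rightarrow> div_on A g X p S)"
    by (rule varifold_coding[OF N, of k]) blast
  have sV: "sets (V n) = sets (grassmann_borel A k N)" for n using V(1) by (simp add: varifold_def)
  have \<sigma>V: "\<sigma> \<in> measurable (V n) (restrict_space borel K)" for n
    using \<sigma> measurable_cong_sets[OF sV refl] by blast
  define M where "M n = distr (V n) (restrict_space borel K) \<sigma>" for n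
  have M: "prob_space (M n)" "sets (M n) = sets (restrict_space borel K)" for n
    unfolding M_def by (rule prob_space.prob_space_distr[OF V(2) \<sigma>V]) simp
  obtain r R where r: "strict_mono r" and R: "prob_space R" "sets R = sets (restrict_space borel K)"
    and lim: "\<And>f :: real \<times> 'b \<times> ('b \<Rightarrow>\<^sub>L 'b) \<Rightarrow> real. continuous_on K f \<Longrightarrow>
      (\<lambda>n. integral\<^sup>L (M (r n)) f) \<longlonglongrightarrow> integral\<^sup>L R f"
    by (rule compact_prob_space_convergent_subsequence[of K M, OF K M]) blast
  have \<Theta>R: "\<Theta> \<in> measurable R (grassmann_borel A k N)"
    using \<Theta> measurable_cong_sets[OF R(2) refl] by blast
  define L where "L = distr R (grassmann_borel A k N) \<Theta>"
  have L: "prob_space L" unfolding L_def by (rule prob_space.prob_space_distr[OF R(1) \<Theta>R])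
  have "varifold A k N L"
    using L prob_space.finite_measure by (auto simp: varifold_def L_def)
  moreover have "(\<lambda>n. first_variation A g (V (r n)) X) \<longlonglongrightarrow> first_variation A g L X"
    if X: "smooth_vector_field A X" for X
  proof -
    define f where "f z = (case \<Theta> z of (p, S) \<Rightarrow> div_on A g X p S)" for z
    have f: "continuous_on K f" unfolding f_def by (rule c[OF X])
    have "integral\<^sup>L (M n) f = first_variation A g (V n) X" for n
    proof -
      have "integral\<^sup>L (M n) f = (\<integral>q. f (\<sigma> q) \<partial>V n)"
        unfolding M_def by (rule integral_distr[OF \<sigma>V borel_measurable_continuous_on_restrict[OF f]])
      also have "\<dots> = first_variation A g (V n) X"
        unfolding first_variation_def
        by (rule Bochner_Integration.integral_cong[OF refl])
           (simp add: f_def inv varifold_space[OF V(1)])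
      finally show ?thesis .
    qed
    moreover have "first_variation A g L X = integral\<^sup>L R f"
      unfolding first_variation_def L_def f_def
      by (rule integral_distr[OF \<Theta>R div_on_borel_bounded(1)[OF N X]])
    ultimately show ?thesis using lim[OF f] by simp
  qed
  ultimately show ?thesis using that[OF r _ L] by blast
qed

end

section \<open>Bounded vector fields\<close>

context riemannian_manifold
begin

definition smooth_scalar :: "('a \<Rightarrow> real) \<Rightarrow> bool" where
  "smooth_scalar h \<longleftrightarrow> (\<forall>c\<in>A. smooth_on (chart_image c) (\<lambda>x. h (chart_inv c x)))"

lemma smooth_scalar_const: "smooth_scalar (\<lambda>p. r)"
  by (simp add: smooth_scalar_def smooth_on_const)

lemma vf_rep_scaleR:
  assumes "c \<in> A" "x \<in> chart_image c"
  shows "vf_rep A (\<lambda>p. h p *\<^sub>R X p) c x = h (chart_inv c x) *\<^sub>R vf_rep A X c x"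
  unfolding vf_rep_def using linear_cmul[OF linear_to_chart] assms by simp

lemma smooth_vector_field_scaleR:
  assumes X: "smooth_vector_field A X" and h: "smooth_scalar h"
  shows "smooth_vector_field A (\<lambda>p. h p *\<^sub>R X p)"
  unfolding smooth_vector_field_def
proof
  fix c assume c: "c \<in> A"
  have "smooth_on (chart_image c) (\<lambda>x. h (chart_inv c x) *\<^sub>R vf_rep A X c x)"
    using X h c by (intro smooth_on_scaleR chart_open) (auto simp: smooth_vector_field_def smooth_scalar_def)
  then show "smooth_on (chart_image c) (vf_rep A (\<lambda>p. h p *\<^sub>R X p) c)"
    using smooth_on_cong[OF chart_open(2)[OF c] vf_rep_scaleR[OF c]] by simp
qed

lemma smooth_vector_field_zero: "smooth_vector_field A (\<lambda>p. 0)"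
  unfolding smooth_vector_field_def
proof
  fix c assume c: "c \<in> A"
  have "vf_rep A (\<lambda>p. 0) c x = 0" if "x \<in> chart_image c" for x
    unfolding vf_rep_def using linear_0[OF linear_to_chart] c that by simp
  then show "smooth_on (chart_image c) (vf_rep A (\<lambda>p. 0) c)"
    using smooth_on_cong[OF chart_open(2)[OF c], of "vf_rep A (\<lambda>p. 0) c" "\<lambda>x. 0"] smooth_on_const by simp
qed

lemma smooth_scalar_norm_square:
  assumes X: "smooth_vector_field A X"
  shows "smooth_scalar (\<lambda>p. g p (X p) (X p))"
  unfolding smooth_scalar_def
proof
  fix c assume c: "c \<in> A"
  have vf: "smooth_on (chart_image c) (vf_rep A X c)" using X c by (simp add: smooth_vector_field_def)
  have sm: "smooth_on (chart_image c) (\<lambda>x. \<Sum>i\<in>Basis. \<Sum>j\<in>Basis.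
      (vf_rep A X c x \<bullet> i) * (vf_rep A X c x \<bullet> j) * metric_rep A g c x i j)"
    by (intro smooth_on_sum smooth_on_mult smooth_on_inner chart_open vf smooth_on_const metric_rep_smooth c)
  have eq: "g (chart_inv c x) (X (chart_inv c x)) (X (chart_inv c x)) =
      (\<Sum>i\<in>Basis. \<Sum>j\<in>Basis. (vf_rep A X c x \<bullet> i) * (vf_rep A X c x \<bullet> j) * metric_rep A g c x i j)"
    if x: "x \<in> chart_image c" for x
    unfolding bilinear_euclidean_sum[OF bilinear_metric_rep[OF c x], symmetric] vf_rep_def
    using metric_rep_to_chart[OF c chart_inv_right(1)[OF c x]] chart_inv_right(2)[OF c x] by simp
  show "smooth_on (chart_image c) (\<lambda>x. g (chart_inv c x) (X (chart_inv c x)) (X (chart_inv c x)))"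
    by (rule smooth_on_cong[THEN iffD2, OF chart_open(2)[OF c] _ sm]) (rule eq)
qed

lemma smooth_scalar_damping:
  assumes h: "smooth_scalar h" and pos: "\<And>p. 0 \<le> h p" and e: "0 \<le> e"
  shows "smooth_scalar (\<lambda>p. inverse (1 + e * h p))"
  unfolding smooth_scalar_def
proof
  fix c assume c: "c \<in> A"
  have nz: "1 + e * h p \<noteq> 0" for p using mult_nonneg_nonneg[OF e pos[of p]] by linarith
  show "smooth_on (chart_image c) (\<lambda>x. inverse (1 + e * h (chart_inv c x)))"
    using h c nz by (intro smooth_on_inverse smooth_on_add smooth_on_mult smooth_on_const chart_open)
      (auto simp: smooth_scalar_def)
qed

section \<open>The product rule for the divergence\<close>

definition scalar_deriv :: "('a \<Rightarrow> real) \<Rightarrow> 'a \<Rightarrow> 'b \<Rightarrow> real" where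
  "scalar_deriv h p = frechet_derivative (\<lambda>x. h (chart_inv (chart_at A p) x)) (at (snd (chart_at A p) p))"

lemma scalar_has_derivative:
  "smooth_scalar h \<Longrightarrow>
    ((\<lambda>x. h (chart_inv (chart_at A p) x)) has_derivative scalar_deriv h p) (at (snd (chart_at A p) p))"
  unfolding scalar_deriv_def smooth_scalar_def by (rule smooth_on_has_derivative) auto

text \<open>The added sum is the pairing of the gradient of \<open>h\<close> along the plane with
  \<open>X\<close>. A single \<open>E\<close> for all \<open>X\<close> and \<open>h\<close> lets
  this sum be compared for different scalars.\<close>

lemma div_on_scaleR:
  assumes S: "subspace S"
  obtains E where "\<And>X h. smooth_vector_field A X \<Longrightarrow> smooth_scalar h \<Longrightarrow>
    div_on A g (\<lambda>p. h p *\<^sub>R X p) p S = h p * div_on A g X p S + (\<Sum>e\<in>E. scalar_deriv h p e * g p (X p) e)"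
proof -
  define c where "c = chart_at A p"
  define x where "x = snd c p"
  have c: "c \<in> A" "p \<in> fst c" "x \<in> chart_image c" "chart_inv c x = p" by (auto simp: c_def x_def)
  note m = bilinear_metric_rep[OF c(1,3)]
  obtain E where E: "\<And>X. smooth_vector_field A X \<Longrightarrow> div_on A g X p S = (\<Sum>e\<in>E. div_form X c x e e)"
    using div_on_sum[OF S, of p] unfolding c_def x_def by metis
  have form: "div_form (\<lambda>p. h p *\<^sub>R X p) c x e e = h p * div_form X c x e e + scalar_deriv h p e * g p (X p) e"
    if X: "smooth_vector_field A X" and h: "smooth_scalar h" for X h e
  proof -
    define Z where "Z = vf_rep A X c"
    have Z: "(Z has_derivative frechet_derivative Z (at x)) (at x)"
      unfolding Z_def by (rule vf_rep_has_derivative[OF X c(1,3)])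
    have hd: "((\<lambda>x. h (chart_inv c x)) has_derivative scalar_deriv h p) (at x)"
      using scalar_has_derivative[OF h, of p] by (simp add: c_def x_def)
    have "(vf_rep A (\<lambda>p. h p *\<^sub>R X p) c has_derivative
        (\<lambda>w. h (chart_inv c x) *\<^sub>R frechet_derivative Z (at x) w + scalar_deriv h p w *\<^sub>R Z x)) (at x)"
      by (rule has_derivative_transform_within_open[OF has_derivative_scaleR[OF hd Z] chart_open(2)[OF c(1)] c(3)])
         (simp add: vf_rep_scaleR[OF c(1)] Z_def)
    from differentiable_frechetI[OF this]
    have 1: "frechet_derivative (vf_rep A (\<lambda>p. h p *\<^sub>R X p) c) (at x) e
        = h p *\<^sub>R frechet_derivative Z (at x) e + scalar_deriv h p e *\<^sub>R Z x" by (simp add: c(4))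
    have 2: "vf_rep A (\<lambda>p. h p *\<^sub>R X p) c x = h p *\<^sub>R Z x"
      by (simp add: vf_rep_scaleR[OF c(1,3)] Z_def c(4))
    have 3: "metric_rep A g c x (Z x) e = g p (X p) e"
      using metric_rep_chart_at[of p "Z x" e] vf_rep_chart[OF c(1,2), of X] tangent_change_id[OF c(1,2)]
      by (simp add: c_def x_def Z_def to_chart_def)
    show ?thesis
      unfolding div_form_def 1 2 Z_def[symmetric]
      by (simp add: bilinear_ladd[OF m] bilinear_lmul[OF m] 3 linear_cmul[OF metric_deriv_linear[OF c(1,3)]]
        distrib_left)
  qed
  show ?thesis
  proof (rule that[of E])
    fix X h assume X: "smooth_vector_field A X" and h: "smooth_scalar h"
    show "div_on A g (\<lambda>p. h p *\<^sub>R X p) p S = h p * div_on A g X p S + (\<Sum>e\<in>E. scalar_deriv h p e * g p (X p) e)"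
      unfolding E[OF X] E[OF smooth_vector_field_scaleR[OF X h]] form[OF X h]
      by (simp add: sum.distrib sum_distrib_left)
  qed
qed

lemma div_on_const_scaleR:
  assumes "subspace S" "smooth_vector_field A X"
  shows "div_on A g (\<lambda>p. r *\<^sub>R X p) p S = r * div_on A g X p S"
proof -
  obtain E where E: "\<And>X h. smooth_vector_field A X \<Longrightarrow> smooth_scalar h \<Longrightarrow>
    div_on A g (\<lambda>p. h p *\<^sub>R X p) p S = h p * div_on A g X p S + (\<Sum>e\<in>E. scalar_deriv h p e * g p (X p) e)"
    by (rule div_on_scaleR[OF assms(1), of p]) blast
  have "scalar_deriv (\<lambda>p. r) p e = 0" for e
    by (simp add: scalar_deriv_def frechet_derivative_const)
  then show ?thesis
    using E[OF assms(2) smooth_scalar_const[of r]] by simp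
qed

text \<open>Dividing \<open>X\<close> by \<open>1 + \<epsilon> |X|\<^sup>2\<close> makes it bounded. The correction term of the divergence is
  expressed through \<open>|X|\<^sup>2 X\<close>, whose divergence is measurable and bounded on compact sets.\<close>

lemma div_on_damping:
  assumes S: "subspace S" and X: "smooth_vector_field A X" and u: "u = (\<lambda>p. g p (X p) (X p))" and e: "0 \<le> e"
  shows "div_on A g (\<lambda>p. inverse (1 + e * u p) *\<^sub>R X p) p S =
    inverse (1 + e * u p) * div_on A g X p S
    - e * (inverse (1 + e * u p))\<^sup>2 * (div_on A g (\<lambda>p. u p *\<^sub>R X p) p S - u p * div_on A g X p S)"
proof -
  have pos: "0 \<le> u p" for p
    unfolding u by (rule metric_nonneg)
  have su: "smooth_scalar u" unfolding u by (rule smooth_scalar_norm_square[OF X])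
  define f where "f p = inverse (1 + e * u p)" for p
  have sf: "smooth_scalar f"
    unfolding f_def by (rule smooth_scalar_damping[OF su pos e])
  have nz: "1 + e * u p \<noteq> 0" using mult_nonneg_nonneg[OF e pos[of p]] by linarith
  define c where "c = chart_at A p"
  define x where "x = snd c p"
  have cx: "chart_inv c x = p" by (simp add: c_def x_def)
  have du: "((\<lambda>x. u (chart_inv c x)) has_derivative scalar_deriv u p) (at x)"
    using scalar_has_derivative[OF su, of p] by (simp add: c_def x_def)
  have nz': "1 + e * u (chart_inv c x) \<noteq> 0" using nz cx by simp
  have "((\<lambda>x. inverse (1 + e * u (chart_inv c x))) has_derivative
     (\<lambda>h. - (inverse (1 + e * u (chart_inv c x)) * (0 + e * scalar_deriv u p h) * inverse (1 + e * u (chart_inv c x))))) (at x)"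
    by (rule Deriv.has_derivative_inverse[OF nz'
        has_derivative_add[OF has_derivative_const has_derivative_mult_right[OF du]]])
  from differentiable_frechetI[OF this]
  have fd: "scalar_deriv f p v = - e * (f p)\<^sup>2 * scalar_deriv u p v" for v
    unfolding scalar_deriv_def[of f] f_def c_def[symmetric] x_def[symmetric]
    by (simp add: cx power2_eq_square mult_ac)
  obtain E where E: "\<And>X h. smooth_vector_field A X \<Longrightarrow> smooth_scalar h \<Longrightarrow>
    div_on A g (\<lambda>p. h p *\<^sub>R X p) p S = h p * div_on A g X p S + (\<Sum>e\<in>E. scalar_deriv h p e * g p (X p) e)"
    by (rule div_on_scaleR[OF S, of p]) blast
  \<comment> \<open>The gradient of the damping factor is a multiple of that of \<open>u\<close>, so
    its sum is proportional to the one for \<open>u\<close>, which is then eliminated as a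
    difference of divergences.\<close>
  have "(\<Sum>v\<in>E. scalar_deriv f p v * g p (X p) v) = - e * (f p)\<^sup>2 * (\<Sum>v\<in>E. scalar_deriv u p v * g p (X p) v)"
    unfolding fd by (simp add: sum_distrib_left mult_ac sum_negf)
  then have "div_on A g (\<lambda>p. f p *\<^sub>R X p) p S = f p * div_on A g X p S
    - e * (f p)\<^sup>2 * (div_on A g (\<lambda>p. u p *\<^sub>R X p) p S - u p * div_on A g X p S)"
    using E[OF X sf] E[OF X su] by simp
  then show ?thesis by (simp add: f_def)
qed

lemma varifold_subspace:
  assumes V: "varifold A k N V" and q: "q \<in> space V"
  shows "subspace (snd q)"
proof -
  have "q \<in> grassmann_bundle k N" using q unfolding varifold_space[OF V] .
  then show ?thesis unfolding grassmann_bundle_def by auto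
qed

lemma first_variation_const_scaleR:
  assumes V: "varifold A k N V" and X: "smooth_vector_field A X"
  shows "first_variation A g V (\<lambda>p. r *\<^sub>R X p) = r * first_variation A g V X"
proof -
  have "first_variation A g V (\<lambda>p. r *\<^sub>R X p) = (\<integral>q. r * (case q of (p, S) \<Rightarrow> div_on A g X p S) \<partial>V)"
    unfolding first_variation_def
  proof (rule Bochner_Integration.integral_cong[OF refl])
    fix q assume "q \<in> space V"
    then have "subspace (snd q)" by (rule varifold_subspace[OF V])
    then show "(case q of (p, S) \<Rightarrow> div_on A g (\<lambda>p. r *\<^sub>R X p) p S) = r * (case q of (p, S) \<Rightarrow> div_on A g X p S)"
      using div_on_const_scaleR[OF _ X] by (simp add: case_prod_beta)
  qed
  then show ?thesis by (simp add: first_variation_def)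
qed

section \<open>Bounded fields detect stationarity\<close>

definition unit_fields :: "('a \<Rightarrow> 'b) set" where
  "unit_fields = {X. smooth_vector_field A X \<and> (\<forall>p. sqrt (g p (X p) (X p)) \<le> 1)}"

lemma total_first_variation_unit_fields:
  "total_first_variation A g V = (SUP X\<in>unit_fields. ereal (first_variation A g V X))"
  by (simp add: total_first_variation_def unit_fields_def)

lemma zero_unit_field: "(\<lambda>p. 0) \<in> unit_fields"
  using smooth_vector_field_zero bilinear_lzero[OF metric_bilinear] by (auto simp: unit_fields_def)

lemma minus_unit_field:
  assumes "X \<in> unit_fields"
  shows "(\<lambda>p. (- 1) *\<^sub>R X p) \<in> unit_fields"
  using assms smooth_vector_field_scaleR[OF _ smooth_scalar_const[of "- 1"]]
  unfolding unit_fields_def by (auto simp: bilinear_lneg[OF metric_bilinear] bilinear_rneg[OF metric_bilinear])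

lemma total_first_variation_nonneg:
  assumes V: "varifold A k N V"
  shows "0 \<le> total_first_variation A g V"
proof -
  have "first_variation A g V (\<lambda>p. 0) = 0"
    using first_variation_const_scaleR[OF V smooth_vector_field_zero, of 0] by simp
  then show ?thesis
    unfolding total_first_variation_unit_fields using SUP_upper[OF zero_unit_field, of "\<lambda>X. ereal (first_variation A g V X)"]
    by (simp add: zero_ereal_def)
qed

lemma total_first_variation_stationary:
  assumes "stationary A g V"
  shows "total_first_variation A g V = 0"
proof -
  have "total_first_variation A g V = (SUP X\<in>unit_fields. 0)"
    unfolding total_first_variation_unit_fields
  proof (rule SUP_cong[OF refl])
    show "ereal (first_variation A g V X) = 0" if "X \<in> unit_fields" for X
      using assms that unfolding stationary_def unit_fields_def by simp
  qed
  also have "\<dots> = 0" using zero_unit_field by (intro SUP_const) blast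
  finally show ?thesis .
qed

text \<open>Each damped field is bounded and hence a multiple of a unit field, so its first
  variation vanishes. Dominated convergence carries the vanishing over to \<open>X\<close>; only
  pointwise convergence of the divergences and an integrable bound are required.\<close>

lemma stationary_if_unit_fields:
  assumes N: "compact N" and V: "varifold A k N V"
    and zero: "\<And>X. X \<in> unit_fields \<Longrightarrow> first_variation A g V X = 0"
  shows "stationary A g V"
  unfolding stationary_def
proof (intro allI impI)
  fix X assume X: "smooth_vector_field A X"
  define u where "u = (\<lambda>p. g p (X p) (X p))"
  have pos: "0 \<le> u p" for p
    unfolding u_def by (rule metric_nonneg)
  have su: "smooth_scalar u" unfolding u_def by (rule smooth_scalar_norm_square[OF X])
  define \<epsilon> where "\<epsilon> n = 1 / real (Suc n)" for n
  have \<epsilon>: "0 < \<epsilon> n" "\<epsilon> n \<le> 1" for n by (auto simp: \<epsilon>_def divide_simps)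
  define f where "f n p = inverse (1 + \<epsilon> n * u p)" for n p
  have one: "1 \<le> 1 + \<epsilon> n * u p" for n p using \<epsilon>(1)[of n] pos[of p] by simp
  have f: "0 < f n p" "f n p \<le> 1" for n p
    using one[of n p] unfolding f_def by (auto intro: inverse_le_1_iff[THEN iffD2])
  define Y where "Y n = (\<lambda>p. f n p *\<^sub>R X p)" for n
  have sY: "smooth_vector_field A (Y n)" for n
    unfolding Y_def f_def
    using \<epsilon>(1)[of n] by (intro smooth_vector_field_scaleR[OF X] smooth_scalar_damping[OF su pos]) simp
  have Y0: "first_variation A g V (Y n) = 0" for n
  proof -
    \<comment> \<open>The squared length of \<open>Y n\<close> is u / (1 + \<epsilon> u)^2, at most
      1 / (4 \<epsilon>) because 4t <= (1 + t)^2. Multiplication by \<open>r\<close> normalises this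
      bound to 1.\<close>
    define r where "r = 2 * sqrt (\<epsilon> n)"
    have r: "r > 0" using \<epsilon>(1)[of n] by (simp add: r_def)
    have "g p (r *\<^sub>R Y n p) (r *\<^sub>R Y n p) \<le> 1" for p
    proof -
      have "4 * (\<epsilon> n * u p) \<le> (1 + \<epsilon> n * u p)\<^sup>2"
        using zero_le_power2[of "1 - \<epsilon> n * u p"] by (simp add: power2_eq_square algebra_simps)
      then have "4 * (\<epsilon> n * u p) / (1 + \<epsilon> n * u p)\<^sup>2 \<le> 1"
        using one[of n p] by (simp add: divide_le_eq_1)
      moreover have "g p (r *\<^sub>R Y n p) (r *\<^sub>R Y n p) = r\<^sup>2 * (f n p)\<^sup>2 * u p"
        by (simp add: Y_def u_def bilinear_lmul[OF metric_bilinear] bilinear_rmul[OF metric_bilinear] power2_eq_square)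
      moreover have "r\<^sup>2 = 4 * \<epsilon> n" using \<epsilon>(1)[of n] by (simp add: r_def power_mult_distrib)
      ultimately show ?thesis
        by (simp add: f_def power_inverse divide_inverse mult_ac)
    qed
    then have "(\<lambda>p. r *\<^sub>R Y n p) \<in> unit_fields"
      using smooth_vector_field_scaleR[OF sY[of n] smooth_scalar_const[of r]] by (simp add: unit_fields_def)
    from zero[OF this] show ?thesis
      using first_variation_const_scaleR[OF V sY[of n], of r] r by simp
  qed
  define D where "D = (\<lambda>q. case q of (p, S) \<Rightarrow> div_on A g X p S)"
  define G where "G = (\<lambda>q. case q of (p, S) \<Rightarrow> div_on A g (\<lambda>p. u p *\<^sub>R X p) p S)"
  have suX: "smooth_vector_field A (\<lambda>p. u p *\<^sub>R X p)" by (rule smooth_vector_field_scaleR[OF X su])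
  have eq: "(case q of (p, S) \<Rightarrow> div_on A g (Y n) p S) =
      f n (fst q) * D q - \<epsilon> n * (f n (fst q))\<^sup>2 * (G q - u (fst q) * D q)" if q: "q \<in> space V" for n q
  proof -
    have "subspace (snd q)" using q by (rule varifold_subspace[OF V])
    from div_on_damping[OF this X u_def less_imp_le[OF \<epsilon>(1)], of n "fst q"] show ?thesis
      by (simp add: Y_def f_def D_def G_def case_prod_beta)
  qed
  have "(\<lambda>n. \<integral>q. (case q of (p, S) \<Rightarrow> div_on A g (Y n) p S) \<partial>V) \<longlonglongrightarrow> (\<integral>q. D q \<partial>V)"
  \<comment> \<open>The damped divergence is (a + b u) D - b G with a, b and b u in [0, 1], whatever
    \<open>n\<close>; hence the coefficients 2 and 1. The field behind \<open>G\<close> is smooth,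
    so \<open>G\<close> is integrable.\<close>
  proof (rule integral_dominated_convergence[where w = "\<lambda>q. 2 * \<bar>D q\<bar> + \<bar>G q\<bar>"])
    show "D \<in> borel_measurable V"
      unfolding D_def by (rule varifold_div_on(1)[OF N V X])
    show "(\<lambda>q. case q of (p, S) \<Rightarrow> div_on A g (Y n) p S) \<in> borel_measurable V" for n
      by (rule varifold_div_on(1)[OF N V sY])
    have "integrable V D" "integrable V G"
      unfolding D_def G_def by (rule varifold_div_on(2)[OF N V X], rule varifold_div_on(2)[OF N V suX])
    then show "integrable V (\<lambda>q. 2 * \<bar>D q\<bar> + \<bar>G q\<bar>)"
      by (intro Bochner_Integration.integrable_add integrable_mult_right integrable_abs)
    show "AE q in V. (\<lambda>n. case q of (p, S) \<Rightarrow> div_on A g (Y n) p S) \<longlonglongrightarrow> D q"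
    proof (rule AE_I2)
      fix q assume q: "q \<in> space V"
      have e0: "\<epsilon> \<longlonglongrightarrow> 0"
        unfolding \<epsilon>_def[abs_def] using LIMSEQ_inverse_real_of_nat by (simp add: inverse_eq_divide)
      have "(\<lambda>n. inverse (1 + \<epsilon> n * u (fst q))) \<longlonglongrightarrow> inverse (1 + 0 * u (fst q))"
        by (intro tendsto_intros e0) simp
      then have f1: "(\<lambda>n. f n (fst q)) \<longlonglongrightarrow> 1" by (simp add: f_def)
      have "(\<lambda>n. f n (fst q) * D q - \<epsilon> n * (f n (fst q))\<^sup>2 * (G q - u (fst q) * D q)) \<longlonglongrightarrow>
          1 * D q - 0 * 1\<^sup>2 * (G q - u (fst q) * D q)"
        by (intro tendsto_intros f1 e0)
      then show "(\<lambda>n. case q of (p, S) \<Rightarrow> div_on A g (Y n) p S) \<longlonglongrightarrow> D q"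
        by (simp add: eq[OF q])
    qed
    show "AE q in V. norm (case q of (p, S) \<Rightarrow> div_on A g (Y n) p S) \<le> 2 * \<bar>D q\<bar> + \<bar>G q\<bar>" for n
    proof (rule AE_I2)
      fix q assume q: "q \<in> space V"
      define a where "a = f n (fst q)"
      define b where "b = \<epsilon> n * a\<^sup>2"
      have a: "0 < a" "a \<le> 1" using f by (auto simp: a_def)
      have "a\<^sup>2 \<le> 1" using a by (simp add: power_le_one)
      then have b: "0 \<le> b" "b \<le> 1"
        using \<epsilon>[of n] unfolding b_def by (auto intro: mult_le_one)
      have "\<epsilon> n * u (fst q) * a \<le> 1"
        using one[of n "fst q"] by (simp add: a_def f_def field_simps)
      then have "a * (\<epsilon> n * u (fst q) * a) \<le> 1"
        using a \<epsilon>(1)[of n] pos[of "fst q"] by (intro mult_le_one[OF a(2)]) simp_all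
      then have bu: "b * u (fst q) \<le> 1"
        by (simp add: b_def power2_eq_square mult_ac)
      have "a * D q - b * (G q - u (fst q) * D q) = (a + b * u (fst q)) * D q - b * G q"
        by (simp add: algebra_simps)
      also have "\<bar>\<dots>\<bar> \<le> \<bar>(a + b * u (fst q)) * D q\<bar> + \<bar>b * G q\<bar>"
        by (rule abs_triangle_ineq4)
      also have "\<dots> \<le> 2 * \<bar>D q\<bar> + 1 * \<bar>G q\<bar>"
        unfolding abs_mult using a b bu mult_nonneg_nonneg[OF b(1) pos[of "fst q"]]
        by (intro add_mono mult_right_mono) auto
      finally show "norm (case q of (p, S) \<Rightarrow> div_on A g (Y n) p S) \<le> 2 * \<bar>D q\<bar> + \<bar>G q\<bar>"
        unfolding eq[OF q] a_def[symmetric] b_def[symmetric] by simp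
    qed
  qed
  then show "first_variation A g V X = 0"
    using Y0 by (simp add: first_variation_def D_def LIMSEQ_const_iff)
qed

section \<open>From failing linear bounds to a stationary limit\<close>

text \<open>Mass and first variation are both homogeneous of degree one in the measure, so their
  ratio is kept when the mass is scaled to 1.\<close>

lemma varifold_normalize:
  assumes N: "compact N" and V: "varifold A k N V" and pos: "mass V > 0"
  obtains W where "varifold A k N W" "prob_space W"
    "\<And>X. smooth_vector_field A X \<Longrightarrow> first_variation A g W X = first_variation A g V X / mass V"
proof -
  interpret finite_measure V using V by (simp add: varifold_def)
  define W where "W = density V (\<lambda>_. ennreal (1 / mass V))"
  have "emeasure W (space V) = ennreal (1 / mass V) * emeasure V (space V)"
    unfolding W_def by (rule emeasure_density_const) simp
  also have "\<dots> = ennreal (1 / mass V) * ennreal (mass V)"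
    by (simp add: mass_def emeasure_eq_measure)
  also have "\<dots> = 1"
    using pos by (simp flip: ennreal_mult)
  finally have W: "prob_space W"
    by (intro prob_spaceI) (simp add: W_def)
  then have "varifold A k N W"
    using V prob_space.finite_measure[OF W] by (simp add: varifold_def W_def)
  moreover have "first_variation A g W X = first_variation A g V X / mass V" if "smooth_vector_field A X" for X
    unfolding first_variation_def W_def
    using varifold_div_on(1)[OF N V that] pos by (subst integral_density) (auto simp: less_imp_le)
  ultimately show ?thesis using that[OF _ W] by blast
qed

lemma mass_le_total_first_variation:
  assumes N: "compact N"
    and none: "\<not> (\<exists>V. varifold A k N V \<and> stationary A g V \<and> V \<noteq> null_measure V)"
  obtains c :: real where "\<And>V. varifold A k N V \<Longrightarrow> ereal (mass V) \<le> ereal c * total_first_variation A g V"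
proof (rule ccontr)
  assume "\<not> thesis"
  then have "\<forall>c. \<exists>V. varifold A k N V \<and> \<not> ereal (mass V) \<le> ereal c * total_first_variation A g V"
    using that by blast
  then have "\<exists>V. varifold A k N V \<and> \<not> ereal (mass V) \<le> ereal (real (Suc n)) * total_first_variation A g V" for n
    by blast
  then obtain V where V: "\<And>n. varifold A k N (V n)"
    "\<And>n. \<not> ereal (mass (V n)) \<le> ereal (real (Suc n)) * total_first_variation A g (V n)"
    by metis
  \<comment> \<open>The total first variation is nonnegative, so a failing inequality leaves a
    strictly positive mass to divide by.\<close>
  have pos: "mass (V n) > 0" for n
  proof -
    have "0 \<le> ereal (real (Suc n)) * total_first_variation A g (V n)"
      using total_first_variation_nonneg[OF V(1)] by simp
    then have "0 < ereal (mass (V n))" using V(2)[of n] by (meson le_less_trans not_le)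
    then show ?thesis by simp
  qed
  have bound: "first_variation A g (V n) X \<le> mass (V n) / real (Suc n)" if "X \<in> unit_fields" for n X
  proof -
    have "ereal (first_variation A g (V n) X) \<le> total_first_variation A g (V n)"
      unfolding total_first_variation_unit_fields by (rule SUP_upper[OF that])
    then have "ereal (real (Suc n)) * ereal (first_variation A g (V n) X)
        \<le> ereal (real (Suc n)) * total_first_variation A g (V n)"
      by (intro ereal_mult_left_mono) auto
    also have "\<dots> \<le> ereal (mass (V n))" using V(2)[of n] by simp
    finally show ?thesis by (simp add: field_simps)
  qed
  have "\<exists>W. varifold A k N W \<and> prob_space W \<and>
      (\<forall>X. smooth_vector_field A X \<longrightarrow> first_variation A g W X = first_variation A g (V n) X / mass (V n))" for n
    by (rule varifold_normalize[OF N V(1) pos]) blast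
  then obtain W where W: "\<And>n. varifold A k N (W n)" "\<And>n. prob_space (W n)"
    "\<And>n X. smooth_vector_field A X \<Longrightarrow> first_variation A g (W n) X = first_variation A g (V n) X / mass (V n)"
    by metis
  have Wle: "first_variation A g (W n) X \<le> 1 / real (Suc n)" if "X \<in> unit_fields" for n X
  proof -
    have "first_variation A g (W n) X = first_variation A g (V n) X / mass (V n)"
      using that by (intro W(3)) (simp add: unit_fields_def)
    also have "\<dots> \<le> mass (V n) / real (Suc n) / mass (V n)"
      using bound[OF that] pos by (intro divide_right_mono) (auto intro: less_imp_le)
    also have "\<dots> = 1 / real (Suc n)" using pos[of n] by simp
    finally show ?thesis .
  qed
  \<comment> \<open>The supremum controls first variations only from above; applying it to the
    negated field gives the lower bound.\<close>
  have Wabs: "\<bar>first_variation A g (W n) X\<bar> \<le> 1 / real (Suc n)" if X: "X \<in> unit_fields" for n X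
    using Wle[OF X, of n] Wle[OF minus_unit_field[OF X], of n]
      first_variation_const_scaleR[OF W(1), of X n "- 1"] X
    unfolding unit_fields_def by (auto simp: abs_le_iff)
  obtain r L where r: "strict_mono r" and L: "varifold A k N L" "prob_space L"
    and lim: "\<And>X. smooth_vector_field A X \<Longrightarrow>
      (\<lambda>n. first_variation A g (W (r n)) X) \<longlonglongrightarrow> first_variation A g L X"
    by (rule varifold_convergent_subsequence[of N k W, OF N W(1,2)]) blast
  have "stationary A g L"
  proof (rule stationary_if_unit_fields[OF N L(1)])
    fix X assume X: "X \<in> unit_fields"
    have "(\<lambda>n. 1 / real (Suc n)) \<longlonglongrightarrow> 0"
      using LIMSEQ_inverse_real_of_nat by (simp add: inverse_eq_divide)
    then have "(\<lambda>n. first_variation A g (W (r n)) X) \<longlonglongrightarrow> 0"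
    proof (rule Lim_null_comparison[rotated])
      show "\<forall>\<^sub>F n in sequentially. norm (first_variation A g (W (r n)) X) \<le> 1 / real (Suc n)"
      proof (rule always_eventually, rule allI)
        fix n
        have "\<bar>first_variation A g (W (r n)) X\<bar> \<le> 1 / real (Suc (r n))" by (rule Wabs[OF X])
        also have "\<dots> \<le> 1 / real (Suc n)"
          using seq_suble[OF r, of n] by (simp add: frac_le)
        finally show "norm (first_variation A g (W (r n)) X) \<le> 1 / real (Suc n)" by simp
      qed
    qed
    moreover have "smooth_vector_field A X" using X by (simp add: unit_fields_def)
    ultimately show "first_variation A g L X = 0" using lim LIMSEQ_unique by blast
  qed
  \<comment> \<open>Mass 1 survives the limit because everything takes place over the compact set
    \<open>N\<close>; nothing escapes.\<close>
  moreover have "L \<noteq> null_measure L"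
    using prob_space.emeasure_space_1[OF L(2)] by (metis emeasure_null_measure zero_neq_one)
  ultimately show False using none L(1) by blast
qed

lemma null_measure_if_mass_zero:
  assumes V: "varifold A k N V" and "mass V \<le> 0"
  shows "V = null_measure V"
proof -
  interpret finite_measure V using V by (simp add: varifold_def)
  have "measure V (space V) = 0" using assms(2) measure_nonneg[of V "space V"] by (simp add: mass_def)
  then have z: "emeasure V (space V) = 0" by (simp add: emeasure_eq_measure)
  show ?thesis
  proof (rule measure_eqI)
    fix B assume "B \<in> sets V"
    then have "emeasure V B \<le> emeasure V (space V)"
      by (intro emeasure_mono sets.sets_into_space sets.top)
    then show "emeasure V B = emeasure (null_measure V) B" using z by simp
  qed simp
qed

end

theorem theorem2p3:
  fixes A :: "('a::{t2_space, second_countable_topology}, 'b::euclidean_space) chart set"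
    and g :: "'a \<Rightarrow> 'b \<Rightarrow> 'b \<Rightarrow> real"
    and N :: "'a set"
    and n k :: nat
  assumes "smooth_atlas A"
    and "riemannian_metric A g"
    and "DIM('b) = n + 1"
    and "compact N"
    and "1 \<le> k" and "k \<le> n"
  shows "(\<not> (\<exists>V. varifold A k N V \<and> stationary A g V \<and> V \<noteq> null_measure V) \<longleftrightarrow>
          (\<exists>\<phi> :: real \<Rightarrow> real. \<phi> ` {0..} \<subseteq> {0..} \<and> mono_on {0..} \<phi> \<and> \<phi> 0 = 0 \<and>
             (\<forall>V. varifold A k N V \<and> total_first_variation A g V < \<infinity> \<longrightarrow>
                mass V \<le> \<phi> (real_of_ereal (total_first_variation A g V)))))
       \<and> (\<not> (\<exists>V. varifold A k N V \<and> stationary A g V \<and> V \<noteq> null_measure V) \<longleftrightarrow>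
          (\<exists>c :: real. \<forall>V. varifold A k N V \<longrightarrow>
             ereal (mass V) \<le> ereal c * total_first_variation A g V))"
    (is "(?a \<longleftrightarrow> ?b) \<and> (?a \<longleftrightarrow> ?c)")
proof -
  interpret riemannian_manifold A g
    using assms(1,2) by unfold_locales
  have ac: ?c if ?a
    using mass_le_total_first_variation[OF assms(4) that] by metis
  have cb: ?b if c: ?c
  proof -
    obtain c :: real where c: "\<And>V. varifold A k N V \<Longrightarrow> ereal (mass V) \<le> ereal c * total_first_variation A g V"
      using c by blast
    show ?b
    \<comment> \<open>The constant in (c) may be negative, for instance when only the zero varifold
      exists; truncation at 0 makes the function monotone with values in
      \<open>{0..}\<close>.\<close>
    proof (intro exI[of _ "\<lambda>t. max c 0 * t"] conjI allI impI)
      fix V assume V: "varifold A k N V \<and> total_first_variation A g V < \<infinity>"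
      then obtain t where t: "total_first_variation A g V = ereal t" "0 \<le> t"
        using total_first_variation_nonneg[of k N V] by (cases "total_first_variation A g V") auto
      have "mass V \<le> c * t" using c[of V] V t by simp
      also have "\<dots> \<le> max c 0 * t" using t(2) by (intro mult_right_mono) auto
      finally show "mass V \<le> max c 0 * real_of_ereal (total_first_variation A g V)" by (simp add: t)
    qed (auto intro!: mono_onI mult_left_mono)
  qed
  have ba: ?a if b: ?b
  proof
    obtain \<phi> :: "real \<Rightarrow> real" where \<phi>: "\<phi> 0 = 0"
      "\<And>V. varifold A k N V \<Longrightarrow> total_first_variation A g V < \<infinity> \<Longrightarrow>
        mass V \<le> \<phi> (real_of_ereal (total_first_variation A g V))"
      using b by blast
    assume "\<exists>V. varifold A k N V \<and> stationary A g V \<and> V \<noteq> null_measure V"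
    then obtain V where V: "varifold A k N V" "stationary A g V" "V \<noteq> null_measure V" by blast
    \<comment> \<open>For a stationary varifold the bound is evaluated at 0, where
      \<open>\<phi>\<close> vanishes.\<close>
    have "mass V \<le> 0"
      using \<phi>(2)[OF V(1)] total_first_variation_stationary[OF V(2)] \<phi>(1) by simp
    then show False using null_measure_if_mass_zero[OF V(1)] V(3) by blast
  qed
  show ?thesis using ac cb ba by blast
qed

end
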